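(* Let $T>0$, $\sigma>0$, $\mu\in\mathbb{R}$, and consider the optimal prediction problem $$V_1=\inf_{0\le\tau\le T}\mathsf{E}\Big(\frac{M_T}{Z_\tau}\Big)=\inf_{0\le\tau\le T}\mathsf{E}\big(e^{\sigma(S^\lambda_T-B^\lambda_\tau)}\big),\qquad \lambda=(\mu-\sigma^2/2)/\sigma,$$ where the infimum is over all stopping times $\tau$ of $Z$ (equivalently of $B$) with values in $[0,T]$. If $\lambda\ge\sigma/2$ then $$\mathsf{E}\big(e^{\sigma(S^\lambda_T-B^\lambda_\tau)}\big)\ge\mathsf{E}\big(e^{\sigma(S^\lambda_T-B^\lambda_T)}\big)\qquad (1)$$ for all stopping times $\tau$ of $B$ taking values in $[0,T]$. If $\lambda\le-\sigma/2$ then $$\mathsf{E}\big(e^{\sigma(S^\lambda_T-B^\lambda_\tau)}\big)\ge\mathsf{E}\big(e^{\sigma S^\lambda_T}\big)\qquad (2)$$ for all stopping times $\tau$ of $B$ taking values in $[0,T]$. Consequently the optimal stopping time $\tau_*$ for $V_1$ is described as follows: when $\mu\ge\sigma^2$ we have $\tau_*\equiv T$, and when $\mu\le0$ we have $\tau_*\equiv0$. (Moreover, if $\lambda<\sigma/2$ then it is not the case that (1) holds for all stopping times $\tau$ of $B$ with values in $[0,T]$, and if $\lambda>-\sigma/2$ then it is not the case that (2) holds for all stopping times $\tau$ of $B$ with values in $[0,T]$.)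
   Context: $B=(B_t)_{0\le t\le T}$ is a standard Brownian motion started at $0$ on $(\Omega,\mathcal{F},\mathsf{P})$; stopping times of $B$ are with respect to its natural filtration. $Z=(Z_t)_{0\le t\le T}$ is the geometric Brownian motion $dZ_t=\mu Z_t\,dt+\sigma Z_t\,dB_t$ with $Z_0>0$ independent of $B$, i.e. $Z_t=Z_0\exp(\sigma B_t+(\mu-\sigma^2/2)t)$, and $M_t=\max_{0\le s\le t}Z_s$. For $\lambda\in\mathbb{R}$: $B^\lambda_t=B_t+\lambda t$ and $S^\lambda_t=\max_{0\le s\le t}B^\lambda_s$ for $t\in[0,T]$. A stopping time is optimal if it attains the infimum. *)

theory Defs
  imports "HOL-Probability.Probability"
begin

text \<open>Standard Brownian motion on \<open>[0,T]\<close> started at 0, with every path continuous. The values of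
  \<open>B t\<close> for \<open>t\<close> outside \<open>[0,T]\<close> are unconstrained.\<close>

locale brownian_motion = prob_space P for P :: "'a measure" +
  fixes B :: "real \<Rightarrow> 'a \<Rightarrow> real" and T :: real
  assumes measurable_B: "\<And>t. t \<in> {0..T} \<Longrightarrow> B t \<in> borel_measurable P"
    and B_start: "\<And>\<omega>. \<omega> \<in> space P \<Longrightarrow> B 0 \<omega> = 0"
    and continuous_paths: "\<And>\<omega>. \<omega> \<in> space P \<Longrightarrow> continuous_on {0..T} (\<lambda>t. B t \<omega>)"
    and normal_increments: "\<And>s t. 0 \<le> s \<Longrightarrow> s < t \<Longrightarrow> t \<le> T \<Longrightarrow>
      distributed P lborel (\<lambda>\<omega>. B t \<omega> - B s \<omega>) (normal_density 0 (sqrt (t - s)))"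
    and indep_increments: "\<And>(t :: nat \<Rightarrow> real) n. 0 \<le> t 0 \<Longrightarrow> (\<And>i. i < n \<Longrightarrow> t i \<le> t (Suc i)) \<Longrightarrow> t n \<le> T \<Longrightarrow>
      indep_vars (\<lambda>_. borel) (\<lambda>i \<omega>. B (t (Suc i)) \<omega> - B (t i) \<omega>) {..<n}"

definition natural_filtration :: "'a measure \<Rightarrow> (real \<Rightarrow> 'a \<Rightarrow> real) \<Rightarrow> real \<Rightarrow> 'a measure" where
  "natural_filtration P X t =
    sigma (space P) {X s -` A \<inter> space P | s A. s \<in> {0..t} \<and> A \<in> sets borel}"

text \<open>Stopping times of \<open>X\<close> with values in \<open>[0,T]\<close>. Since \<open>\<tau> \<le> T\<close>, the requirement
  \<open>{\<tau> \<le> t} \<in> F\<^sub>t\<close> is trivial for \<open>t < 0\<close> and for \<open>t \<ge> T\<close>, so only \<open>X\<close> on \<open>[0,T]\<close> matters.\<close>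

definition stopping_times ::
    "'a measure \<Rightarrow> (real \<Rightarrow> 'a \<Rightarrow> real) \<Rightarrow> real \<Rightarrow> ('a \<Rightarrow> real) set" where
  "stopping_times P X T =
    {\<tau>. stopping_time (natural_filtration P X) \<tau> \<and> (\<forall>\<omega>\<in>space P. 0 \<le> \<tau> \<omega> \<and> \<tau> \<omega> \<le> T)}"

definition with_drift :: "(real \<Rightarrow> 'a \<Rightarrow> real) \<Rightarrow> real \<Rightarrow> real \<Rightarrow> 'a \<Rightarrow> real" where
  "with_drift B l t \<omega> = B t \<omega> + l * t"

definition geometric_bm ::
    "('a \<Rightarrow> real) \<Rightarrow> (real \<Rightarrow> 'a \<Rightarrow> real) \<Rightarrow> real \<Rightarrow> real \<Rightarrow> real \<Rightarrow> 'a \<Rightarrow> real" where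
  "geometric_bm Z0 B \<mu> \<sigma> t \<omega> = Z0 \<omega> * exp (\<sigma> * B t \<omega> + (\<mu> - \<sigma>\<^sup>2 / 2) * t)"

text \<open>For a continuous path on \<open>[0,t]\<close> the supremum below is attained, i.e. it is the maximum.\<close>

definition running_max :: "(real \<Rightarrow> 'a \<Rightarrow> real) \<Rightarrow> real \<Rightarrow> 'a \<Rightarrow> real" where
  "running_max X t \<omega> = (SUP s\<in>{0..t}. X s \<omega>)"

definition ratio_cost :: "'a measure \<Rightarrow> (real \<Rightarrow> 'a \<Rightarrow> real) \<Rightarrow> real \<Rightarrow> ('a \<Rightarrow> real) \<Rightarrow> real" where
  "ratio_cost P Z T \<tau> = (\<integral>\<omega>. running_max Z T \<omega> / Z (\<tau> \<omega>) \<omega> \<partial>P)"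

definition exp_cost ::
    "'a measure \<Rightarrow> real \<Rightarrow> (real \<Rightarrow> 'a \<Rightarrow> real) \<Rightarrow> real \<Rightarrow> ('a \<Rightarrow> real) \<Rightarrow> real" where
  "exp_cost P \<sigma> X T \<tau> = (\<integral>\<omega>. exp (\<sigma> * (running_max X T \<omega> - X (\<tau> \<omega>) \<omega>)) \<partial>P)"

definition is_optimal :: "('a \<Rightarrow> real) set \<Rightarrow> (('a \<Rightarrow> real) \<Rightarrow> real) \<Rightarrow> ('a \<Rightarrow> real) \<Rightarrow> bool" where
  "is_optimal \<T> J \<tau> \<longleftrightarrow> \<tau> \<in> \<T> \<and> J \<tau> = (INF \<tau>'\<in>\<T>. J \<tau>')"

end

theory Submission
  imports Defs "HOL-Real_Asymp.Real_Asymp"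
begin

text \<open>
  The one-step Girsanov identity \<open>E[w \<Phi>(B) exp (- \<sigma> (B\<^sub>b - B\<^sub>a))] = exp (\<sigma>\<^sup>2 (b - a) / 2) E[w \<Phi>(B - \<sigma> (b - a) 1\<^bsub>[b,T]\<^esub>)]\<close>,
  for functionals \<open>\<Phi>\<close> of the path off \<open>(a,b)\<close> and weights \<open>w\<close> not involving the increment over \<open>[a,b]\<close>, turns
  postponing the stopping time from \<open>a\<close> to \<open>b\<close> into lowering the path after \<open>b\<close>. This lowers the maximum of the path
  by at least \<open>0\<close> and at most \<open>\<sigma> (b - a)\<close>, so that every postponement decreases the cost when \<open>\<lambda> \<ge> \<sigma>/2\<close> and increases
  it when \<open>\<lambda> \<le> -\<sigma>/2\<close>, for stopping times and maxima on a dyadic mesh; Doob's inequality yields an integrable majorant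
  for the passage to the limit.

  If \<open>\<lambda> < \<sigma>/2\<close>, stopping at \<open>T/2\<close> when the drawdown there is large, and at \<open>T\<close> otherwise, beats \<open>T\<close>. If \<open>\<lambda> > -\<sigma>/2\<close>,
  a small deterministic time beats \<open>0\<close>: after the change of measure the maximum drops by the full amount \<open>\<sigma> h\<close> up
  to an event whose probability vanishes with \<open>h\<close>, because the maximum is almost surely positive.

  A stopping time of \<open>Z\<close> becomes a stopping time of \<open>B\<close> when the independent initial value is frozen, hence both
  classes have the same infimum.
\<close>

subsection \<open>Independence of an increment from the rest of the path\<close>

text \<open>Postponing by one cell \<open>[a,b]\<close> of length \<open>\<delta>\<close> multiplies
  the integrand by \<open>exp (- \<sigma> (B_b - B_a) - \<sigma> l \<delta>)\<close>, but the same
  increment also moves the maximum, which looks into the future; no martingale argument applies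
  directly. After the change of measure the two effects separate: a deterministic factor with
  exponent \<open>(\<sigma>^2/2 - \<sigma> l) \<delta>\<close>, and a drop of
  \<open>\<sigma>\<close> times the maximum by an amount between \<open>0\<close> and
  \<open>\<sigma>^2 \<delta>\<close>. The total exponent lies between
  \<open>- \<sigma> (l + \<sigma>/2) \<delta>\<close> and
  \<open>\<sigma> (\<sigma>/2 - l) \<delta>\<close>; these ends change sign exactly at
  \<open>l = - \<sigma>/2\<close> and \<open>l = \<sigma>/2\<close>, whence the thresholds.

  The mesh is forced by the increment: strictly inside the cell the path contains only a piece of
  it, so the identity needs functionals that avoid the open cell.

  Costs are Bochner integrals, which are 0 for a non-integrable integrand. The comparison therefore
  runs with nonnegative extended integrals and returns to the reals through one majorant.\<close>

lemma space_natural_filtration [simp]: "space (natural_filtration P X t) = space P"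
  unfolding natural_filtration_def by (rule space_measure_of) auto

lemma sets_natural_filtration:
  "sets (natural_filtration P X t) = sigma_sets (space P)
     {X s -` A \<inter> space P | s A. s \<in> {0..t} \<and> A \<in> sets borel}"
  unfolding natural_filtration_def by (rule sets_measure_of) auto

text \<open>Independence of increments is assumed along monotone sequences of times, so an arbitrary
  finite set of times has to be listed increasingly first. Strictness lets the order of times be
  read off from the indices.\<close>

lemma finite_real_set_enumeration:
  fixes F :: "real set"
  assumes "finite F" "F \<noteq> {}"
  obtains t n where "\<And>i. i < n \<Longrightarrow> t i < t (Suc i)" "F = t ` {..n}" "strict_mono_on {..n} (t :: nat \<Rightarrow> real)"
proof -
  define L where "L = sorted_list_of_set F"
  have L: "set L = F" "sorted_wrt (<) L" using assms by (simp_all add: L_def)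
  have n: "length L > 0" using L(1) assms by auto
  have m: "strict_mono_on {..length L - 1} ((!) L)"
    using n by (auto intro!: strict_mono_onI sorted_wrt_nth_less[OF L(2)])
  have "set L = (!) L ` {..length L - 1}"
  proof -
    have "{..length L - 1} = {..<length L}"
      using n by (cases L) auto
    then show ?thesis by (auto simp: set_conv_nth)
  qed
  then show ?thesis
    using m n by (intro that[of "length L - 1" "(!) L"])
      (auto simp: L(1) intro!: sorted_wrt_nth_less[OF L(2)])
qed

context brownian_motion
begin

text \<open>The path with the increment over \<open>[a,b]\<close> cut out and the later part moved
  to close the gap. At times in \<open>(a,b)\<close> a piece of the increment survives, which is why
  \<open>skip_algebra\<close> uses only times outside.\<close>

definition skip :: "real \<Rightarrow> real \<Rightarrow> real \<Rightarrow> 'a \<Rightarrow> real" where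
  "skip a b s \<omega> = B s \<omega> - (if b \<le> s then B b \<omega> - B a \<omega> else 0)"

definition skip_algebra :: "real \<Rightarrow> real \<Rightarrow> 'a measure" where
  "skip_algebra a b = sigma (space P)
     {skip a b s -` C \<inter> space P | s C. s \<in> {0..a} \<union> {b..T} \<and> C \<in> sets borel}"

lemma space_skip_algebra [simp]: "space (skip_algebra a b) = space P"
  unfolding skip_algebra_def by (rule space_measure_of) auto

lemma sets_skip_algebra:
  "sets (skip_algebra a b) = sigma_sets (space P)
     {skip a b s -` C \<inter> space P | s C. s \<in> {0..a} \<union> {b..T} \<and> C \<in> sets borel}"
  unfolding skip_algebra_def by (rule sets_measure_of) auto

lemma measurable_skip_skip_algebra:
  assumes "s \<in> {0..a} \<union> {b..T}"
  shows "skip a b s \<in> borel_measurable (skip_algebra a b)"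
proof (rule measurableI)
  fix C :: "real set" assume "C \<in> sets borel"
  then show "skip a b s -` C \<inter> space (skip_algebra a b) \<in> sets (skip_algebra a b)"
    unfolding sets_skip_algebra space_skip_algebra using assms by (intro sigma_sets.Basic) blast
qed simp

text \<open>Adding \<open>0\<close>, \<open>a\<close> and \<open>b\<close> to the times makes
  \<open>B b - B a\<close> a single one of the increments and every skipped value a sum of the
  others; the claim is then independence of one increment from a disjoint block.\<close>

lemma indep_skip_finite:
  assumes ab: "0 \<le> a" "a < b" "b \<le> T"
    and J: "finite J" "J \<subseteq> {0..a} \<union> {b..T}" and C: "\<And>s. C s \<in> sets borel" and D: "D \<in> sets borel"
  shows "prob ({\<omega>\<in>space P. \<forall>s\<in>J. skip a b s \<omega> \<in> C s} \<inter> ((\<lambda>\<omega>. B b \<omega> - B a \<omega>) -` D \<inter> space P))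
    = prob {\<omega>\<in>space P. \<forall>s\<in>J. skip a b s \<omega> \<in> C s} * prob ((\<lambda>\<omega>. B b \<omega> - B a \<omega>) -` D \<inter> space P)"
proof -
  let ?F = "insert 0 (insert a (insert b J))"
  obtain t n where t: "\<And>i. i < n \<Longrightarrow> t i < t (Suc i)" "?F = t ` {..n}" "strict_mono_on {..n} t"
    using finite_real_set_enumeration[of ?F] J by (metis finite_insert insert_not_empty)
  have F: "t i \<in> {0..a} \<union> {b..T}" if "i \<le> n" for i
  proof -
    have "t i \<in> ?F" using t(2) that by blast
    then show ?thesis using ab J by auto
  qed
  obtain z where z: "z \<le> n" "t z = 0" using t(2) by (metis atMost_iff imageE insertI1)
  have t0: "t 0 = 0"
  proof (cases "z = 0")
    case False
    then have "t 0 < t z" using strict_mono_onD[OF t(3), of 0 z] z by simp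
    then show ?thesis using F[of 0] z ab by auto
  qed (use z in simp)
  obtain p where p: "p \<le> n" "t p = a" using t(2) by (metis atMost_iff imageE insertI1 insertI2)
  obtain q where q: "q \<le> n" "t q = b" using t(2) by (metis atMost_iff imageE insertI1 insertI2)
  have less_iff: "t i < t j \<longleftrightarrow> i < j" if "i \<le> n" "j \<le> n" for i j
    using strict_mono_onD[OF t(3), of i j] strict_mono_onD[OF t(3), of j i] that
    by (cases i j rule: linorder_cases) auto
  have pq: "p < q" using less_iff[of p q] p q ab by simp
  \<comment> \<open>No listed time lies strictly between \<open>a\<close> and \<open>b\<close>, so
    the two are neighbours.\<close>
  have "t (Suc p) \<ge> b" using F[of "Suc p"] less_iff[of p "Suc p"] p q pq by auto
  then have q': "q = Suc p" using less_iff[of "Suc p" q] p q pq by fastforce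
  define \<xi> where "\<xi> i \<omega> = B (t (Suc i)) \<omega> - B (t i) \<omega>" for i \<omega>
  have indep: "indep_vars (\<lambda>_. borel) \<xi> {..<n}"
    unfolding \<xi>_def
  proof (rule indep_increments)
    show "t n \<le> T" using F[of n] ab by auto
  qed (use t0 t(1) in \<open>auto intro: less_imp_le\<close>)
  define K where "K = {..<n} - {p}"
  have iv: "indep_var (PiM K (\<lambda>_. borel)) (\<lambda>\<omega>. restrict (\<lambda>i. \<xi> i \<omega>) K)
      (PiM {p} (\<lambda>_. borel)) (\<lambda>\<omega>. restrict (\<lambda>i. \<xi> i \<omega>) {p})"
    using pq q by (intro indep_var_restrict[OF indep]) (auto simp: K_def)
  have B_sum: "B (t k) \<omega> = (\<Sum>j<k. \<xi> j \<omega>)" if "k \<le> n" "\<omega> \<in> space P" for k \<omega>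
    using that
  proof (induction k)
    case 0 then show ?case using B_start t0 by simp
  next
    case (Suc k)
    then have "B (t k) \<omega> = (\<Sum>j<k. \<xi> j \<omega>)" by simp
    then show ?case by (simp add: \<xi>_def)
  qed
  have skip_sum: "skip a b (t k) \<omega> = (\<Sum>j\<in>{..<k} - {p}. \<xi> j \<omega>)" if "k \<le> n" "\<omega> \<in> space P" for k \<omega>
  proof (cases "p < k")
    case True
    then have "b \<le> t k" using less_iff[of q k] less_iff[of k q] q q' that by (metis Suc_leI linorder_not_less less_irrefl)
    then have "skip a b (t k) \<omega> = (\<Sum>j<k. \<xi> j \<omega>) - \<xi> p \<omega>"
      using B_sum[OF that] p q q' by (simp add: skip_def \<xi>_def)
    also have "\<dots> = (\<Sum>j\<in>{..<k} - {p}. \<xi> j \<omega>)"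
      using True by (subst sum_diff1) auto
    finally show ?thesis .
  next
    case False
    then have "t k < b" using less_iff[of k q] q q' that by simp
    moreover have "{..<k} - {p} = {..<k}" using False by auto
    ultimately show ?thesis using B_sum[OF that] by (simp add: skip_def)
  qed
  have "\<forall>s\<in>J. \<exists>k. k \<le> n \<and> t k = s"
    using t(2) by (metis atMost_iff imageE insert_iff)
  then obtain k where k: "\<And>s. s \<in> J \<Longrightarrow> k s \<le> n \<and> t (k s) = s" by metis
  let ?E = "{x\<in>space (PiM K (\<lambda>_. borel :: real measure)). \<forall>s\<in>J. (\<Sum>j\<in>{..<k s} - {p}. x j) \<in> C s}"
  have [measurable]: "C s \<in> sets borel" for s by (rule C)
  have kK: "j \<in> K" if "s \<in> J" "j \<in> {..<k s} - {p}" for s j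
    using that k[of s] by (auto simp: K_def)
  have E: "?E \<in> sets (PiM K (\<lambda>_. borel))"
  proof (rule sets.sets_Collect_finite_All)
    show "finite J" by (rule J)
    fix s assume s: "s \<in> J"
    have [measurable]: "(\<lambda>x. (\<Sum>j\<in>{..<k s} - {p}. x j :: real)) \<in> borel_measurable (PiM K (\<lambda>_. borel))"
      using kK[OF s] by (intro borel_measurable_sum measurable_component_singleton) auto
    show "{x \<in> space (PiM K (\<lambda>_. borel)). (\<Sum>j\<in>{..<k s} - {p}. x j) \<in> C s} \<in> sets (PiM K (\<lambda>_. borel))"
      by measurable
  qed
  let ?D = "{x\<in>space (PiM {p} (\<lambda>_. borel :: real measure)). x p \<in> D}"
  have D': "?D \<in> sets (PiM {p} (\<lambda>_. borel))" using D by measurable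
  have 1: "(\<lambda>\<omega>. restrict (\<lambda>i. \<xi> i \<omega>) K) -` ?E \<inter> space P = {\<omega>\<in>space P. \<forall>s\<in>J. skip a b s \<omega> \<in> C s}"
  proof -
    have "(\<Sum>j\<in>{..<k s} - {p}. restrict (\<lambda>i. \<xi> i \<omega>) K j) = skip a b s \<omega>" if "s \<in> J" "\<omega> \<in> space P" for s \<omega>
    proof -
      have "(\<Sum>j\<in>{..<k s} - {p}. restrict (\<lambda>i. \<xi> i \<omega>) K j) = (\<Sum>j\<in>{..<k s} - {p}. \<xi> j \<omega>)"
        using kK[OF that(1)] by (intro sum.cong) auto
      then show ?thesis using skip_sum[of "k s" \<omega>] k that by simp
    qed
    then show ?thesis by (auto simp: space_PiM)
  qed
  have 2: "(\<lambda>\<omega>. restrict (\<lambda>i. \<xi> i \<omega>) {p}) -` ?D \<inter> space P = (\<lambda>\<omega>. B b \<omega> - B a \<omega>) -` D \<inter> space P"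
    using p q q' by (auto simp: space_PiM \<xi>_def)
  have 3: "(\<lambda>\<omega>. (restrict (\<lambda>i. \<xi> i \<omega>) K, restrict (\<lambda>i. \<xi> i \<omega>) {p})) -` (?E \<times> ?D) \<inter> space P
    = {\<omega>\<in>space P. \<forall>s\<in>J. skip a b s \<omega> \<in> C s} \<inter> ((\<lambda>\<omega>. B b \<omega> - B a \<omega>) -` D \<inter> space P)"
    unfolding 1[symmetric] 2[symmetric] by blast
  show ?thesis
    using indep_varD[OF iv E D'] unfolding 1 2 3 .
qed

lemma measurable_skip [measurable (raw)]:
  assumes "0 \<le> a" "a < b" "b \<le> T" "s \<in> {0..T}"
  shows "skip a b s \<in> borel_measurable P"
  using assms unfolding skip_def[abs_def]
  by (intro borel_measurable_diff measurable_If measurable_B) auto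

lemma subalgebra_skip_algebra:
  assumes "0 \<le> a" "a < b" "b \<le> T"
  shows "subalgebra P (skip_algebra a b)"
  unfolding subalgebra_def sets_skip_algebra
  using assms by (auto intro!: sets.sigma_sets_subset measurable_sets[OF measurable_skip[OF assms]])

text \<open>Through this, events decided by time \<open>a\<close> become admissible weights in the
  Girsanov step.\<close>

lemma sets_natural_filtration_subset_skip_algebra:
  assumes "a < b"
  shows "sets (natural_filtration P B a) \<subseteq> sets (skip_algebra a b)"
  unfolding sets_natural_filtration sets_skip_algebra
proof (rule sigma_sets_mono', safe)
  fix s :: real and A :: "real set"
  assume *: "s \<in> {0..a}" "A \<in> sets borel"
  then have "skip a b s = B s" using assms by (auto simp: skip_def)
  then show "\<exists>sa C. B s -` A \<inter> space P = skip a b sa -` C \<inter> space P \<and>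
      sa \<in> {0..a} \<union> {b..T} \<and> C \<in> sets borel"
    using * by (metis UnI1)
qed

text \<open>A pi-system argument: the finite-dimensional cylinders are stable under intersection and
  generate the skipped path, and for them the product rule is the finite case above.\<close>

proposition indep_skip_algebra:
  assumes ab: "0 \<le> a" "a < b" "b \<le> T"
  shows "indep_set (sets (skip_algebra a b)) (sets (vimage_algebra (space P) (\<lambda>\<omega>. B b \<omega> - B a \<omega>) borel))"
proof -
  let ?\<xi> = "\<lambda>\<omega>. B b \<omega> - B a \<omega>"
  let ?I = "{0..a} \<union> {b..T}"
  let ?G = "{skip a b s -` C \<inter> space P | s C. s \<in> ?I \<and> C \<in> sets borel}"
  let ?cyl = "\<lambda>J C. {\<omega>\<in>space P. \<forall>s\<in>J. skip a b s \<omega> \<in> C s}"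
  let ?\<Pi> = "{?cyl J C | J C. finite J \<and> J \<subseteq> ?I \<and> (\<forall>s. C s \<in> sets borel)}"
  let ?D = "{?\<xi> -` D \<inter> space P | D. D \<in> sets borel}"
  have \<xi>: "?\<xi> \<in> borel_measurable P" using ab by (intro borel_measurable_diff measurable_B) auto
  have cyl_ev: "?cyl J C \<in> events" if J: "finite J" "J \<subseteq> ?I" and C: "\<And>s. C s \<in> sets borel" for J C
  proof (rule sets.sets_Collect_finite_All)
    show "finite J" by (rule J)
    fix s assume "s \<in> J"
    then have [measurable]: "skip a b s \<in> borel_measurable P" using J ab by (intro measurable_skip) auto
    have [measurable]: "C s \<in> sets borel" by (rule C)
    show "{\<omega>\<in>space P. skip a b s \<omega> \<in> C s} \<in> events" by measurable
  qed
  have "indep_set ?\<Pi> ?D"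
    using ab by (intro indep_setI) (auto intro!: cyl_ev measurable_sets[OF \<xi>] indep_skip_finite)
  moreover have "Int_stable ?\<Pi>"
  proof (rule Int_stableI, safe)
    fix J1 J2 :: "real set" and C1 C2 :: "real \<Rightarrow> real set"
    assume *: "finite J1" "J1 \<subseteq> ?I" "\<forall>s. C1 s \<in> sets borel" "finite J2" "J2 \<subseteq> ?I" "\<forall>s. C2 s \<in> sets borel"
    \<comment> \<open>Padding with \<open>UNIV\<close> brings both cylinders to the common set of
      times \<open>J1 \<union> J2\<close>.\<close>
    let ?C = "\<lambda>s. (if s \<in> J1 then C1 s else UNIV) \<inter> (if s \<in> J2 then C2 s else UNIV)"
    have "?cyl J1 C1 \<inter> ?cyl J2 C2 = ?cyl (J1 \<union> J2) ?C" by auto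
    moreover have "\<forall>s. ?C s \<in> sets borel" using * by auto
    ultimately show "\<exists>J C. ?cyl J1 C1 \<inter> ?cyl J2 C2 = ?cyl J C \<and> finite J \<and> J \<subseteq> ?I \<and> (\<forall>s. C s \<in> sets borel)"
      using * by (intro exI[of _ "J1 \<union> J2"] exI[of _ ?C]) (simp only: finite_Un Un_least simp_thms)
  qed
  moreover have "Int_stable ?D"
  proof (rule Int_stableI, safe)
    fix D1 D2 :: "real set" assume "D1 \<in> sets borel" "D2 \<in> sets borel"
    then show "\<exists>D. ?\<xi> -` D1 \<inter> space P \<inter> (?\<xi> -` D2 \<inter> space P) = ?\<xi> -` D \<inter> space P \<and> D \<in> sets borel"
      by (intro exI[of _ "D1 \<inter> D2"]) auto
  qed
  ultimately have ind: "indep_set (sigma_sets (space P) ?\<Pi>) (sigma_sets (space P) ?D)"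
    by (rule indep_set_sigma_sets)
  have "?G \<subseteq> ?\<Pi>"
  proof
    fix E assume "E \<in> ?G"
    then obtain s C where *: "E = skip a b s -` C \<inter> space P" "s \<in> ?I" "C \<in> sets borel" by blast
    have "E = ?cyl {s} (\<lambda>_. C)" using * by auto
    moreover have "{s} \<subseteq> ?I" using * by blast
    ultimately show "E \<in> ?\<Pi>"
      using *(3) by (intro CollectI exI[of _ "{s}"] exI[of _ "\<lambda>_. C"]) (simp only: finite.intros simp_thms)
  qed
  then have "sets (skip_algebra a b) \<subseteq> sigma_sets (space P) ?\<Pi>"
    unfolding sets_skip_algebra by (rule sigma_sets_mono')
  moreover have "sets (vimage_algebra (space P) ?\<xi> borel) = sigma_sets (space P) ?D"
    by (simp add: sets_vimage_algebra)
  ultimately show ?thesis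
    unfolding indep_set_def
    by (intro indep_sets_mono_sets[OF ind[unfolded indep_set_def]]) (simp split: bool.split)
qed

end

subsection \<open>The one-step Girsanov identity\<close>

text \<open>Completing the square: the centred Gaussian density of variance \<open>v\<close> times
  \<open>exp (- c * x)\<close> is \<open>exp (c\<^sup>2 * v / 2)\<close> times the density of mean
  \<open>- c * v\<close>; a translation then moves the shift into \<open>f\<close>.\<close>

lemma nn_integral_normal_shift:
  fixes f :: "real \<Rightarrow> ennreal" and c v :: real
  assumes [measurable]: "f \<in> borel_measurable borel" and v: "v > 0"
  shows "(\<integral>\<^sup>+x. ennreal (normal_density 0 (sqrt v) x) * (f x * ennreal (exp (- c * x))) \<partial>lborel) =
    ennreal (exp (c\<^sup>2 * v / 2)) * (\<integral>\<^sup>+x. ennreal (normal_density 0 (sqrt v) x) * f (x - c * v) \<partial>lborel)"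
proof -
  have *: "normal_density 0 (sqrt v) x * exp (- c * x) = exp (c\<^sup>2 * v / 2) * normal_density 0 (sqrt v) (c * v + x)" for x
  proof -
    have "- (x\<^sup>2) / (2 * v) + - c * x = c\<^sup>2 * v / 2 + - ((c * v + x)\<^sup>2) / (2 * v)"
      using v by (simp add: field_simps power2_eq_square)
    then have "exp (- (x\<^sup>2) / (2 * v)) * exp (- c * x) = exp (c\<^sup>2 * v / 2) * exp (- ((c * v + x)\<^sup>2) / (2 * v))"
      by (simp only: exp_add[symmetric])
    then show ?thesis using v by (simp add: normal_density_def)
  qed
  have "(\<integral>\<^sup>+x. ennreal (normal_density 0 (sqrt v) x) * f (x - c * v) \<partial>lborel)
      = (\<integral>\<^sup>+x. ennreal (normal_density 0 (sqrt v) (c * v + x)) * f x \<partial>lborel)"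
    by (subst nn_integral_real_affine[where t="c * v" and c=1]) simp_all
  then have "ennreal (exp (c\<^sup>2 * v / 2)) * (\<integral>\<^sup>+x. ennreal (normal_density 0 (sqrt v) x) * f (x - c * v) \<partial>lborel)
      = (\<integral>\<^sup>+x. ennreal (exp (c\<^sup>2 * v / 2)) * (ennreal (normal_density 0 (sqrt v) (c * v + x)) * f x) \<partial>lborel)"
    by (simp add: nn_integral_cmult)
  also have "\<dots> = (\<integral>\<^sup>+x. ennreal (normal_density 0 (sqrt v) x) * (f x * ennreal (exp (- c * x))) \<partial>lborel)"
  proof (rule nn_integral_cong)
    fix x
    have "ennreal (exp (c\<^sup>2 * v / 2)) * (ennreal (normal_density 0 (sqrt v) (c * v + x)) * f x)
        = ennreal (exp (c\<^sup>2 * v / 2) * normal_density 0 (sqrt v) (c * v + x)) * f x"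
      by (simp add: ennreal_mult mult_ac)
    also have "\<dots> = ennreal (normal_density 0 (sqrt v) x) * (f x * ennreal (exp (- c * x)))"
      unfolding *[symmetric] by (simp add: ennreal_mult mult_ac)
    finally show "ennreal (exp (c\<^sup>2 * v / 2)) * (ennreal (normal_density 0 (sqrt v) (c * v + x)) * f x) = \<dots>" .
  qed
  finally show ?thesis by simp
qed

lemma (in prob_space) distr_pair_indep_set:
  assumes ind: "indep_set (sets A) (sets A')" and sp: "space A = space M" "space A' = space M"
    and W: "W \<in> measurable A N" and X: "X \<in> measurable A' S"
  shows "distr M N W \<Otimes>\<^sub>M distr M S X = distr M (N \<Otimes>\<^sub>M S) (\<lambda>\<omega>. (W \<omega>, X \<omega>))"
proof -
  have "subalgebra M A" "subalgebra M A'"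
    using indep_setD_ev1[OF ind] indep_setD_ev2[OF ind] sp by (auto simp: subalgebra_def)
  then have [measurable]: "W \<in> measurable M N" "X \<in> measurable M S"
    using measurable_from_subalg W X by blast+
  interpret W: prob_space "distr M N W" by (rule prob_space_distr) simp
  interpret X: prob_space "distr M S X" by (rule prob_space_distr) simp
  show ?thesis
  proof (rule pair_measure_eqI)
    fix U V assume "U \<in> sets (distr M N W)" "V \<in> sets (distr M S X)"
    then have [measurable]: "U \<in> sets N" "V \<in> sets S" by simp_all
    have "prob ((W -` U \<inter> space M) \<inter> (X -` V \<inter> space M)) = prob (W -` U \<inter> space M) * prob (X -` V \<inter> space M)"
      using measurable_sets[OF W \<open>U \<in> sets N\<close>] measurable_sets[OF X \<open>V \<in> sets S\<close>] sp
      by (intro indep_setD[OF ind]) simp_all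
    moreover have "(W -` U \<inter> space M) \<inter> (X -` V \<inter> space M) = (\<lambda>\<omega>. (W \<omega>, X \<omega>)) -` (U \<times> V) \<inter> space M" by auto
    ultimately show "emeasure (distr M N W) U * emeasure (distr M S X) V =
        emeasure (distr M (N \<Otimes>\<^sub>M S) (\<lambda>\<omega>. (W \<omega>, X \<omega>))) (U \<times> V)"
      by (simp add: emeasure_distr emeasure_eq_measure ennreal_mult'')
  qed (simp_all add: W.sigma_finite_measure_axioms X.sigma_finite_measure_axioms cong: sets_pair_measure_cong)
qed

text \<open>Independence is taken between sigma-algebras so that the variables may have any target
  space. When the initial value is frozen, \<open>X\<close> will be the identity on the sample space
  with the natural filtration as target.\<close>

lemma (in prob_space) nn_integral_indep_set:
  assumes ind: "indep_set (sets A) (sets A')" and sp: "space A = space M" "space A' = space M"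
    and W: "W \<in> measurable A N" and X: "X \<in> measurable A' S"
    and [measurable]: "F \<in> borel_measurable (N \<Otimes>\<^sub>M S)"
  shows "(\<integral>\<^sup>+\<omega>. F (W \<omega>, X \<omega>) \<partial>M) = (\<integral>\<^sup>+\<omega>. (\<integral>\<^sup>+\<omega>'. F (W \<omega>, X \<omega>') \<partial>M) \<partial>M)"
proof -
  have "subalgebra M A" "subalgebra M A'"
    using indep_setD_ev1[OF ind] indep_setD_ev2[OF ind] sp by (auto simp: subalgebra_def)
  then have [measurable]: "W \<in> measurable M N" "X \<in> measurable M S"
    using measurable_from_subalg W X by blast+
  interpret X: prob_space "distr M S X" by (rule prob_space_distr) simp
  have "(\<integral>\<^sup>+\<omega>. F (W \<omega>, X \<omega>) \<partial>M) = (\<integral>\<^sup>+p. F p \<partial>distr M (N \<Otimes>\<^sub>M S) (\<lambda>x. (W x, X x)))"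
    by (subst nn_integral_distr) simp_all
  also have "\<dots> = (\<integral>\<^sup>+w. (\<integral>\<^sup>+x. F (w, x) \<partial>distr M S X) \<partial>distr M N W)"
    unfolding distr_pair_indep_set[OF assms(1-5), symmetric] by (subst X.nn_integral_fst) simp_all
  also have "\<dots> = (\<integral>\<^sup>+\<omega>. (\<integral>\<^sup>+x. F (W \<omega>, x) \<partial>distr M S X) \<partial>M)"
    by (subst nn_integral_distr) simp_all
  also have "\<dots> = (\<integral>\<^sup>+\<omega>. (\<integral>\<^sup>+\<omega>'. F (W \<omega>, X \<omega>') \<partial>M) \<partial>M)"
  proof (rule nn_integral_cong)
    fix \<omega> assume "\<omega> \<in> space M"
    then have "W \<omega> \<in> space N" by (rule measurable_space[rotated]) simp
    then have [measurable]: "(\<lambda>x. F (W \<omega>, x)) \<in> borel_measurable S" by measurable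
    show "(\<integral>\<^sup>+x. F (W \<omega>, x) \<partial>distr M S X) = (\<integral>\<^sup>+\<omega>'. F (W \<omega>, X \<omega>') \<partial>M)"
      by (subst nn_integral_distr) simp_all
  qed
  finally show ?thesis .
qed

context brownian_motion
begin

lemma nn_integral_increment:
  assumes "0 \<le> a" "a < b" "b \<le> T" and "f \<in> borel_measurable borel"
  shows "(\<integral>\<^sup>+\<omega>. f (B b \<omega> - B a \<omega>) \<partial>P) = (\<integral>\<^sup>+x. ennreal (normal_density 0 (sqrt (b - a)) x) * f x \<partial>lborel)"
  using distributed_nn_integral[OF normal_increments[OF assms(1-3)], of f] assms(4) by simp

text \<open>By independence the increment can be integrated first, with \<open>W\<close> held fixed,
  which leaves the one-dimensional Gaussian shift.\<close>

lemma nn_integral_skip_shift: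
  fixes c :: real
  assumes ab: "0 \<le> a" "a < b" "b \<le> T" and W: "W \<in> measurable (skip_algebra a b) N"
    and [measurable]: "F \<in> borel_measurable (N \<Otimes>\<^sub>M borel)"
  shows "(\<integral>\<^sup>+\<omega>. F (W \<omega>, B b \<omega> - B a \<omega>) * ennreal (exp (- c * (B b \<omega> - B a \<omega>))) \<partial>P) =
    ennreal (exp (c\<^sup>2 * (b - a) / 2)) * (\<integral>\<^sup>+\<omega>. F (W \<omega>, B b \<omega> - B a \<omega> - c * (b - a)) \<partial>P)"
proof -
  have [measurable]: "W \<in> measurable P N"
    using W subalgebra_skip_algebra[OF ab] by (rule measurable_from_subalg[rotated])
  have [measurable]: "B b \<in> borel_measurable P" "B a \<in> borel_measurable P"
    using ab by (auto intro: measurable_B)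
  have "(\<lambda>\<omega>. B b \<omega> - B a \<omega>) \<in> borel_measurable (vimage_algebra (space P) (\<lambda>\<omega>. B b \<omega> - B a \<omega>) borel)"
    by (rule measurable_vimage_algebra1) simp
  note ind = nn_integral_indep_set[OF indep_skip_algebra[OF ab] space_skip_algebra space_vimage_algebra W this]
  have in_N: "W \<omega> \<in> space N" if "\<omega> \<in> space P" for \<omega>
    using that by (auto intro: measurable_space[of W P N])
  have "(\<integral>\<^sup>+\<omega>. F (W \<omega>, B b \<omega> - B a \<omega>) * ennreal (exp (- c * (B b \<omega> - B a \<omega>))) \<partial>P) =
    (\<integral>\<^sup>+\<omega>. (\<integral>\<^sup>+\<omega>'. F (W \<omega>, B b \<omega>' - B a \<omega>') * ennreal (exp (- c * (B b \<omega>' - B a \<omega>'))) \<partial>P) \<partial>P)"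
    using ind[of "\<lambda>p. F p * ennreal (exp (- c * snd p))"] by simp
  also have "\<dots> = (\<integral>\<^sup>+\<omega>. ennreal (exp (c\<^sup>2 * (b - a) / 2)) *
      (\<integral>\<^sup>+\<omega>'. F (W \<omega>, B b \<omega>' - B a \<omega>' - c * (b - a)) \<partial>P) \<partial>P)"
  proof (rule nn_integral_cong)
    fix \<omega> assume "\<omega> \<in> space P"
    then have [measurable]: "(\<lambda>x. F (W \<omega>, x)) \<in> borel_measurable borel" using in_N by measurable
    show "(\<integral>\<^sup>+\<omega>'. F (W \<omega>, B b \<omega>' - B a \<omega>') * ennreal (exp (- c * (B b \<omega>' - B a \<omega>'))) \<partial>P) =
      ennreal (exp (c\<^sup>2 * (b - a) / 2)) * (\<integral>\<^sup>+\<omega>'. F (W \<omega>, B b \<omega>' - B a \<omega>' - c * (b - a)) \<partial>P)"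
      using nn_integral_normal_shift[of "\<lambda>x. F (W \<omega>, x)" "b - a" c] ab
      by (simp add: nn_integral_increment[OF ab, of "\<lambda>x. F (W \<omega>, x) * ennreal (exp (- (c * x)))"]
          nn_integral_increment[OF ab, of "\<lambda>x. F (W \<omega>, x - c * (b - a))"])
  qed
  also have "\<dots> = ennreal (exp (c\<^sup>2 * (b - a) / 2)) *
      (\<integral>\<^sup>+\<omega>. (\<integral>\<^sup>+\<omega>'. F (W \<omega>, B b \<omega>' - B a \<omega>' - c * (b - a)) \<partial>P) \<partial>P)"
    by (rule nn_integral_cmult) measurable
  also have "(\<integral>\<^sup>+\<omega>. (\<integral>\<^sup>+\<omega>'. F (W \<omega>, B b \<omega>' - B a \<omega>' - c * (b - a)) \<partial>P) \<partial>P) =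
      (\<integral>\<^sup>+\<omega>. F (W \<omega>, B b \<omega> - B a \<omega> - c * (b - a)) \<partial>P)"
    using ind[of "\<lambda>p. F (fst p, snd p - c * (b - a))"] by simp
  finally show ?thesis .
qed

text \<open>From time \<open>b\<close> on the path is the skipped path plus the increment, and up to
  time \<open>a\<close> it is the skipped path itself. Shifting the increment by
  \<open>- c * (b - a)\<close> therefore lowers the path from \<open>b\<close> on and leaves the
  weight \<open>w\<close> alone.\<close>

proposition nn_integral_girsanov_step:
  fixes c :: real
  assumes ab: "0 \<le> a" "a < b" "b \<le> T" and J: "J \<subseteq> {0..a} \<union> {b..T}"
    and w: "w \<in> borel_measurable (skip_algebra a b)"
    and [measurable]: "\<Phi> \<in> borel_measurable (PiM J (\<lambda>_. borel))"
  shows "(\<integral>\<^sup>+\<omega>. w \<omega> * \<Phi> (\<lambda>s\<in>J. B s \<omega>) * ennreal (exp (- c * (B b \<omega> - B a \<omega>))) \<partial>P) =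
    ennreal (exp (c\<^sup>2 * (b - a) / 2)) *
    (\<integral>\<^sup>+\<omega>. w \<omega> * \<Phi> (\<lambda>s\<in>J. B s \<omega> - (if b \<le> s then c * (b - a) else 0)) \<partial>P)"
proof -
  let ?N = "borel \<Otimes>\<^sub>M PiM J (\<lambda>_. borel :: real measure)"
  let ?W = "\<lambda>\<omega>. (w \<omega>, \<lambda>s\<in>J. skip a b s \<omega>)"
  let ?F = "\<lambda>p. fst (fst p) * \<Phi> (\<lambda>s\<in>J. snd (fst p) s + (if b \<le> s then snd p else 0))"
  have W: "?W \<in> measurable (skip_algebra a b) ?N"
    using w J by (intro measurable_Pair measurable_restrict measurable_skip_skip_algebra) auto
  have "(\<lambda>p. \<lambda>s\<in>J. snd (fst p) s + (if b \<le> s then snd p else 0)) \<in> measurable (?N \<Otimes>\<^sub>M borel) (PiM J (\<lambda>_. borel))"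
  proof (rule measurable_restrict)
    fix s assume s[measurable]: "s \<in> J"
    show "(\<lambda>p. snd (fst p) s + (if b \<le> s then snd p else 0)) \<in> borel_measurable (?N \<Otimes>\<^sub>M borel)"
      by (cases "b \<le> s") simp_all
  qed
  then have F: "?F \<in> borel_measurable (?N \<Otimes>\<^sub>M borel)" by measurable
  have 1: "?F (?W \<omega>, B b \<omega> - B a \<omega>) = w \<omega> * \<Phi> (\<lambda>s\<in>J. B s \<omega>)" for \<omega>
    by (auto simp: skip_def intro!: arg_cong[where f="\<lambda>x. w \<omega> * \<Phi> x"] restrict_ext)
  have 2: "?F (?W \<omega>, B b \<omega> - B a \<omega> - c * (b - a)) =
      w \<omega> * \<Phi> (\<lambda>s\<in>J. B s \<omega> - (if b \<le> s then c * (b - a) else 0))" for \<omega>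
    by (auto simp: skip_def intro!: arg_cong[where f="\<lambda>x. w \<omega> * \<Phi> x"] restrict_ext)
  show ?thesis
    using nn_integral_skip_shift[OF ab W F, of c] by (simp only: 1 2)
qed

text \<open>The exponential martingale, read off from the Girsanov step with a trivial path
  functional and \<open>- c\<close> for \<open>c\<close>.\<close>

lemma nn_integral_exp_increment:
  fixes c :: real
  assumes ab: "0 \<le> a" "a < b" "b \<le> T" and w: "w \<in> borel_measurable (skip_algebra a b)"
  shows "(\<integral>\<^sup>+\<omega>. w \<omega> * ennreal (exp (c * (B b \<omega> - B a \<omega>))) \<partial>P) =
    ennreal (exp (c\<^sup>2 * (b - a) / 2)) * (\<integral>\<^sup>+\<omega>. w \<omega> \<partial>P)"
  using nn_integral_girsanov_step[OF ab _ w, of "{}" "\<lambda>_. 1" "-c"] by simp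

end

subsection \<open>Dyadic meshes\<close>

definition tick :: "real \<Rightarrow> nat \<Rightarrow> nat \<Rightarrow> real" where
  "tick T n i = T * real i / 2 ^ n"

definition mesh :: "real \<Rightarrow> nat \<Rightarrow> real set" where
  "mesh T n = tick T n ` {..2 ^ n}"

text \<open>Rounding up is what preserves stopping times: the rounded time is at most a given tick
  exactly when the original time is, so the event is already decided at that tick.\<close>

definition next_tick :: "real \<Rightarrow> nat \<Rightarrow> real \<Rightarrow> nat" where
  "next_tick T n s = (LEAST i. s \<le> tick T n i)"

lemma tick_0 [simp]: "tick T n 0 = 0"
  by (simp add: tick_def)

lemma tick_top [simp]: "tick T n (2 ^ n) = T"
  by (simp add: tick_def)

lemma tick_Suc: "tick T n (Suc i) = tick T n i + T / 2 ^ n"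
  by (simp add: tick_def field_simps)

lemma tick_le_iff: "T > 0 \<Longrightarrow> tick T n i \<le> tick T n j \<longleftrightarrow> i \<le> j"
  by (simp add: tick_def field_simps)

lemma tick_less_iff: "T > 0 \<Longrightarrow> tick T n i < tick T n j \<longleftrightarrow> i < j"
  by (simp add: tick_def field_simps)

lemma tick_nonneg: "T > 0 \<Longrightarrow> 0 \<le> tick T n i"
  by (simp add: tick_def)

lemma tick_le: "T > 0 \<Longrightarrow> i \<le> 2 ^ n \<Longrightarrow> tick T n i \<le> T"
  using tick_le_iff[of T n i "2 ^ n"] by simp

lemma tick_mem: "T > 0 \<Longrightarrow> i \<le> 2 ^ n \<Longrightarrow> tick T n i \<in> {0..T}"
  using tick_nonneg tick_le by simp

lemma finite_mesh [simp]: "finite (mesh T n)"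
  by (simp add: mesh_def)

lemma mesh_nonempty [simp]: "mesh T n \<noteq> {}"
  by (simp add: mesh_def)

lemma mesh_subset: "T > 0 \<Longrightarrow> mesh T n \<subseteq> {0..T}"
  using tick_mem by (auto simp: mesh_def)

text \<open>This makes the mesh an admissible set of times for the Girsanov step over any of its
  cells.\<close>

lemma mesh_avoids: "T > 0 \<Longrightarrow> mesh T n \<subseteq> {0..tick T n i} \<union> {tick T n (Suc i)..T}"
proof
  fix s assume T: "T > 0" and "s \<in> mesh T n"
  then obtain j where j: "j \<le> 2 ^ n" "s = tick T n j" by (auto simp: mesh_def)
  then show "s \<in> {0..tick T n i} \<union> {tick T n (Suc i)..T}"
    using tick_mem[OF T j(1)] tick_le_iff[OF T, of n j i] tick_le_iff[OF T, of n "Suc i" j]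
    by (cases "j \<le> i") auto
qed

lemma next_tick:
  assumes T: "T > 0" and s: "s \<in> {0..T}"
  shows "next_tick T n s \<le> 2 ^ n" "s \<le> tick T n (next_tick T n s)"
    "tick T n (next_tick T n s) \<le> s + T / 2 ^ n" "next_tick T n s \<le> j \<longleftrightarrow> s \<le> tick T n j"
proof -
  have top: "s \<le> tick T n (2 ^ n)" using s by simp
  show "next_tick T n s \<le> 2 ^ n" unfolding next_tick_def using top by (rule Least_le)
  show ub: "s \<le> tick T n (next_tick T n s)" unfolding next_tick_def using top by (rule LeastI)
  show "tick T n (next_tick T n s) \<le> s + T / 2 ^ n"
  proof (cases "next_tick T n s")
    case 0
    have "T / 2 ^ n \<ge> 0" using T by simp
    then show ?thesis using 0 s by simp
  next
    case (Suc k)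
    then have "\<not> s \<le> tick T n k" unfolding next_tick_def by (intro not_less_Least) simp
    then show ?thesis using Suc by (simp add: tick_Suc)
  qed
  show "next_tick T n s \<le> j \<longleftrightarrow> s \<le> tick T n j"
  proof
    assume "next_tick T n s \<le> j"
    then have "tick T n (next_tick T n s) \<le> tick T n j" by (simp add: tick_le_iff[OF T])
    then show "s \<le> tick T n j" using ub by simp
  qed (auto simp: next_tick_def intro: Least_le)
qed

lemma next_tick_tendsto:
  assumes T: "T > 0" and s: "s \<in> {0..T}"
  shows "(\<lambda>n. tick T n (next_tick T n s)) \<longlonglongrightarrow> s"
proof (rule tendsto_sandwich[of "\<lambda>_. s" _ _ "\<lambda>n. s + T / 2 ^ n"])
  have "(\<lambda>n. s + T * (1 / 2) ^ n) \<longlonglongrightarrow> s + T * 0"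
    by (intro tendsto_intros LIMSEQ_power_zero) simp
  then show "(\<lambda>n. s + T / 2 ^ n) \<longlonglongrightarrow> s" by (simp add: power_divide)
qed (use next_tick(2,3)[OF assms] in simp_all)

lemma continuous_tick_tendsto:
  fixes f :: "real \<Rightarrow> real"
  assumes "T > 0" "s \<in> {0..T}" "continuous_on {0..T} f"
  shows "(\<lambda>n. f (tick T n (next_tick T n s))) \<longlonglongrightarrow> f s"
  using tick_mem[OF assms(1) next_tick(1)[OF assms(1,2)]]
  by (intro continuous_on_tendsto_compose[OF assms(3) next_tick_tendsto[OF assms(1,2)] assms(2)] always_eventually) blast

lemma continuous_on_bdd_above:
  fixes f :: "real \<Rightarrow> real"
  shows "continuous_on {a..b} f \<Longrightarrow> bdd_above (f ` {a..b})"
  by (intro bounded_imp_bdd_above compact_imp_bounded compact_continuous_image compact_Icc)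

text \<open>A maximiser rounded up to the mesh gives the squeeze: its value lies below the mesh
  maximum and tends to the true maximum by continuity, while the true maximum lies above.\<close>

lemma SUP_mesh_tendsto:
  fixes f :: "real \<Rightarrow> real"
  assumes T: "T > 0" and f: "continuous_on {0..T} f"
  shows "(\<lambda>n. SUP s\<in>mesh T n. f s) \<longlonglongrightarrow> (SUP s\<in>{0..T}. f s)"
proof -
  obtain s where s: "s \<in> {0..T}" "\<And>r. r \<in> {0..T} \<Longrightarrow> f r \<le> f s"
    using continuous_attains_sup[OF compact_Icc, of 0 T f] T f by auto
  have S: "(SUP s\<in>{0..T}. f s) = f s" by (intro cSup_eq_maximum) (use s in auto)
  show ?thesis unfolding S
  proof (rule tendsto_sandwich[OF _ _ continuous_tick_tendsto[OF T s(1) f] tendsto_const])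
    show "\<forall>\<^sub>F n in sequentially. f (tick T n (next_tick T n s)) \<le> (SUP s\<in>mesh T n. f s)"
      using next_tick(1)[OF T s(1)] by (intro always_eventually allI cSUP_upper bdd_above_finite) (auto simp: mesh_def)
    show "\<forall>\<^sub>F n in sequentially. (SUP s\<in>mesh T n. f s) \<le> f s"
      by (intro always_eventually allI cSUP_least s(2)) (simp, meson mesh_subset[OF T] subsetD)
  qed
qed

text \<open>The measurable space is arbitrary because the maximum is needed relative to the natural
  filtration and to \<open>skip_algebra\<close> as well as to \<open>P\<close>.\<close>

lemma measurable_running_max:
  assumes T: "T > 0" and X: "\<And>s. s \<in> {0..T} \<Longrightarrow> X s \<in> borel_measurable M"
    and c: "\<And>\<omega>. \<omega> \<in> space M \<Longrightarrow> continuous_on {0..T} (\<lambda>s. X s \<omega>)"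
  shows "running_max X T \<in> borel_measurable M"
proof (rule borel_measurable_LIMSEQ_real)
  show "(\<lambda>n. SUP s\<in>mesh T n. X s \<omega>) \<longlonglongrightarrow> running_max X T \<omega>" if "\<omega> \<in> space M" for \<omega>
    unfolding running_max_def by (rule SUP_mesh_tendsto[OF T c[OF that]])
  show "(\<lambda>\<omega>. SUP s\<in>mesh T n. X s \<omega>) \<in> borel_measurable M" for n
    using mesh_subset[OF T, of n] by (intro borel_measurable_cSUP X bdd_above_finite) (auto intro: countable_finite)
qed

lemma running_max_upper:
  assumes "continuous_on {0..t} (\<lambda>s. X s \<omega>)" "s \<in> {0..t}"
  shows "X s \<omega> \<le> running_max X t \<omega>"
  unfolding running_max_def using assms by (intro cSUP_upper continuous_on_bdd_above)

lemma running_max_least: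
  assumes "t \<ge> 0" "\<And>s. s \<in> {0..t} \<Longrightarrow> X s \<omega> \<le> u"
  shows "running_max X t \<omega> \<le> u"
  unfolding running_max_def using assms by (intro cSUP_least) auto

lemma running_max_attained:
  assumes "t \<ge> 0" "continuous_on {0..t} (\<lambda>s. X s \<omega>)"
  obtains s where "s \<in> {0..t}" "running_max X t \<omega> = X s \<omega>"
proof -
  obtain s where s: "s \<in> {0..t}" "\<And>r. r \<in> {0..t} \<Longrightarrow> X r \<omega> \<le> X s \<omega>"
    using continuous_attains_sup[OF compact_Icc, of 0 t "\<lambda>s. X s \<omega>"] assms by auto
  then show ?thesis
    using running_max_least[of t X \<omega> "X s \<omega>"] running_max_upper[where X=X and \<omega>=\<omega>, OF assms(2) s(1)] assms(1)
    by (intro that[of s] antisym) auto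
qed

subsection \<open>Exponential moments of the running maximum\<close>

text \<open>Doob's inequality in pathwise form. The two sums are the halves of the discrete integral
  of \<open>m\<close> against \<open>x\<close>, kept apart so that for positive \<open>x\<close> all
  terms are positive and can be read in \<open>ennreal\<close>. In the induction both sides grow
  equally while the maximum stands, and a new maximum leaves the slack
  \<open>(x (Suc N) - m N)\<^sup>2\<close>.\<close>

lemma pathwise_doob:
  fixes x :: "nat \<Rightarrow> real"
  defines "m \<equiv> \<lambda>i. Max (x ` {..i})"
  shows "m N ^ 2 + 2 * (\<Sum>i<N. m i * x (Suc i)) \<le> 2 * m N * x N + 2 * (\<Sum>i<N. m i * x i)"
proof (induction N)
  case 0
  then show ?case by (simp add: m_def power2_eq_square)
next
  case (Suc N)
  have m_Suc: "m (Suc N) = max (x (Suc N)) (m N)"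
    unfolding m_def by (simp add: atMost_Suc)
  show ?case
  proof (cases "x (Suc N) \<le> m N")
    case True
    then show ?thesis using Suc m_Suc by (simp add: algebra_simps)
  next
    case False
    have "0 \<le> (x (Suc N) - m N)\<^sup>2" by simp
    then show ?thesis using Suc m_Suc False by (simp add: algebra_simps power2_eq_square)
  qed
qed

text \<open>The mixed term is absorbed by \<open>4 * m N * x N \<le> m N ^ 2 + 4 * x N ^ 2\<close>,
  which produces Doob's constant 4 for second moments.\<close>

lemma pathwise_doob_square:
  fixes x :: "nat \<Rightarrow> real"
  defines "m \<equiv> \<lambda>i. Max (x ` {..i})"
  shows "m N ^ 2 + 4 * (\<Sum>i<N. m i * x (Suc i)) \<le> 4 * x N ^ 2 + 4 * (\<Sum>i<N. m i * x i)"
proof -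
  have "0 \<le> (m N - 2 * x N)\<^sup>2" by simp
  then have "4 * m N * x N \<le> m N ^ 2 + 4 * x N ^ 2" by (simp add: algebra_simps power2_eq_square)
  moreover have "2 * m N ^ 2 + 4 * (\<Sum>i<N. m i * x (Suc i)) \<le> 4 * m N * x N + 4 * (\<Sum>i<N. m i * x i)"
    using pathwise_doob[of x N] by (simp add: m_def algebra_simps)
  ultimately show ?thesis by linarith
qed

context brownian_motion
begin

lemma nn_integral_exp_B:
  fixes c :: real
  assumes "t \<in> {0..T}"
  shows "(\<integral>\<^sup>+\<omega>. ennreal (exp (c * B t \<omega>)) \<partial>P) = ennreal (exp (c\<^sup>2 * t / 2))"
proof (cases "t = 0")
  case True
  then have "(\<integral>\<^sup>+\<omega>. ennreal (exp (c * B t \<omega>)) \<partial>P) = (\<integral>\<^sup>+\<omega>. 1 \<partial>P)"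
    using B_start by (intro nn_integral_cong) simp
  then show ?thesis using True emeasure_space_1 by simp
next
  case False
  have "(\<integral>\<^sup>+\<omega>. ennreal (exp (c * B t \<omega>)) \<partial>P) = (\<integral>\<^sup>+\<omega>. 1 * ennreal (exp (c * (B t \<omega> - B 0 \<omega>))) \<partial>P)"
    using B_start by (intro nn_integral_cong) simp
  also have "\<dots> = ennreal (exp (c\<^sup>2 * t / 2))"
    using False assms emeasure_space_1 by (subst nn_integral_exp_increment) auto
  finally show ?thesis .
qed

lemma nn_integral_max_exp_square:
  fixes c :: real
  assumes T: "T > 0" and N: "N \<le> 2 ^ n"
  shows "(\<integral>\<^sup>+\<omega>. ennreal ((Max ((\<lambda>i. exp (c * B (tick T n i) \<omega>)) ` {..N}))\<^sup>2) \<partial>P)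
    \<le> 4 * ennreal (exp (2 * c\<^sup>2 * T))"
proof -
  define x where "x i \<omega> = exp (c * B (tick T n i) \<omega>)" for i \<omega>
  define m where "m i \<omega> = Max ((\<lambda>i. x i \<omega>) ` {..i})" for i \<omega>
  have tick: "tick T n i \<in> {0..T}" if "i \<le> N" for i
    using that N tick_mem[OF T, of i n] by auto
  have B_skip: "B s \<in> borel_measurable (skip_algebra a b)" if "s \<in> {0..a}" "a < b" for s a b
  proof -
    have "skip a b s = B s" using that by (auto simp: skip_def)
    then show ?thesis using measurable_skip_skip_algebra[of s a b] that by simp
  qed
  have x_meas: "x i \<in> borel_measurable M" if "B (tick T n i) \<in> borel_measurable M" for i M
    using that unfolding x_def by measurable
  have m_meas: "m i \<in> borel_measurable M" if "\<And>j. j \<le> i \<Longrightarrow> B (tick T n j) \<in> borel_measurable M" for i M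
    unfolding m_def by (intro borel_measurable_Max) (auto intro!: x_meas that)
  have [measurable]: "x i \<in> borel_measurable P" if "i \<le> N" for i
    using tick[OF that] by (intro x_meas measurable_B)
  have [measurable]: "m i \<in> borel_measurable P" if "i \<le> N" for i
    using tick that by (intro m_meas measurable_B) auto
  have x_pos: "x i \<omega> > 0" for i \<omega> by (simp add: x_def)
  have m_ge: "x i \<omega> \<le> m i \<omega>" for i \<omega> unfolding m_def by (intro Max_ge) auto
  have m_pos: "m i \<omega> > 0" for i \<omega> using x_pos[of i \<omega>] m_ge[of i \<omega>] by linarith
  have x2: "(\<integral>\<^sup>+\<omega>. ennreal ((x i \<omega>)\<^sup>2) \<partial>P) = ennreal (exp (2 * c\<^sup>2 * tick T n i))" if "i \<le> N" for i
  proof -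
    have "(x i \<omega>)\<^sup>2 = exp ((2 * c) * B (tick T n i) \<omega>)" for \<omega>
      by (simp add: x_def exp_double[symmetric] power2_eq_square mult.assoc exp_add[symmetric])
    then show ?thesis
      using nn_integral_exp_B[OF tick[OF that], of "2 * c"] by (simp add: power2_eq_square mult_ac)
  qed
  \<comment> \<open>A crude bound by the sum of all squares. Only finiteness matters: it permits the
    cancellation at the end, which fails in \<open>ennreal\<close> at infinity.\<close>
  have m2: "(\<integral>\<^sup>+\<omega>. ennreal ((m i \<omega>)\<^sup>2) \<partial>P) < \<infinity>" if "i \<le> N" for i
  proof -
    have "(\<integral>\<^sup>+\<omega>. ennreal ((m i \<omega>)\<^sup>2) \<partial>P) \<le> (\<integral>\<^sup>+\<omega>. (\<Sum>j\<le>i. ennreal ((x j \<omega>)\<^sup>2)) \<partial>P)"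
    proof (rule nn_integral_mono)
      fix \<omega>
      have "m i \<omega> \<in> (\<lambda>i. x i \<omega>) ` {..i}" unfolding m_def by (intro Max_in) auto
      then obtain j where "j \<le> i" "m i \<omega> = x j \<omega>" by auto
      then have "(m i \<omega>)\<^sup>2 \<le> (\<Sum>j\<le>i. (x j \<omega>)\<^sup>2)"
        by (simp add: member_le_sum[where f="\<lambda>j. (x j \<omega>)\<^sup>2" and A="{..i}"])
      then show "ennreal ((m i \<omega>)\<^sup>2) \<le> (\<Sum>j\<le>i. ennreal ((x j \<omega>)\<^sup>2))"
        by (simp add: sum_ennreal ennreal_leI)
    qed
    also have "\<dots> = (\<Sum>j\<le>i. \<integral>\<^sup>+\<omega>. ennreal ((x j \<omega>)\<^sup>2) \<partial>P)"
      using that by (intro nn_integral_sum) auto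
    also have "\<dots> = (\<Sum>j\<le>i. ennreal (exp (2 * c\<^sup>2 * tick T n j)))"
      using that by (intro sum.cong x2) auto
    also have "\<dots> < \<infinity>" by simp
    finally show ?thesis .
  qed
  have mx: "(\<integral>\<^sup>+\<omega>. ennreal (m i \<omega> * x i \<omega>) \<partial>P) < \<infinity>" if "i \<le> N" for i
  proof (rule le_less_trans[OF nn_integral_mono m2[OF that]])
    fix \<omega>
    show "ennreal (m i \<omega> * x i \<omega>) \<le> ennreal ((m i \<omega>)\<^sup>2)"
      using m_ge[of i \<omega>] m_pos[of i \<omega>] unfolding power2_eq_square by (intro ennreal_leI mult_left_mono) auto
  qed
  have step: "(\<integral>\<^sup>+\<omega>. ennreal (m i \<omega> * x i \<omega>) \<partial>P) \<le> (\<integral>\<^sup>+\<omega>. ennreal (m i \<omega> * x (Suc i) \<omega>) \<partial>P)"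
    if "i < N" for i
  proof -
    let ?a = "tick T n i" and ?b = "tick T n (Suc i)"
    have ab: "0 \<le> ?a" "?a < ?b" "?b \<le> T"
      using tick[of i] tick[of "Suc i"] that tick_less_iff[OF T, of n i "Suc i"] by auto
    have j: "B (tick T n j) \<in> borel_measurable (skip_algebra ?a ?b)" if "j \<le> i" for j
      using ab that tick_nonneg[OF T, of n j] tick_le_iff[OF T, of n j i] by (intro B_skip) auto
    have w: "(\<lambda>\<omega>. ennreal (m i \<omega> * x i \<omega>)) \<in> borel_measurable (skip_algebra ?a ?b)"
      using m_meas[OF j] x_meas[OF j] by measurable
    have "(\<integral>\<^sup>+\<omega>. ennreal (m i \<omega> * x i \<omega>) \<partial>P) \<le> ennreal (exp (c\<^sup>2 * (?b - ?a) / 2)) * (\<integral>\<^sup>+\<omega>. ennreal (m i \<omega> * x i \<omega>) \<partial>P)"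
    proof -
      have "1 \<le> ennreal (exp (c\<^sup>2 * (?b - ?a) / 2))" using ab by (simp flip: ennreal_1 add: ennreal_leI)
      then show ?thesis using mult_right_mono[of 1 "ennreal (exp (c\<^sup>2 * (?b - ?a) / 2))"] by fastforce
    qed
    also have "\<dots> = (\<integral>\<^sup>+\<omega>. ennreal (m i \<omega> * x i \<omega>) * ennreal (exp (c * (B ?b \<omega> - B ?a \<omega>))) \<partial>P)"
      using nn_integral_exp_increment[OF ab w, of c] by simp
    also have "\<dots> = (\<integral>\<^sup>+\<omega>. ennreal (m i \<omega> * x (Suc i) \<omega>) \<partial>P)"
    proof (rule nn_integral_cong)
      fix \<omega>
      have "m i \<omega> * x i \<omega> * exp (c * (B ?b \<omega> - B ?a \<omega>)) = m i \<omega> * x (Suc i) \<omega>"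
        by (simp add: x_def mult.assoc exp_add[symmetric] algebra_simps)
      then show "ennreal (m i \<omega> * x i \<omega>) * ennreal (exp (c * (B ?b \<omega> - B ?a \<omega>))) = ennreal (m i \<omega> * x (Suc i) \<omega>)"
        using m_pos[of i \<omega>] x_pos[of i \<omega>] by (metis ennreal_mult' less_imp_le mult_pos_pos exp_ge_zero ennreal_mult'')
    qed
    finally show ?thesis .
  qed
  let ?S = "\<Sum>i<N. \<integral>\<^sup>+\<omega>. ennreal (m i \<omega> * x i \<omega>) \<partial>P"
  let ?S' = "\<Sum>i<N. \<integral>\<^sup>+\<omega>. ennreal (m i \<omega> * x (Suc i) \<omega>) \<partial>P"
  have "(\<integral>\<^sup>+\<omega>. ennreal ((m N \<omega>)\<^sup>2) + 4 * (\<Sum>i<N. ennreal (m i \<omega> * x (Suc i) \<omega>)) \<partial>P)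
    \<le> (\<integral>\<^sup>+\<omega>. 4 * ennreal ((x N \<omega>)\<^sup>2) + 4 * (\<Sum>i<N. ennreal (m i \<omega> * x i \<omega>)) \<partial>P)"
  proof (rule nn_integral_mono)
    fix \<omega>
    have nn: "0 \<le> m i \<omega> * x j \<omega>" for i j using m_pos[of i \<omega>] x_pos[of j \<omega>] by simp
    have "ennreal ((m N \<omega>)\<^sup>2 + 4 * (\<Sum>i<N. m i \<omega> * x (Suc i) \<omega>)) \<le> ennreal (4 * (x N \<omega>)\<^sup>2 + 4 * (\<Sum>i<N. m i \<omega> * x i \<omega>))"
      using pathwise_doob_square[of "\<lambda>i. x i \<omega>" N] by (intro ennreal_leI) (simp add: m_def)
    then show "ennreal ((m N \<omega>)\<^sup>2) + 4 * (\<Sum>i<N. ennreal (m i \<omega> * x (Suc i) \<omega>))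
        \<le> 4 * ennreal ((x N \<omega>)\<^sup>2) + 4 * (\<Sum>i<N. ennreal (m i \<omega> * x i \<omega>))"
      using nn by (simp add: sum_ennreal sum_nonneg ennreal_plus ennreal_mult ennreal_numeral)
  qed
  moreover have "(\<integral>\<^sup>+\<omega>. (\<Sum>i<N. ennreal (m i \<omega> * x (Suc i) \<omega>)) \<partial>P) = ?S'"
    by (intro nn_integral_sum) auto
  moreover have "(\<integral>\<^sup>+\<omega>. (\<Sum>i<N. ennreal (m i \<omega> * x i \<omega>)) \<partial>P) = ?S"
    by (intro nn_integral_sum) auto
  ultimately have "(\<integral>\<^sup>+\<omega>. ennreal ((m N \<omega>)\<^sup>2) \<partial>P) + 4 * ?S' \<le> 4 * (\<integral>\<^sup>+\<omega>. ennreal ((x N \<omega>)\<^sup>2) \<partial>P) + 4 * ?S"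
    by (simp add: nn_integral_add nn_integral_cmult)
  moreover have "4 * ?S \<le> 4 * ?S'" by (intro mult_left_mono sum_mono step) auto
  ultimately have "(\<integral>\<^sup>+\<omega>. ennreal ((m N \<omega>)\<^sup>2) \<partial>P) + 4 * ?S \<le> 4 * (\<integral>\<^sup>+\<omega>. ennreal ((x N \<omega>)\<^sup>2) \<partial>P) + 4 * ?S"
    by (meson add_left_mono order_trans)
  moreover have "4 * ?S < \<infinity>"
    using mx by (auto simp: ennreal_mult_less_top)
  ultimately have "(\<integral>\<^sup>+\<omega>. ennreal ((m N \<omega>)\<^sup>2) \<partial>P) \<le> 4 * (\<integral>\<^sup>+\<omega>. ennreal ((x N \<omega>)\<^sup>2) \<partial>P)"
    unfolding add.commute[of _ "4 * ?S"] ennreal_add_left_cancel_le by (elim disjE) (simp, assumption)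
  also have "\<dots> \<le> 4 * ennreal (exp (2 * c\<^sup>2 * T))"
    unfolding x2[OF order_refl] using tick[of N] by (intro mult_left_mono ennreal_leI) (auto intro!: mult_left_mono)
  finally show ?thesis by (simp add: m_def x_def)
qed

text \<open>Fatou along the dyadic meshes turns the uniform discrete bound into one for the
  continuous maximum. The factor 2 in the exponent is the second moment that a product of two such
  exponentials will use up.\<close>

lemma nn_integral_exp_running_max:
  fixes c :: real
  assumes T: "T > 0"
  shows "(\<integral>\<^sup>+\<omega>. ennreal (exp (2 * running_max (\<lambda>s \<omega>. c * B s \<omega>) T \<omega>)) \<partial>P) < \<infinity>"
proof -
  let ?M = "\<lambda>n \<omega>. SUP s\<in>mesh T n. c * B s \<omega>"
  have eq: "exp (2 * ?M n \<omega>) = (Max ((\<lambda>i. exp (c * B (tick T n i) \<omega>)) ` {..2 ^ n}))\<^sup>2" for n \<omega>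
  proof -
    have "?M n \<omega> = Max ((\<lambda>i. c * B (tick T n i) \<omega>) ` {..2 ^ n})"
      by (simp add: mesh_def cSup_eq_Max image_image)
    then have "exp (?M n \<omega>) = Max (exp ` (\<lambda>i. c * B (tick T n i) \<omega>) ` {..2 ^ n})"
      using mono_Max_commute[of exp "(\<lambda>i. c * B (tick T n i) \<omega>) ` {..2 ^ n}"] by (simp add: monoI)
    then have "exp (?M n \<omega>) = Max ((\<lambda>i. exp (c * B (tick T n i) \<omega>)) ` {..2 ^ n})"
      by (simp add: image_image)
    then show ?thesis by (simp add: exp_double)
  qed
  have [measurable]: "?M n \<in> borel_measurable P" for n
    using mesh_subset[OF T, of n] by (intro borel_measurable_cSUP borel_measurable_times measurable_B bdd_above_finite)
      (auto intro: countable_finite)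
  have lim: "(\<lambda>n. ennreal (exp (2 * ?M n \<omega>))) \<longlonglongrightarrow> ennreal (exp (2 * running_max (\<lambda>s \<omega>. c * B s \<omega>) T \<omega>))"
    if "\<omega> \<in> space P" for \<omega>
    unfolding running_max_def
    by (intro tendsto_ennrealI tendsto_intros SUP_mesh_tendsto T continuous_on_mult_left continuous_paths that)
  have "(\<integral>\<^sup>+\<omega>. ennreal (exp (2 * running_max (\<lambda>s \<omega>. c * B s \<omega>) T \<omega>)) \<partial>P)
      = (\<integral>\<^sup>+\<omega>. liminf (\<lambda>n. ennreal (exp (2 * ?M n \<omega>))) \<partial>P)"
    by (intro nn_integral_cong) (metis lim lim_imp_Liminf sequentially_bot)
  also have "\<dots> \<le> liminf (\<lambda>n. \<integral>\<^sup>+\<omega>. ennreal (exp (2 * ?M n \<omega>)) \<partial>P)"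
    by (intro nn_integral_liminf) simp
  also have "\<dots> \<le> limsup (\<lambda>n. \<integral>\<^sup>+\<omega>. ennreal (exp (2 * ?M n \<omega>)) \<partial>P)"
    by (simp add: Liminf_le_Limsup)
  also have "\<dots> \<le> 4 * ennreal (exp (2 * c\<^sup>2 * T))"
    unfolding eq by (intro Limsup_bounded always_eventually allI nn_integral_max_exp_square T order_refl)
  also have "\<dots> < \<infinity>" by (simp add: ennreal_mult_less_top)
  finally show ?thesis .
qed

end

lemma measurable_next_tick:
  assumes [measurable]: "\<tau> \<in> borel_measurable M"
  shows "(\<lambda>\<omega>. next_tick T n (\<tau> \<omega>)) \<in> measurable M (count_space UNIV)"
  unfolding next_tick_def by measurable

lemma measurable_at_tick:
  assumes T: "T > 0" and X: "\<And>s. s \<in> {0..T} \<Longrightarrow> X s \<in> borel_measurable M"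
    and \<kappa>: "\<kappa> \<in> measurable M (count_space UNIV)" and le: "\<And>\<omega>. \<omega> \<in> space M \<Longrightarrow> \<kappa> \<omega> \<le> 2 ^ n"
  shows "(\<lambda>\<omega>. X (tick T n (\<kappa> \<omega>)) \<omega> :: real) \<in> borel_measurable M"
proof -
  \<comment> \<open>Composition with a countable index asks for measurability at every index, hence
    the truncation at \<open>2 ^ n\<close>, which changes nothing at the values that
    \<open>\<kappa>\<close> takes.\<close>
  have *: "(\<lambda>\<omega>. X (tick T n (min (2 ^ n) (\<kappa> \<omega>))) \<omega>) \<in> borel_measurable M"
    by (rule measurable_compose_countable[where f="\<lambda>i \<omega>. X (tick T n (min (2 ^ n) i)) \<omega>", OF _ \<kappa>])
       (intro X tick_mem T min.cobounded1)
  show ?thesis by (rule measurable_cong[THEN iffD1, OF _ *]) (simp add: min.absorb2 le)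
qed

lemma measurable_at_time:
  fixes T :: real
  assumes T: "T > 0" and X: "\<And>s. s \<in> {0..T} \<Longrightarrow> X s \<in> borel_measurable M"
    and c: "\<And>\<omega>. \<omega> \<in> space M \<Longrightarrow> continuous_on {0..T} (\<lambda>s. X s \<omega>)"
    and \<tau>: "\<tau> \<in> borel_measurable M" and le: "\<And>\<omega>. \<omega> \<in> space M \<Longrightarrow> \<tau> \<omega> \<in> {0..T}"
  shows "(\<lambda>\<omega>. X (\<tau> \<omega>) \<omega> :: real) \<in> borel_measurable M"
proof (rule borel_measurable_LIMSEQ_real)
  show "(\<lambda>n. X (tick T n (next_tick T n (\<tau> \<omega>))) \<omega>) \<longlonglongrightarrow> X (\<tau> \<omega>) \<omega>" if "\<omega> \<in> space M" for \<omega>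
    by (rule continuous_tick_tendsto[OF T le[OF that] c[OF that]])
  show "(\<lambda>\<omega>. X (tick T n (next_tick T n (\<tau> \<omega>))) \<omega>) \<in> borel_measurable M" for n
    by (rule measurable_at_tick[where X=X, OF T X measurable_next_tick[OF \<tau>] next_tick(1)[OF T le]])
qed

section \<open>The drifted process: integrable majorant and approximation of the cost\<close>

locale drifted_bm = brownian_motion P B T for P :: "'a measure" and B T +
  fixes \<sigma> l :: real
  assumes T_pos: "T > 0" and \<sigma>_pos: "\<sigma> > 0"
begin

abbreviation X :: "real \<Rightarrow> 'a \<Rightarrow> real" where "X \<equiv> with_drift B l"

abbreviation S :: "'a \<Rightarrow> real" where "S \<equiv> running_max X T"

text \<open>A bound for \<open>exp (\<sigma> * (X s \<omega> - X t \<omega>))\<close> uniform in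
  both times: the drift contributes at most \<open>\<sigma> * \<bar>l\<bar> * T\<close>, the two
  Brownian values at most the maxima of \<open>\<sigma> * B\<close> and
  \<open>- \<sigma> * B\<close>, and the product of the two exponentials is at most the sum of their
  squares.\<close>

definition dominator :: "'a \<Rightarrow> real" where
  "dominator \<omega> = exp (\<sigma> * \<bar>l\<bar> * T) * (exp (2 * running_max (\<lambda>s \<omega>. \<sigma> * B s \<omega>) T \<omega>) +
     exp (2 * running_max (\<lambda>s \<omega>. (-\<sigma>) * B s \<omega>) T \<omega>))"

lemma measurable_X_sub: "B s \<in> borel_measurable M \<Longrightarrow> X s \<in> borel_measurable M"
  unfolding with_drift_def[abs_def] by (intro borel_measurable_add borel_measurable_const)

lemma measurable_X: "s \<in> {0..T} \<Longrightarrow> X s \<in> borel_measurable P"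
  by (intro measurable_X_sub measurable_B)

lemma X_0: "\<omega> \<in> space P \<Longrightarrow> X 0 \<omega> = 0"
  by (simp add: with_drift_def B_start)

lemma continuous_X: "\<omega> \<in> space P \<Longrightarrow> continuous_on {0..T} (\<lambda>s. X s \<omega>)"
  unfolding with_drift_def by (intro continuous_intros continuous_paths)

lemma X_le_S: "\<omega> \<in> space P \<Longrightarrow> s \<in> {0..T} \<Longrightarrow> X s \<omega> \<le> S \<omega>"
  by (intro running_max_upper continuous_X)

lemma measurable_S [measurable]: "S \<in> borel_measurable P"
  using T_pos by (intro measurable_running_max measurable_X continuous_X)

lemma integrable_dominator: "integrable P dominator"
proof -
  have "integrable P (\<lambda>\<omega>. exp (2 * running_max (\<lambda>s \<omega>. c * B s \<omega>) T \<omega>))" for c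
  proof (rule integrableI_nonneg)
    have [measurable]: "running_max (\<lambda>s \<omega>. c * B s \<omega>) T \<in> borel_measurable P"
      using T_pos by (intro measurable_running_max borel_measurable_times measurable_B continuous_on_mult_left continuous_paths) auto
    show "(\<lambda>\<omega>. exp (2 * running_max (\<lambda>s \<omega>. c * B s \<omega>) T \<omega>)) \<in> borel_measurable P" by measurable
  qed (use nn_integral_exp_running_max[OF T_pos] in auto)
  from Bochner_Integration.integrable_add[OF this[of \<sigma>] this[of "-\<sigma>"]] show ?thesis
    unfolding dominator_def[abs_def] by (rule integrable_mult_right)
qed

lemma exp_increment_le_dominator:
  assumes \<omega>: "\<omega> \<in> space P" and st: "s \<in> {0..T}" "t \<in> {0..T}"
  shows "exp (\<sigma> * (X s \<omega> - X t \<omega>)) \<le> dominator \<omega>"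
proof -
  let ?R = "\<lambda>c. running_max (\<lambda>s \<omega>. c * B s \<omega>) T \<omega>"
  have R: "c * B r \<omega> \<le> ?R c" if "r \<in> {0..T}" for c r
    using that by (intro running_max_upper[where X="\<lambda>s \<omega>. c * B s \<omega>"] continuous_on_mult_left continuous_paths \<omega>)
  have "l * (s - t) \<le> \<bar>l\<bar> * \<bar>s - t\<bar>" by (metis abs_ge_self abs_mult)
  also have "\<dots> \<le> \<bar>l\<bar> * T" using st by (intro mult_left_mono) auto
  finally have "\<sigma> * (l * (s - t)) \<le> \<sigma> * (\<bar>l\<bar> * T)" using \<sigma>_pos by simp
  then have "\<sigma> * (X s \<omega> - X t \<omega>) \<le> \<sigma> * \<bar>l\<bar> * T + (?R \<sigma> + ?R (-\<sigma>))"
    using R[OF st(1), of \<sigma>] R[OF st(2), of "-\<sigma>"] by (simp add: with_drift_def algebra_simps)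
  then have "exp (\<sigma> * (X s \<omega> - X t \<omega>)) \<le> exp (\<sigma> * \<bar>l\<bar> * T) * (exp (?R \<sigma>) * exp (?R (-\<sigma>)))"
    by (simp flip: exp_add)
  also have "\<dots> \<le> exp (\<sigma> * \<bar>l\<bar> * T) * (exp (2 * ?R \<sigma>) + exp (2 * ?R (-\<sigma>)))"
  proof (rule mult_left_mono)
    have "a * b \<le> a\<^sup>2 + b\<^sup>2" if "0 \<le> a" "0 \<le> b" for a b :: real
      using sum_squares_bound[of a b] mult_nonneg_nonneg[OF that] by linarith
    from this[of "exp (?R \<sigma>)" "exp (?R (-\<sigma>))"] show "exp (?R \<sigma>) * exp (?R (-\<sigma>)) \<le> exp (2 * ?R \<sigma>) + exp (2 * ?R (-\<sigma>))"
      by (simp only: exp_double exp_ge_zero simp_thms)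
  qed simp
  finally show ?thesis by (simp add: dominator_def)
qed

lemma exp_S_le_dominator:
  assumes "\<omega> \<in> space P" "t \<in> {0..T}"
  shows "exp (\<sigma> * (S \<omega> - X t \<omega>)) \<le> dominator \<omega>"
proof -
  obtain s where s: "s \<in> {0..T}" "S \<omega> = X s \<omega>"
    using running_max_attained[of T X \<omega>] continuous_X[OF assms(1)] T_pos by auto
  then show ?thesis using exp_increment_le_dominator[OF assms(1) s(1) assms(2)] by simp
qed

lemma measurable_X_at:
  assumes "\<tau> \<in> borel_measurable P" "\<And>\<omega>. \<omega> \<in> space P \<Longrightarrow> \<tau> \<omega> \<in> {0..T}"
  shows "(\<lambda>\<omega>. X (\<tau> \<omega>) \<omega>) \<in> borel_measurable P"
  by (rule measurable_at_time[OF T_pos measurable_X continuous_X assms])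

lemma integrable_cost:
  assumes \<tau>: "\<tau> \<in> borel_measurable P" "\<And>\<omega>. \<omega> \<in> space P \<Longrightarrow> \<tau> \<omega> \<in> {0..T}"
  shows "integrable P (\<lambda>\<omega>. exp (\<sigma> * (S \<omega> - X (\<tau> \<omega>) \<omega>)))"
proof (rule Bochner_Integration.integrable_bound[OF integrable_dominator])
  have [measurable]: "(\<lambda>\<omega>. X (\<tau> \<omega>) \<omega>) \<in> borel_measurable P" by (rule measurable_X_at[OF \<tau>])
  show "(\<lambda>\<omega>. exp (\<sigma> * (S \<omega> - X (\<tau> \<omega>) \<omega>))) \<in> borel_measurable P" by measurable
  show "AE \<omega> in P. norm (exp (\<sigma> * (S \<omega> - X (\<tau> \<omega>) \<omega>))) \<le> norm (dominator \<omega>)"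
    using exp_S_le_dominator[OF _ \<tau>(2)] by (intro AE_I2) (fastforce intro: order_trans[OF _ abs_ge_self])
qed

lemma nn_integral_cost:
  assumes \<tau>: "\<tau> \<in> borel_measurable P" "\<And>\<omega>. \<omega> \<in> space P \<Longrightarrow> \<tau> \<omega> \<in> {0..T}"
  shows "(\<integral>\<^sup>+\<omega>. ennreal (exp (\<sigma> * (S \<omega> - X (\<tau> \<omega>) \<omega>))) \<partial>P) = ennreal (exp_cost P \<sigma> X T \<tau>)"
  unfolding exp_cost_def by (intro nn_integral_eq_integral integrable_cost \<tau>) auto

definition mesh_max :: "nat \<Rightarrow> 'a \<Rightarrow> real" where
  "mesh_max n \<omega> = (SUP s\<in>mesh T n. X s \<omega>)"

lemma measurable_mesh_max [measurable]: "mesh_max n \<in> borel_measurable P"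
  unfolding mesh_max_def[abs_def] using mesh_subset[OF T_pos, of n]
  by (intro borel_measurable_cSUP measurable_X bdd_above_finite) (auto intro: countable_finite)

lemma mesh_max_tendsto: "\<omega> \<in> space P \<Longrightarrow> (\<lambda>n. mesh_max n \<omega>) \<longlonglongrightarrow> S \<omega>"
  unfolding running_max_def mesh_max_def by (intro SUP_mesh_tendsto T_pos continuous_X)

lemma mesh_max_le_S: "\<omega> \<in> space P \<Longrightarrow> mesh_max n \<omega> \<le> S \<omega>"
  unfolding mesh_max_def using mesh_subset[OF T_pos, of n] by (intro cSUP_least X_le_S) auto

text \<open>Extended nonnegative, so that the Girsanov step and the splitting over events apply
  without repeated integrability checks. The maximum is the one over the mesh, since the step sees
  the path only there.\<close>

definition mesh_cost :: "nat \<Rightarrow> ('a \<Rightarrow> real) \<Rightarrow> ennreal" where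
  "mesh_cost n \<tau> = (\<integral>\<^sup>+\<omega>. ennreal (exp (\<sigma> * (mesh_max n \<omega> - X (\<tau> \<omega>) \<omega>))) \<partial>P)"

definition mesh_time :: "nat \<Rightarrow> ('a \<Rightarrow> real) \<Rightarrow> 'a \<Rightarrow> real" where
  "mesh_time n \<tau> \<omega> = tick T n (next_tick T n (\<tau> \<omega>))"

lemma mesh_time_mem: "\<tau> \<omega> \<in> {0..T} \<Longrightarrow> mesh_time n \<tau> \<omega> \<in> {0..T}"
  unfolding mesh_time_def by (intro tick_mem next_tick(1) T_pos)

lemma measurable_mesh_time [measurable]: "\<tau> \<in> borel_measurable M \<Longrightarrow> mesh_time n \<tau> \<in> borel_measurable M"
  unfolding mesh_time_def[abs_def] by (rule measurable_compose[OF measurable_next_tick]) simp_all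

lemma X_mesh_time_tendsto:
  "\<omega> \<in> space P \<Longrightarrow> \<tau> \<omega> \<in> {0..T} \<Longrightarrow> (\<lambda>n. X (mesh_time n \<tau> \<omega>) \<omega>) \<longlonglongrightarrow> X (\<tau> \<omega>) \<omega>"
  unfolding mesh_time_def by (intro continuous_tick_tendsto T_pos continuous_X)

lemma mesh_cost_tendsto:
  assumes \<tau>: "\<tau> \<in> borel_measurable P" "\<And>\<omega>. \<omega> \<in> space P \<Longrightarrow> \<tau> \<omega> \<in> {0..T}"
  shows "(\<lambda>n. mesh_cost n (mesh_time n \<tau>)) \<longlonglongrightarrow> ennreal (exp_cost P \<sigma> X T \<tau>)"
proof -
  have "(\<lambda>n. \<integral>\<^sup>+\<omega>. ennreal (exp (\<sigma> * (mesh_max n \<omega> - X (mesh_time n \<tau> \<omega>) \<omega>))) \<partial>P)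
    \<longlonglongrightarrow> (\<integral>\<^sup>+\<omega>. ennreal (exp (\<sigma> * (S \<omega> - X (\<tau> \<omega>) \<omega>))) \<partial>P)"
  proof (rule nn_integral_dominated_convergence[where w="\<lambda>\<omega>. ennreal (dominator \<omega>)"])
    have [measurable]: "(\<lambda>\<omega>. X (mesh_time n \<tau> \<omega>) \<omega>) \<in> borel_measurable P" for n
      by (intro measurable_X_at measurable_mesh_time mesh_time_mem \<tau>)
    show "(\<lambda>\<omega>. ennreal (exp (\<sigma> * (mesh_max n \<omega> - X (mesh_time n \<tau> \<omega>) \<omega>)))) \<in> borel_measurable P" for n
      by measurable
    have [measurable]: "(\<lambda>\<omega>. X (\<tau> \<omega>) \<omega>) \<in> borel_measurable P" by (rule measurable_X_at[OF \<tau>])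
    show "(\<lambda>\<omega>. ennreal (exp (\<sigma> * (S \<omega> - X (\<tau> \<omega>) \<omega>)))) \<in> borel_measurable P" by measurable
    show "(\<lambda>\<omega>. ennreal (dominator \<omega>)) \<in> borel_measurable P" using integrable_dominator by measurable
    have "0 \<le> dominator \<omega>" for \<omega> by (simp add: dominator_def)
    then show "(\<integral>\<^sup>+\<omega>. ennreal (dominator \<omega>) \<partial>P) < \<infinity>"
      using integrable_dominator by (simp add: nn_integral_eq_integral)
    show "AE \<omega> in P. ennreal (exp (\<sigma> * (mesh_max n \<omega> - X (mesh_time n \<tau> \<omega>) \<omega>))) \<le> ennreal (dominator \<omega>)" for n
    proof (intro AE_I2 ennreal_leI)
      fix \<omega> assume \<omega>: "\<omega> \<in> space P"
      have "exp (\<sigma> * (mesh_max n \<omega> - X (mesh_time n \<tau> \<omega>) \<omega>)) \<le> exp (\<sigma> * (S \<omega> - X (mesh_time n \<tau> \<omega>) \<omega>))"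
        using mesh_max_le_S[OF \<omega>] \<sigma>_pos by simp
      then show "exp (\<sigma> * (mesh_max n \<omega> - X (mesh_time n \<tau> \<omega>) \<omega>)) \<le> dominator \<omega>"
        using exp_S_le_dominator[OF \<omega> mesh_time_mem[where \<tau>=\<tau>, OF \<tau>(2)[OF \<omega>]]] by (rule order_trans)
    qed
  show "AE \<omega> in P. (\<lambda>n. ennreal (exp (\<sigma> * (mesh_max n \<omega> - X (mesh_time n \<tau> \<omega>) \<omega>)))) \<longlonglongrightarrow>
      ennreal (exp (\<sigma> * (S \<omega> - X (\<tau> \<omega>) \<omega>)))"
    by (intro AE_I2 tendsto_ennrealI tendsto_intros mesh_max_tendsto X_mesh_time_tendsto \<tau>)
qed
  then show ?thesis by (simp only: mesh_cost_def nn_integral_cost[OF \<tau>])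
qed

text \<open>Here the time is rounded but the full maximum is kept: freezing the initial value only
  needs times with finitely many values.\<close>

lemma exp_cost_mesh_time_tendsto:
  assumes \<tau>: "\<tau> \<in> borel_measurable P" "\<And>\<omega>. \<omega> \<in> space P \<Longrightarrow> \<tau> \<omega> \<in> {0..T}"
  shows "(\<lambda>n. exp_cost P \<sigma> X T (mesh_time n \<tau>)) \<longlonglongrightarrow> exp_cost P \<sigma> X T \<tau>"
  unfolding exp_cost_def
proof (rule integral_dominated_convergence[OF _ _ integrable_dominator])
  have [measurable]: "(\<lambda>\<omega>. X (mesh_time n \<tau> \<omega>) \<omega>) \<in> borel_measurable P" for n
    by (intro measurable_X_at measurable_mesh_time mesh_time_mem \<tau>)
  show "(\<lambda>\<omega>. exp (\<sigma> * (S \<omega> - X (mesh_time n \<tau> \<omega>) \<omega>))) \<in> borel_measurable P" for n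
    by measurable
  have [measurable]: "(\<lambda>\<omega>. X (\<tau> \<omega>) \<omega>) \<in> borel_measurable P" by (rule measurable_X_at[OF \<tau>])
  show "(\<lambda>\<omega>. exp (\<sigma> * (S \<omega> - X (\<tau> \<omega>) \<omega>))) \<in> borel_measurable P" by measurable
  show "AE \<omega> in P. norm (exp (\<sigma> * (S \<omega> - X (mesh_time n \<tau> \<omega>) \<omega>))) \<le> dominator \<omega>" for n
    using exp_S_le_dominator mesh_time_mem[where \<tau>=\<tau>, OF \<tau>(2)] by (intro AE_I2) simp
  show "AE \<omega> in P. (\<lambda>n. exp (\<sigma> * (S \<omega> - X (mesh_time n \<tau> \<omega>) \<omega>))) \<longlonglongrightarrow> exp (\<sigma> * (S \<omega> - X (\<tau> \<omega>) \<omega>))"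
    by (intro AE_I2 tendsto_intros X_mesh_time_tendsto \<tau>)
qed

end

subsection \<open>Comparison of stopping times with the extreme times\<close>

lemma sets_natural_filtration_subset:
  assumes "\<And>s. s \<in> {0..t} \<Longrightarrow> Y s \<in> borel_measurable M" "space M = space P"
  shows "sets (natural_filtration P Y t) \<subseteq> sets M"
proof -
  have "{Y s -` A \<inter> space P | s A. s \<in> {0..t} \<and> A \<in> sets borel} \<subseteq> sets M"
    using measurable_sets[OF assms(1)] unfolding assms(2) by blast
  from sets.sigma_sets_subset[OF this] show ?thesis
    unfolding sets_natural_filtration assms(2) .
qed

lemma sets_natural_filtration_mono:
  assumes "s \<le> t"
  shows "sets (natural_filtration P Y s) \<subseteq> sets (natural_filtration P Y t)"
  unfolding sets_natural_filtration using assms by (intro sigma_sets_mono') fastforce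

lemma measurable_natural_filtration:
  assumes "s \<in> {0..t}"
  shows "Y s \<in> borel_measurable (natural_filtration P Y t)"
proof (rule measurableI)
  fix A :: "real set" assume "A \<in> sets borel"
  then show "Y s -` A \<inter> space (natural_filtration P Y t) \<in> sets (natural_filtration P Y t)"
    unfolding sets_natural_filtration space_natural_filtration using assms by (intro sigma_sets.Basic) blast
qed simp

lemma stopping_times_sets:
  assumes "\<tau> \<in> stopping_times P Y T"
  shows "{\<omega>\<in>space P. \<tau> \<omega> \<le> t} \<in> sets (natural_filtration P Y t)"
  using assms stopping_timeD[of "natural_filtration P Y" \<tau> t]
  by (simp add: stopping_times_def pred_def)

lemma stopping_times_range:
  "\<tau> \<in> stopping_times P Y T \<Longrightarrow> \<omega> \<in> space P \<Longrightarrow> \<tau> \<omega> \<in> {0..T}"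
  by (simp add: stopping_times_def)

lemma stopping_timesI:
  assumes "\<And>\<omega>. \<omega> \<in> space P \<Longrightarrow> \<tau> \<omega> \<in> {0..T}"
    and sets: "\<And>t. 0 \<le> t \<Longrightarrow> t < T \<Longrightarrow> {\<omega>\<in>space P. \<tau> \<omega> \<le> t} \<in> sets (natural_filtration P Y t)"
  shows "\<tau> \<in> stopping_times P Y T"
proof -
  have "{\<omega>\<in>space P. \<tau> \<omega> \<le> t} \<in> sets (natural_filtration P Y t)" for t
  proof -
    have top: "space P \<in> sets (natural_filtration P Y t)"
      using sets.top[of "natural_filtration P Y t"] by simp
    consider "t < 0" | "0 \<le> t" "t < T" | "T \<le> t" by linarith
    then show ?thesis
    proof cases
      case 1
      then have "{\<omega>\<in>space P. \<tau> \<omega> \<le> t} = {}" using assms(1) by fastforce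
      then show ?thesis by (metis sets.empty_sets)
    next
      case 3
      then have "{\<omega>\<in>space P. \<tau> \<omega> \<le> t} = space P" using assms(1) by fastforce
      then show ?thesis using top by metis
    qed (rule sets)
  qed
  then show ?thesis
    using assms(1) by (simp add: stopping_times_def stopping_time_def pred_def)
qed

lemma stopping_times_measurable:
  assumes \<tau>: "\<tau> \<in> stopping_times P Y T" and Y: "\<And>s. s \<in> {0..T} \<Longrightarrow> Y s \<in> borel_measurable P"
  shows "\<tau> \<in> borel_measurable P"
  unfolding borel_measurable_iff_le
proof
  fix t
  show "{\<omega>\<in>space P. \<tau> \<omega> \<le> t} \<in> sets P"
  proof (cases "t \<le> T")
    case True
    then have "sets (natural_filtration P Y t) \<subseteq> sets P"
      using Y by (intro sets_natural_filtration_subset) auto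
    then show ?thesis using stopping_times_sets[OF \<tau>] by blast
  next
    case False
    then have "{\<omega>\<in>space P. \<tau> \<omega> \<le> t} = space P" using stopping_times_range[OF \<tau>] by fastforce
    then show ?thesis by (metis sets.top)
  qed
qed

lemma const_stopping_times: "c \<in> {0..T} \<Longrightarrow> (\<lambda>_. c) \<in> stopping_times P Y T"
proof (rule stopping_timesI)
  fix t
  show "{\<omega>\<in>space P. c \<le> t} \<in> sets (natural_filtration P Y t)"
    using sets.top[of "natural_filtration P Y t"] by (cases "c \<le> t") simp_all
qed

context drifted_bm
begin

text \<open>The free deterministic \<open>f\<close> allows iteration: it is the drift for a single
  step, and the drift minus the lowering already accumulated when several cells are treated in
  succession.\<close>

lemma mesh_girsanov_step:
  assumes i: "i < 2 ^ n" and w: "w \<in> borel_measurable (skip_algebra (tick T n i) (tick T n (Suc i)))"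
  shows "(\<integral>\<^sup>+\<omega>. w \<omega> * ennreal (exp (\<sigma> * (SUP s\<in>mesh T n. B s \<omega> + f s))) *
      ennreal (exp (- \<sigma> * (B (tick T n (Suc i)) \<omega> - B (tick T n i) \<omega>))) \<partial>P) =
    ennreal (exp (\<sigma>\<^sup>2 * (T / 2 ^ n) / 2)) *
    (\<integral>\<^sup>+\<omega>. w \<omega> * ennreal (exp (\<sigma> * (SUP s\<in>mesh T n.
        B s \<omega> - (if tick T n (Suc i) \<le> s then \<sigma> * (T / 2 ^ n) else 0) + f s))) \<partial>P)"
proof -
  let ?a = "tick T n i" and ?b = "tick T n (Suc i)"
  have ab: "0 \<le> ?a" "?a < ?b" "?b \<le> T"
    using T_pos i by (auto simp: tick_less_iff intro: tick_nonneg tick_le)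
  have ba: "?b - ?a = T / 2 ^ n" by (simp add: tick_Suc)
  let ?\<Phi> = "\<lambda>x. ennreal (exp (\<sigma> * (SUP s\<in>mesh T n. x s + f s)))"
  have "(\<lambda>x. SUP s\<in>mesh T n. x s + f s) \<in> borel_measurable (PiM (mesh T n) (\<lambda>_. borel))"
    by (intro borel_measurable_cSUP borel_measurable_add borel_measurable_const measurable_component_singleton
        bdd_above_finite countable_finite finite_imageI finite_mesh)
  then have \<Phi>: "?\<Phi> \<in> borel_measurable (PiM (mesh T n) (\<lambda>_. borel))" by measurable
  have "?\<Phi> (\<lambda>s\<in>mesh T n. y s) = ?\<Phi> y" for y
    by (intro arg_cong[where f="\<lambda>x. ennreal (exp (\<sigma> * x))"] SUP_cong) auto
  then show ?thesis
    using nn_integral_girsanov_step[OF ab mesh_avoids[OF T_pos] w \<Phi>, of \<sigma>] by (simp only: ba)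
qed

lemma mesh_max_eq: "mesh_max n \<omega> = (SUP s\<in>mesh T n. B s \<omega> + l * s)"
  by (simp add: mesh_max_def with_drift_def)

text \<open>After the change of measure, the exponent for stopping at \<open>Suc i\<close> exceeds
  the one for stopping at \<open>i\<close> by \<open>\<sigma>\<^sup>2 * \<delta> / 2 - \<sigma> * l
  * \<delta> + \<sigma> * (m \<omega> - mesh_max n \<omega>)\<close>. The last term lies between
  \<open>- \<sigma>\<^sup>2 * \<delta>\<close> and \<open>0\<close>, which settles the sign beyond
  either threshold.\<close>

lemma mesh_step:
  assumes i: "i < 2 ^ n" and A: "A \<in> sets (natural_filtration P B (tick T n i))"
  defines "cost \<equiv> \<lambda>j. \<integral>\<^sup>+\<omega>. indicator A \<omega> * ennreal (exp (\<sigma> * (mesh_max n \<omega> - X (tick T n j) \<omega>))) \<partial>P"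
  shows "l \<ge> \<sigma> / 2 \<Longrightarrow> cost (Suc i) \<le> cost i" and "l \<le> - \<sigma> / 2 \<Longrightarrow> cost i \<le> cost (Suc i)"
proof -
  let ?a = "tick T n i" and ?b = "tick T n (Suc i)"
  define \<delta> where "\<delta> = T / 2 ^ n"
  have \<delta>: "\<delta> > 0" using T_pos by (simp add: \<delta>_def)
  have b: "?b = ?a + \<delta>" by (simp add: tick_Suc \<delta>_def)
  have ab: "0 \<le> ?a" "?a < ?b" "?b \<le> T"
    using T_pos i by (auto simp: tick_less_iff intro: tick_nonneg tick_le)
  define m where "m \<omega> = (SUP s\<in>mesh T n. B s \<omega> - (if ?b \<le> s then \<sigma> * \<delta> else 0) + l * s)" for \<omega>
  have bdd: "bdd_above (g ` mesh T n)" for g :: "real \<Rightarrow> real" by (intro bdd_above_finite) simp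
  have m_le: "m \<omega> \<le> mesh_max n \<omega>" for \<omega>
    unfolding m_def mesh_max_eq using \<sigma>_pos \<delta> by (intro cSUP_mono bdd) (auto intro!: bexI)
  have m_ge: "mesh_max n \<omega> - \<sigma> * \<delta> \<le> m \<omega>" for \<omega>
  proof -
    have "mesh_max n \<omega> \<le> m \<omega> + \<sigma> * \<delta>"
      unfolding mesh_max_eq
    proof (rule cSUP_least)
      fix s assume s: "s \<in> mesh T n"
      have "B s \<omega> - (if ?b \<le> s then \<sigma> * \<delta> else 0) + l * s \<le> m \<omega>"
        unfolding m_def by (rule cSUP_upper[OF s bdd])
      then show "B s \<omega> + l * s \<le> m \<omega> + \<sigma> * \<delta>" using mult_pos_pos[OF \<sigma>_pos \<delta>] by (cases "?b \<le> s") simp_all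
    qed simp
    then show ?thesis by simp
  qed
  have [measurable]: "A \<in> sets (skip_algebra ?a ?b)"
    using A sets_natural_filtration_subset_skip_algebra[OF ab(2)] by blast
  have "skip ?a ?b ?a = B ?a" using ab by (auto simp: skip_def)
  then have [measurable]: "B ?a \<in> borel_measurable (skip_algebra ?a ?b)"
    using measurable_skip_skip_algebra[of ?a ?a ?b] ab by simp
  \<comment> \<open>The part of the cost at \<open>Suc i\<close> that is known at time
    \<open>?a\<close>: the event, the value of the path there, and the deterministic drift over the
    cell. What remains is the maximum and the increment.\<close>
  let ?w = "\<lambda>\<omega>. indicator A \<omega> * ennreal (exp (- \<sigma> * X ?a \<omega> - \<sigma> * l * \<delta>))"
  have [measurable]: "X ?a \<in> borel_measurable (skip_algebra ?a ?b)" by (intro measurable_X_sub) measurable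
  have w: "?w \<in> borel_measurable (skip_algebra ?a ?b)" by measurable
  have [measurable]: "A \<in> events" "B ?a \<in> borel_measurable P"
    using \<open>A \<in> sets (skip_algebra ?a ?b)\<close> subalgebra_skip_algebra[OF ab] ab
    by (auto simp: subalgebra_def intro: measurable_B)
  have [measurable]: "X ?a \<in> borel_measurable P" by (intro measurable_X_sub) measurable
  have [measurable]: "m \<in> borel_measurable P"
  proof -
    have "B s \<in> borel_measurable P" if "s \<in> mesh T n" for s
      using that mesh_subset[OF T_pos] by (intro measurable_B) blast
    then show ?thesis unfolding m_def
      by (intro borel_measurable_cSUP bdd countable_finite finite_mesh borel_measurable_add borel_measurable_diff
          borel_measurable_const)
  qed
  have "cost (Suc i) = (\<integral>\<^sup>+\<omega>. ?w \<omega> * ennreal (exp (\<sigma> * (SUP s\<in>mesh T n. B s \<omega> + l * s))) *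
      ennreal (exp (- \<sigma> * (B ?b \<omega> - B ?a \<omega>))) \<partial>P)"
    unfolding cost_def
  proof (rule nn_integral_cong)
    fix \<omega>
    have "exp (- \<sigma> * X ?a \<omega> - \<sigma> * l * \<delta>) * exp (\<sigma> * mesh_max n \<omega>) * exp (- \<sigma> * (B ?b \<omega> - B ?a \<omega>))
      = exp (\<sigma> * (mesh_max n \<omega> - X ?b \<omega>))"
      by (simp add: with_drift_def b exp_add[symmetric] algebra_simps)
    then show "indicator A \<omega> * ennreal (exp (\<sigma> * (mesh_max n \<omega> - X ?b \<omega>))) =
      ?w \<omega> * ennreal (exp (\<sigma> * (SUP s\<in>mesh T n. B s \<omega> + l * s))) * ennreal (exp (- \<sigma> * (B ?b \<omega> - B ?a \<omega>)))"
      by (simp only: mesh_max_eq[symmetric] mult.assoc ennreal_mult[symmetric] exp_ge_zero mult_nonneg_nonneg)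
  qed
  also have "\<dots> = ennreal (exp (\<sigma>\<^sup>2 * \<delta> / 2)) * (\<integral>\<^sup>+\<omega>. ?w \<omega> * ennreal (exp (\<sigma> * m \<omega>)) \<partial>P)"
    unfolding m_def \<delta>_def by (rule mesh_girsanov_step[OF i w[unfolded \<delta>_def]])
  also have "\<dots> = (\<integral>\<^sup>+\<omega>. ennreal (exp (\<sigma>\<^sup>2 * \<delta> / 2)) * (?w \<omega> * ennreal (exp (\<sigma> * m \<omega>))) \<partial>P)"
    by (rule nn_integral_cmult[symmetric]) measurable
  also have "\<dots> = (\<integral>\<^sup>+\<omega>. indicator A \<omega> *
      ennreal (exp (\<sigma>\<^sup>2 * \<delta> / 2 + (- \<sigma> * X ?a \<omega> - \<sigma> * l * \<delta>) + \<sigma> * m \<omega>)) \<partial>P)"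
    by (intro nn_integral_cong) (simp add: exp_add ennreal_mult mult_ac)
  finally have eq: "cost (Suc i) = \<dots>" .
  show "cost (Suc i) \<le> cost i" if l: "l \<ge> \<sigma> / 2"
    unfolding eq unfolding cost_def
  proof (intro nn_integral_mono mult_left_mono ennreal_leI)
    fix \<omega>
    have "\<sigma> * m \<omega> \<le> \<sigma> * mesh_max n \<omega>" using m_le \<sigma>_pos by simp
    moreover have "(\<sigma> * \<delta>) * (\<sigma> / 2) \<le> (\<sigma> * \<delta>) * l" using l \<sigma>_pos \<delta> by (intro mult_left_mono) auto
    ultimately show "exp (\<sigma>\<^sup>2 * \<delta> / 2 + (- \<sigma> * X ?a \<omega> - \<sigma> * l * \<delta>) + \<sigma> * m \<omega>) \<le> exp (\<sigma> * (mesh_max n \<omega> - X ?a \<omega>))"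
      by (simp add: algebra_simps power2_eq_square)
  qed simp
  show "cost i \<le> cost (Suc i)" if l: "l \<le> - \<sigma> / 2"
    unfolding eq unfolding cost_def
  proof (intro nn_integral_mono mult_left_mono ennreal_leI)
    fix \<omega>
    have "\<sigma> * (mesh_max n \<omega> - \<sigma> * \<delta>) \<le> \<sigma> * m \<omega>" using m_ge \<sigma>_pos by (intro mult_left_mono) auto
    moreover have "(\<sigma> * \<delta>) * l \<le> (\<sigma> * \<delta>) * (- \<sigma> / 2)" using l \<sigma>_pos \<delta> by (intro mult_left_mono) auto
    ultimately show "exp (\<sigma> * (mesh_max n \<omega> - X ?a \<omega>)) \<le> exp (\<sigma>\<^sup>2 * \<delta> / 2 + (- \<sigma> * X ?a \<omega> - \<sigma> * l * \<delta>) + \<sigma> * m \<omega>)"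
      by (simp add: algebra_simps power2_eq_square)
  qed simp
qed

lemma mesh_cost_split:
  assumes [measurable]: "A \<in> events"
    and "(\<lambda>\<omega>. X (\<tau>1 \<omega>) \<omega>) \<in> borel_measurable P" "(\<lambda>\<omega>. X (\<tau>2 \<omega>) \<omega>) \<in> borel_measurable P"
    and "\<And>\<omega>. \<omega> \<in> space P \<Longrightarrow> \<tau> \<omega> = (if \<omega> \<in> A then \<tau>1 \<omega> else \<tau>2 \<omega>)"
  shows "mesh_cost n \<tau> = (\<integral>\<^sup>+\<omega>. indicator A \<omega> * ennreal (exp (\<sigma> * (mesh_max n \<omega> - X (\<tau>1 \<omega>) \<omega>))) \<partial>P) +
    (\<integral>\<^sup>+\<omega>. indicator (- A) \<omega> * ennreal (exp (\<sigma> * (mesh_max n \<omega> - X (\<tau>2 \<omega>) \<omega>))) \<partial>P)"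
proof -
  note [measurable] = assms(2,3)
  have "indicator (- A) \<omega> = (1 - indicator A \<omega> :: ennreal)" for \<omega> by (simp split: split_indicator)
  then have [measurable]: "(\<lambda>\<omega>. indicator (- A) \<omega> :: ennreal) \<in> borel_measurable P" by simp
  show ?thesis
    unfolding mesh_cost_def
    by (subst nn_integral_add[symmetric]; (measurable)?)
      (auto intro!: nn_integral_cong simp: assms(4) split: split_indicator)
qed

text \<open>The rounded time is carried to \<open>T\<close> through \<open>max i \<kappa>\<close>,
  or reached from \<open>0\<close> through \<open>min i \<kappa>\<close>, one cell at a time.
  Passing from \<open>i\<close> to \<open>Suc i\<close> alters the time only on
  \<open>{\<kappa> \<le> i}\<close>, respectively on its complement, both decided at tick
  \<open>i\<close>; there the index moves from \<open>i\<close> to \<open>Suc i\<close>, which is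
  the one-step comparison.\<close>

proposition mesh_cost_bounds:
  assumes \<tau>: "\<tau> \<in> stopping_times P B T"
  shows "l \<ge> \<sigma> / 2 \<Longrightarrow> mesh_cost n (\<lambda>_. T) \<le> mesh_cost n (mesh_time n \<tau>)"
    and "l \<le> - \<sigma> / 2 \<Longrightarrow> mesh_cost n (\<lambda>_. 0) \<le> mesh_cost n (mesh_time n \<tau>)"
proof -
  define \<kappa> where "\<kappa> \<omega> = next_tick T n (\<tau> \<omega>)" for \<omega>
  have \<tau>_m: "\<tau> \<in> borel_measurable P" by (intro stopping_times_measurable[OF \<tau>] measurable_B)
  have \<kappa>_m [measurable]: "\<kappa> \<in> measurable P (count_space UNIV)"
    unfolding \<kappa>_def[abs_def] by (rule measurable_next_tick[OF \<tau>_m])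
  have \<kappa>_le: "\<kappa> \<omega> \<le> 2 ^ n" if "\<omega> \<in> space P" for \<omega>
    unfolding \<kappa>_def by (rule next_tick(1)[OF T_pos stopping_times_range[OF \<tau> that]])
  define A where "A i = {\<omega>\<in>space P. \<kappa> \<omega> \<le> i}" for i
  have A: "A i \<in> sets (natural_filtration P B (tick T n i))" for i
  proof -
    have "A i = {\<omega>\<in>space P. \<tau> \<omega> \<le> tick T n i}"
      unfolding A_def \<kappa>_def using next_tick(4)[OF T_pos stopping_times_range[OF \<tau>]] by auto
    then show ?thesis using stopping_times_sets[OF \<tau>] by simp
  qed
  have A_ev [measurable]: "A i \<in> events" for i unfolding A_def by measurable
  have X_\<kappa>: "(\<lambda>\<omega>. X (tick T n (\<kappa> \<omega>)) \<omega>) \<in> borel_measurable P"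
    by (rule measurable_at_tick[where X=X, OF T_pos measurable_X \<kappa>_m \<kappa>_le])
  have X_i: "(\<lambda>\<omega>. X (tick T n i) \<omega>) \<in> borel_measurable P" if "i \<le> 2 ^ n" for i
    using tick_mem[OF T_pos that] by (rule measurable_X)
  have time: "mesh_time n \<tau> = (\<lambda>\<omega>. tick T n (\<kappa> \<omega>))" by (simp add: mesh_time_def \<kappa>_def fun_eq_iff)
  have cong: "mesh_cost n \<rho> = mesh_cost n \<rho>'" if "\<And>\<omega>. \<omega> \<in> space P \<Longrightarrow> \<rho> \<omega> = \<rho>' \<omega>" for \<rho> \<rho>'
    unfolding mesh_cost_def using that by (intro nn_integral_cong) simp
  show "mesh_cost n (\<lambda>_. T) \<le> mesh_cost n (mesh_time n \<tau>)" if l: "l \<ge> \<sigma> / 2"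
  proof -
    have "mesh_cost n (\<lambda>\<omega>. tick T n (max i (\<kappa> \<omega>))) \<le> mesh_cost n (\<lambda>\<omega>. tick T n (\<kappa> \<omega>))" if "i \<le> 2 ^ n" for i
      using that
    proof (induction i)
      case (Suc i)
      have "mesh_cost n (\<lambda>\<omega>. tick T n (max (Suc i) (\<kappa> \<omega>))) =
          (\<integral>\<^sup>+\<omega>. indicator (A i) \<omega> * ennreal (exp (\<sigma> * (mesh_max n \<omega> - X (tick T n (Suc i)) \<omega>))) \<partial>P) +
          (\<integral>\<^sup>+\<omega>. indicator (- A i) \<omega> * ennreal (exp (\<sigma> * (mesh_max n \<omega> - X (tick T n (\<kappa> \<omega>)) \<omega>))) \<partial>P)"
        using Suc.prems by (intro mesh_cost_split X_\<kappa> X_i A_ev) (auto simp: A_def max_def)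
      also have "\<dots> \<le> (\<integral>\<^sup>+\<omega>. indicator (A i) \<omega> * ennreal (exp (\<sigma> * (mesh_max n \<omega> - X (tick T n i) \<omega>))) \<partial>P) +
          (\<integral>\<^sup>+\<omega>. indicator (- A i) \<omega> * ennreal (exp (\<sigma> * (mesh_max n \<omega> - X (tick T n (\<kappa> \<omega>)) \<omega>))) \<partial>P)"
        using Suc.prems by (intro add_right_mono mesh_step(1) A l) simp
      also have "\<dots> = mesh_cost n (\<lambda>\<omega>. tick T n (max i (\<kappa> \<omega>)))"
        using Suc.prems by (intro mesh_cost_split[symmetric] X_\<kappa> X_i A_ev) (auto simp: A_def max_def)
      finally show ?case using Suc by simp
    qed simp
    from this[of "2 ^ n"] show ?thesis
      using cong[of "\<lambda>\<omega>. tick T n (max (2 ^ n) (\<kappa> \<omega>))" "\<lambda>_. T"] \<kappa>_le by (simp add: time max.absorb1)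
  qed
  show "mesh_cost n (\<lambda>_. 0) \<le> mesh_cost n (mesh_time n \<tau>)" if l: "l \<le> - \<sigma> / 2"
  proof -
    have "mesh_cost n (\<lambda>_. 0) \<le> mesh_cost n (\<lambda>\<omega>. tick T n (min i (\<kappa> \<omega>)))" if "i \<le> 2 ^ n" for i
      using that
    proof (induction i)
      case (Suc i)
      let ?C = "space P - A i"
      have C: "?C \<in> sets (natural_filtration P B (tick T n i))"
        using sets.compl_sets[OF A[of i]] by simp
      have C_ev: "?C \<in> events" by measurable
      have "mesh_cost n (\<lambda>\<omega>. tick T n (min i (\<kappa> \<omega>))) =
          (\<integral>\<^sup>+\<omega>. indicator ?C \<omega> * ennreal (exp (\<sigma> * (mesh_max n \<omega> - X (tick T n i) \<omega>))) \<partial>P) +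
          (\<integral>\<^sup>+\<omega>. indicator (- ?C) \<omega> * ennreal (exp (\<sigma> * (mesh_max n \<omega> - X (tick T n (\<kappa> \<omega>)) \<omega>))) \<partial>P)"
        using Suc.prems by (intro mesh_cost_split X_\<kappa> X_i C_ev) (auto simp: A_def min_def)
      also have "\<dots> \<le> (\<integral>\<^sup>+\<omega>. indicator ?C \<omega> * ennreal (exp (\<sigma> * (mesh_max n \<omega> - X (tick T n (Suc i)) \<omega>))) \<partial>P) +
          (\<integral>\<^sup>+\<omega>. indicator (- ?C) \<omega> * ennreal (exp (\<sigma> * (mesh_max n \<omega> - X (tick T n (\<kappa> \<omega>)) \<omega>))) \<partial>P)"
        using Suc.prems by (intro add_right_mono mesh_step(2) C l) simp
      also have "\<dots> = mesh_cost n (\<lambda>\<omega>. tick T n (min (Suc i) (\<kappa> \<omega>)))"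
        using Suc.prems by (intro mesh_cost_split[symmetric] X_\<kappa> X_i C_ev) (auto simp: A_def min_def)
      finally show ?case using Suc by (meson Suc_leD order_trans)
    qed simp
    from this[of "2 ^ n"] show ?thesis
      using cong[of "\<lambda>\<omega>. tick T n (min (2 ^ n) (\<kappa> \<omega>))" "\<lambda>\<omega>. tick T n (\<kappa> \<omega>)"] \<kappa>_le by (simp add: time min.absorb2)
  qed
qed

lemma mesh_time_0: "mesh_time n (\<lambda>_. 0) = (\<lambda>_. 0)"
  by (simp add: mesh_time_def fun_eq_iff next_tick_def Least_eq_0)

lemma mesh_time_top: "mesh_time n (\<lambda>_. T) = (\<lambda>_. T)"
proof
  fix \<omega> :: 'a
  show "mesh_time n (\<lambda>_. T) \<omega> = T"
    using next_tick(2)[OF T_pos, of T n] tick_le[OF T_pos next_tick(1)[OF T_pos, of T n]] T_pos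
    by (simp add: mesh_time_def)
qed

text \<open>The constant time is a mesh point at every level, so rounding leaves it unchanged and
  the mesh inequality passes to the limit.\<close>

theorem exp_cost_ge_terminal:
  assumes l: "l \<ge> \<sigma> / 2" and \<tau>: "\<tau> \<in> stopping_times P B T"
  shows "exp_cost P \<sigma> X T (\<lambda>_. T) \<le> exp_cost P \<sigma> X T \<tau>"
proof -
  have "ennreal (exp_cost P \<sigma> X T (\<lambda>_. T)) \<le> ennreal (exp_cost P \<sigma> X T \<tau>)"
  proof (rule LIMSEQ_le)
    show "(\<lambda>n. mesh_cost n (\<lambda>_. T)) \<longlonglongrightarrow> ennreal (exp_cost P \<sigma> X T (\<lambda>_. T))"
      using mesh_cost_tendsto[of "\<lambda>_. T"] T_pos by (simp add: mesh_time_top)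
    show "(\<lambda>n. mesh_cost n (mesh_time n \<tau>)) \<longlonglongrightarrow> ennreal (exp_cost P \<sigma> X T \<tau>)"
      by (intro mesh_cost_tendsto stopping_times_measurable[OF \<tau>] measurable_B stopping_times_range[OF \<tau>])
    show "\<exists>N. \<forall>n\<ge>N. mesh_cost n (\<lambda>_. T) \<le> mesh_cost n (mesh_time n \<tau>)"
      using mesh_cost_bounds(1)[OF \<tau> l] by blast
  qed
  then show ?thesis by (simp add: exp_cost_def)
qed

theorem exp_cost_ge_initial:
  assumes l: "l \<le> - \<sigma> / 2" and \<tau>: "\<tau> \<in> stopping_times P B T"
  shows "exp_cost P \<sigma> X T (\<lambda>_. 0) \<le> exp_cost P \<sigma> X T \<tau>"
proof -
  have "ennreal (exp_cost P \<sigma> X T (\<lambda>_. 0)) \<le> ennreal (exp_cost P \<sigma> X T \<tau>)"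
  proof (rule LIMSEQ_le)
    show "(\<lambda>n. mesh_cost n (\<lambda>_. 0)) \<longlonglongrightarrow> ennreal (exp_cost P \<sigma> X T (\<lambda>_. 0))"
      using mesh_cost_tendsto[of "\<lambda>_. 0"] T_pos by (simp add: mesh_time_0)
    show "(\<lambda>n. mesh_cost n (mesh_time n \<tau>)) \<longlonglongrightarrow> ennreal (exp_cost P \<sigma> X T \<tau>)"
      by (intro mesh_cost_tendsto stopping_times_measurable[OF \<tau>] measurable_B stopping_times_range[OF \<tau>])
    show "\<exists>N. \<forall>n\<ge>N. mesh_cost n (\<lambda>_. 0) \<le> mesh_cost n (mesh_time n \<tau>)"
      using mesh_cost_bounds(2)[OF \<tau> l] by blast
  qed
  then show ?thesis by (simp add: exp_cost_def)
qed

subsection \<open>Freezing an independent initial value\<close>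

lemma exp_cost_nonneg: "0 \<le> exp_cost P \<sigma> X T \<tau>"
  by (simp add: exp_cost_def)

lemma bdd_below_exp_cost: "bdd_below (exp_cost P \<sigma> X T ` \<T>)"
  by (rule bdd_belowI[where m=0]) (auto intro: exp_cost_nonneg)

lemma measurable_S_natural_filtration: "S \<in> borel_measurable (natural_filtration P B T)"
  by (intro measurable_running_max T_pos measurable_X_sub measurable_natural_filtration) (auto intro: continuous_X)

text \<open>The assumption \<open>enl\<close> says that \<open>\<tau>\<close> is a stopping time of
  \<open>B\<close> when \<open>Z0\<close> is known from the start. With \<open>Z0\<close> frozen at
  \<open>z\<close>, its rounding becomes a stopping time \<open>\<rho> z\<close> of \<open>B\<close>
  alone, whose cost is at least the infimum; integrating \<open>z\<close> against the law of the
  independent \<open>Z0\<close> recovers the cost of the rounded \<open>\<tau>\<close>. Rounding to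
  the mesh leaves finitely many events to be represented by sections.\<close>

proposition exp_cost_ge_INF_enlarged:
  fixes Z0 :: "'a \<Rightarrow> real"
  assumes Z0: "Z0 \<in> borel_measurable P"
    and ind: "indep_set (sets (vimage_algebra (space P) Z0 borel)) (sets (natural_filtration P B T))"
    and \<tau>: "\<tau> \<in> borel_measurable P" and range: "\<And>\<omega>. \<omega> \<in> space P \<Longrightarrow> \<tau> \<omega> \<in> {0..T}"
    and enl: "\<And>t. {\<omega>\<in>space P. \<tau> \<omega> \<le> t} \<in>
      sets (vimage_algebra (space P) (\<lambda>\<omega>. (Z0 \<omega>, \<omega>)) (borel \<Otimes>\<^sub>M natural_filtration P B t))"
  shows "(INF \<tau>'\<in>stopping_times P B T. exp_cost P \<sigma> X T \<tau>') \<le> exp_cost P \<sigma> X T \<tau>"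
    (is "?I \<le> _")
proof (rule LIMSEQ_le_const[OF exp_cost_mesh_time_tendsto[OF \<tau> range]])
  let ?F = "natural_filtration P B"
  have "?I \<le> exp_cost P \<sigma> X T (mesh_time n \<tau>)" for n
  proof -
    let ?N = "2 ^ n :: nat"
    have "\<forall>i. \<exists>D. D \<in> sets (borel \<Otimes>\<^sub>M ?F (tick T n i)) \<and>
        {\<omega>\<in>space P. \<tau> \<omega> \<le> tick T n i} = {\<omega>\<in>space P. (Z0 \<omega>, \<omega>) \<in> D}"
    proof
      fix i
      have "(\<lambda>\<omega>. (Z0 \<omega>, \<omega>)) \<in> space P \<rightarrow> space (borel \<Otimes>\<^sub>M ?F (tick T n i))"
        by (auto simp: space_pair_measure)
      from enl[of "tick T n i", unfolded sets_vimage_algebra2[OF this]] show "\<exists>D. D \<in> sets (borel \<Otimes>\<^sub>M ?F (tick T n i)) \<and>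
        {\<omega>\<in>space P. \<tau> \<omega> \<le> tick T n i} = {\<omega>\<in>space P. (Z0 \<omega>, \<omega>) \<in> D}" by blast
    qed
    from choice[OF this] obtain D where D: "\<And>i. D i \<in> sets (borel \<Otimes>\<^sub>M ?F (tick T n i))"
      and D_eq: "\<And>i. {\<omega>\<in>space P. \<tau> \<omega> \<le> tick T n i} = {\<omega>\<in>space P. (Z0 \<omega>, \<omega>) \<in> D i}" by blast
    \<comment> \<open>The sets \<open>D i\<close> are chosen one by one, and off the graph of
      \<open>Z0\<close> nothing makes them increase in \<open>i\<close>. The least admissible index,
      capped by \<open>?N\<close>, nevertheless defines a stopping time for every frozen value, and
      on the graph it is the index of the rounded time.\<close>
    define k where "k p = (LEAST i. i = ?N \<or> (i < ?N \<and> p \<in> D i))" for p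
    have k_le: "k p \<le> ?N" for p unfolding k_def by (intro Least_le) simp
    have k_cases: "k p = ?N \<or> (k p < ?N \<and> p \<in> D (k p))" for p
      unfolding k_def by (rule LeastI[where k="?N"]) simp
    have k_min: "k p \<le> i" if "i < ?N" "p \<in> D i" for p i
      unfolding k_def using that by (intro Least_le) simp
    have k_Z0: "k (Z0 \<omega>, \<omega>) = next_tick T n (\<tau> \<omega>)" if \<omega>: "\<omega> \<in> space P" for \<omega>
    proof -
      have in_D: "(Z0 \<omega>, \<omega>) \<in> D i \<longleftrightarrow> next_tick T n (\<tau> \<omega>) \<le> i" for i
        unfolding next_tick(4)[OF T_pos range[OF \<omega>]] using D_eq[of i] \<omega> by blast
      show ?thesis
        unfolding k_def in_D using next_tick(1)[OF T_pos range[OF \<omega>], of n]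
        by (intro Least_equality) auto
    qed
    define \<rho> where "\<rho> z \<omega> = tick T n (k (z, \<omega>))" for z \<omega>
    have \<rho>_range: "\<rho> z \<omega> \<in> {0..T}" for z \<omega>
      unfolding \<rho>_def by (rule tick_mem[OF T_pos k_le])
    have \<rho>: "\<rho> z \<in> stopping_times P B T" for z
    proof (rule stopping_timesI[OF \<rho>_range])
      fix t assume t: "t < T"
      \<comment> \<open>The default index \<open>?N\<close> belongs to the time \<open>T > t\<close>
        and cannot occur here, so the event is a finite union of sections of sets \<open>D i\<close>
        with ticks up to \<open>t\<close>.\<close>
      let ?K = "{i. i < ?N \<and> tick T n i \<le> t}"
      have "{\<omega>\<in>space P. \<rho> z \<omega> \<le> t} = {\<omega>\<in>space P. \<exists>i\<in>?K. (z, \<omega>) \<in> D i}"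
      proof (intro Collect_cong conj_cong refl iffI)
        fix \<omega> assume *: "\<rho> z \<omega> \<le> t"
        then have "k (z, \<omega>) \<noteq> ?N" using t by (auto simp: \<rho>_def)
        then show "\<exists>i\<in>?K. (z, \<omega>) \<in> D i" using k_cases[of "(z, \<omega>)"] * by (auto simp: \<rho>_def)
      next
        fix \<omega> assume "\<exists>i\<in>?K. (z, \<omega>) \<in> D i"
        then obtain i where i: "i < ?N" "tick T n i \<le> t" "(z, \<omega>) \<in> D i" by blast
        then have "tick T n (k (z, \<omega>)) \<le> tick T n i" using k_min by (simp add: tick_le_iff T_pos)
        then show "\<rho> z \<omega> \<le> t" using i by (simp add: \<rho>_def)
      qed
      also have "\<dots> = (\<Union>i\<in>?K. Pair z -` D i)"
        using sets.sets_into_space[OF D] by (auto simp: space_pair_measure)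
      also have "\<dots> \<in> sets (?F t)"
      proof (rule sets.finite_UN)
        fix i assume "i \<in> ?K"
        then show "Pair z -` D i \<in> sets (?F t)"
          using sets_Pair1[OF D, of z] sets_natural_filtration_mono[of "tick T n i" t P B] by auto
      qed simp
      finally show "{\<omega>\<in>space P. \<rho> z \<omega> \<le> t} \<in> sets (?F t)" .
    qed
    let ?M = "borel \<Otimes>\<^sub>M ?F T :: (real \<times> 'a) measure"
    have D_T [measurable]: "D i \<in> sets ?M" if "i < ?N" for i
    proof -
      have "tick T n i \<le> T" using that by (intro tick_le T_pos) simp
      then have sub: "sets (?F (tick T n i)) \<subseteq> sets (?F T)" by (rule sets_natural_filtration_mono)
      have "(\<lambda>\<omega>. \<omega>) \<in> measurable (?F T) (?F (tick T n i))"
        using sub by (intro measurableI) (auto dest: sets.sets_into_space simp: Int_absorb2)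
      then have "(\<lambda>p. (fst p, snd p)) \<in> measurable ?M (borel \<Otimes>\<^sub>M ?F (tick T n i))"
        by (intro measurable_Pair measurable_fst measurable_compose[OF measurable_snd])
      from measurable_sets[OF this D] show ?thesis
        using sets.sets_into_space[OF D[of i]] by (simp add: space_pair_measure Int_absorb2)
    qed
    have k_meas: "k \<in> measurable ?M (count_space UNIV)"
      unfolding k_def
    proof (rule measurable_Least)
      fix i
      show "(\<lambda>p. i = ?N \<or> (i < ?N \<and> p \<in> D i)) \<in> measurable ?M (count_space UNIV)"
        by (cases "i < ?N") simp_all
    qed
    let ?h = "\<lambda>p. ennreal (exp (\<sigma> * (S (snd p) - X (tick T n (k p)) (snd p))))"
    have X_snd: "(\<lambda>p. X s (snd p)) \<in> borel_measurable ?M" if "s \<in> {0..T}" for s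
      by (intro measurable_compose[OF measurable_snd] measurable_X_sub measurable_natural_filtration that)
    have [measurable]: "(\<lambda>p. X (tick T n (k p)) (snd p)) \<in> borel_measurable ?M"
      by (rule measurable_at_tick[where X="\<lambda>s p. X s (snd p)", OF T_pos X_snd k_meas k_le])
    have [measurable]: "(\<lambda>p. S (snd p)) \<in> borel_measurable ?M"
      by (rule measurable_compose[OF measurable_snd measurable_S_natural_filtration])
    have h: "?h \<in> borel_measurable ?M" by measurable
    have cost_\<rho>: "(\<integral>\<^sup>+\<omega>'. ?h (z, \<omega>') \<partial>P) = ennreal (exp_cost P \<sigma> X T (\<rho> z))" for z
      using nn_integral_cost[of "\<rho> z", OF stopping_times_measurable[OF \<rho> measurable_B] \<rho>_range]
      by (simp add: \<rho>_def)
    have "ennreal ?I = (\<integral>\<^sup>+\<omega>. ennreal ?I \<partial>P)" by (simp add: emeasure_space_1)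
    also have "\<dots> \<le> (\<integral>\<^sup>+\<omega>. ennreal (exp_cost P \<sigma> X T (\<rho> (Z0 \<omega>))) \<partial>P)"
      by (intro nn_integral_mono ennreal_leI cINF_lower bdd_below_exp_cost \<rho>)
    also have "\<dots> = (\<integral>\<^sup>+\<omega>. (\<integral>\<^sup>+\<omega>'. ?h (Z0 \<omega>, \<omega>') \<partial>P) \<partial>P)"
      by (simp only: cost_\<rho>)
    also have "\<dots> = (\<integral>\<^sup>+\<omega>. ?h (Z0 \<omega>, \<omega>) \<partial>P)"
      by (rule nn_integral_indep_set[OF ind _ _ _ _ h, symmetric]) (auto intro: measurable_vimage_algebra1)
    also have "\<dots> = (\<integral>\<^sup>+\<omega>. ennreal (exp (\<sigma> * (S \<omega> - X (mesh_time n \<tau> \<omega>) \<omega>))) \<partial>P)"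
      by (intro nn_integral_cong) (simp add: k_Z0 mesh_time_def)
    also have "\<dots> = ennreal (exp_cost P \<sigma> X T (mesh_time n \<tau>))"
      by (rule nn_integral_cost) (intro measurable_mesh_time \<tau> mesh_time_mem range)+
    finally show ?thesis using exp_cost_nonneg by simp
  qed
  then show "\<exists>N. \<forall>n\<ge>N. ?I \<le> exp_cost P \<sigma> X T (mesh_time n \<tau>)" by blast
qed

end

section \<open>Stopping times of the geometric Brownian motion\<close>

locale predicted_gbm = drifted_bm P B T \<sigma> l for P :: "'a measure" and B T \<sigma> l +
  fixes Z0 :: "'a \<Rightarrow> real" and Z :: "real \<Rightarrow> 'a \<Rightarrow> real"
  assumes Z0_measurable [measurable]: "Z0 \<in> borel_measurable P"
    and Z0_pos: "\<And>\<omega>. \<omega> \<in> space P \<Longrightarrow> Z0 \<omega> > 0"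
    and Z0_indep: "indep_set (sets (vimage_algebra (space P) Z0 borel)) (sets (natural_filtration P B T))"
    and Z_eq: "\<And>t \<omega>. Z t \<omega> = Z0 \<omega> * exp (\<sigma> * X t \<omega>)"
begin

lemma Z_0: "\<omega> \<in> space P \<Longrightarrow> Z 0 \<omega> = Z0 \<omega>"
  by (simp add: Z_eq X_0)

lemma measurable_Z: "s \<in> {0..T} \<Longrightarrow> Z s \<in> borel_measurable P"
proof -
  assume "s \<in> {0..T}"
  then have [measurable]: "X s \<in> borel_measurable P" by (rule measurable_X)
  show ?thesis unfolding Z_eq[abs_def] by measurable
qed

lemma ratio_cost_eq_exp_cost:
  assumes "\<And>\<omega>. \<omega> \<in> space P \<Longrightarrow> \<tau> \<omega> \<in> {0..T}"
  shows "ratio_cost P Z T \<tau> = exp_cost P \<sigma> X T \<tau>"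
  unfolding ratio_cost_def exp_cost_def
proof (rule Bochner_Integration.integral_cong[OF refl])
  fix \<omega> assume \<omega>: "\<omega> \<in> space P"
  obtain s where s: "s \<in> {0..T}" "S \<omega> = X s \<omega>"
    using running_max_attained[of T X \<omega>] continuous_X[OF \<omega>] T_pos by auto
  have "running_max Z T \<omega> = Z s \<omega>"
    unfolding running_max_def
  proof (rule cSup_eq_maximum)
    show "Z s \<omega> \<in> (\<lambda>s. Z s \<omega>) ` {0..T}" using s by blast
    fix z assume "z \<in> (\<lambda>s. Z s \<omega>) ` {0..T}"
    then obtain r where "r \<in> {0..T}" "z = Z r \<omega>" by blast
    then show "z \<le> Z s \<omega>"
      using X_le_S[OF \<omega>, of r] s Z0_pos[OF \<omega>] \<sigma>_pos by (simp add: Z_eq)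
  qed
  then show "running_max Z T \<omega> / Z (\<tau> \<omega>) \<omega> = exp (\<sigma> * (S \<omega> - X (\<tau> \<omega>) \<omega>))"
    using Z0_pos[OF \<omega>] s by (simp add: Z_eq exp_diff right_diff_distrib)
qed

text \<open>The Brownian path is recovered by
  \<open>B s = ln (Z s / Z 0) / \<sigma> - l * s\<close>, so observing \<open>Z\<close> reveals at
  least as much as observing \<open>B\<close>. The converse inclusion fails in general, because
  \<open>Z\<close> also reveals its random initial value.\<close>

lemma stopping_times_B_subset_Z: "stopping_times P B T \<subseteq> stopping_times P Z T"
proof
  fix \<tau> assume \<tau>: "\<tau> \<in> stopping_times P B T"
  show "\<tau> \<in> stopping_times P Z T"
  proof (rule stopping_timesI[OF stopping_times_range[OF \<tau>]])
    fix t assume t: "0 \<le> t" "t < T"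
    let ?F = "natural_filtration P Z t"
    have "B s \<in> borel_measurable ?F" if "s \<in> {0..t}" for s
    proof -
      have [measurable]: "Z s \<in> borel_measurable ?F" "Z 0 \<in> borel_measurable ?F"
        using that t by (auto intro!: measurable_natural_filtration)
      have "(\<lambda>\<omega>. ln (Z s \<omega> / Z 0 \<omega>) / \<sigma> - l * s) \<in> borel_measurable ?F" by measurable
      then show ?thesis
      proof (rule measurable_cong[THEN iffD1, rotated])
        fix \<omega> assume "\<omega> \<in> space ?F"
        then have \<omega>: "\<omega> \<in> space P" by simp
        then have "Z s \<omega> / Z 0 \<omega> = exp (\<sigma> * X s \<omega>)"
          using Z0_pos[OF \<omega>] unfolding Z_0[OF \<omega>] by (simp add: Z_eq)
        then show "ln (Z s \<omega> / Z 0 \<omega>) / \<sigma> - l * s = B s \<omega>"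
          using \<sigma>_pos by (simp add: with_drift_def)
      qed
    qed
    then have "sets (natural_filtration P B t) \<subseteq> sets ?F"
      by (intro sets_natural_filtration_subset) auto
    then show "{\<omega>\<in>space P. \<tau> \<omega> \<le> t} \<in> sets ?F" using stopping_times_sets[OF \<tau>] by blast
  qed
qed

text \<open>Up to time \<open>t\<close> the process \<open>Z\<close> is a function of
  \<open>Z0\<close> and of the Brownian path, so its stopping times fall under the freezing argument
  although they need not be stopping times of \<open>B\<close>.\<close>

lemma exp_cost_ge_INF_stopping_times_Z:
  assumes \<tau>: "\<tau> \<in> stopping_times P Z T"
  shows "(INF \<tau>'\<in>stopping_times P B T. exp_cost P \<sigma> X T \<tau>') \<le> exp_cost P \<sigma> X T \<tau>"
proof (rule exp_cost_ge_INF_enlarged[OF Z0_measurable Z0_indep])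
  show "\<tau> \<in> borel_measurable P" by (rule stopping_times_measurable[OF \<tau> measurable_Z])
  show "\<tau> \<omega> \<in> {0..T}" if "\<omega> \<in> space P" for \<omega> using stopping_times_range[OF \<tau> that] .
  fix t
  let ?N = "borel \<Otimes>\<^sub>M natural_filtration P B t :: (real \<times> 'a) measure"
  let ?M = "vimage_algebra (space P) (\<lambda>\<omega>. (Z0 \<omega>, \<omega>)) ?N"
  have pair: "(\<lambda>\<omega>. (Z0 \<omega>, \<omega>)) \<in> measurable ?M ?N"
    by (rule measurable_vimage_algebra1) (auto simp: space_pair_measure)
  have "Z s \<in> borel_measurable ?M" if "s \<in> {0..t}" for s
  proof -
    have [measurable]: "(\<lambda>p. X s (snd p)) \<in> borel_measurable ?N"
      by (intro measurable_compose[OF measurable_snd] measurable_X_sub measurable_natural_filtration that)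
    have "(\<lambda>p. fst p * exp (\<sigma> * X s (snd p))) \<in> borel_measurable ?N" by measurable
    from measurable_compose[OF pair this] show ?thesis by (simp add: Z_eq[abs_def])
  qed
  then have "sets (natural_filtration P Z t) \<subseteq> sets ?M"
    by (intro sets_natural_filtration_subset) auto
  then show "{\<omega>\<in>space P. \<tau> \<omega> \<le> t} \<in> sets ?M" using stopping_times_sets[OF \<tau>] by blast
qed

lemma INF_stopping_times_Z_eq_B:
  "(INF \<tau>\<in>stopping_times P Z T. exp_cost P \<sigma> X T \<tau>) = (INF \<tau>\<in>stopping_times P B T. exp_cost P \<sigma> X T \<tau>)"
proof (rule antisym)
  have ne: "stopping_times P B T \<noteq> {}" using const_stopping_times[of 0 T] T_pos by force
  show "(INF \<tau>\<in>stopping_times P Z T. exp_cost P \<sigma> X T \<tau>) \<le> (INF \<tau>\<in>stopping_times P B T. exp_cost P \<sigma> X T \<tau>)"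
    by (intro cINF_superset_mono ne bdd_below_exp_cost stopping_times_B_subset_Z order_refl)
  show "(INF \<tau>\<in>stopping_times P B T. exp_cost P \<sigma> X T \<tau>) \<le> (INF \<tau>\<in>stopping_times P Z T. exp_cost P \<sigma> X T \<tau>)"
    using ne stopping_times_B_subset_Z by (intro cINF_greatest exp_cost_ge_INF_stopping_times_Z) auto
qed

end

context drifted_bm
begin

subsection \<open>Failure of optimality of the extreme times\<close>

text \<open>The Gaussian density is positive everywhere, so a null event would make the interval
  \<open>{c - 1..c}\<close> Lebesgue null.\<close>

lemma emeasure_B_atMost_pos:
  assumes "0 < t" "t \<le> T"
  shows "emeasure P {\<omega>\<in>space P. B t \<omega> \<le> c} > 0"
proof (rule ccontr)
  have [measurable]: "B t \<in> borel_measurable P" using assms by (intro measurable_B) auto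
  assume "\<not> emeasure P {\<omega>\<in>space P. B t \<omega> \<le> c} > 0"
  then have "0 = emeasure P {\<omega>\<in>space P. B t \<omega> \<le> c}" by simp
  also have "\<dots> = (\<integral>\<^sup>+\<omega>. indicator {\<omega>\<in>space P. B t \<omega> \<le> c} \<omega> \<partial>P)" by simp
  also have "\<dots> = (\<integral>\<^sup>+\<omega>. indicator {..c} (B t \<omega> - B 0 \<omega>) \<partial>P)"
    using B_start by (intro nn_integral_cong) (simp split: split_indicator)
  also have "\<dots> = (\<integral>\<^sup>+x. ennreal (normal_density 0 (sqrt t) x) * indicator {..c} x \<partial>lborel)"
    using assms nn_integral_increment[of 0 t "indicator {..c}"] by simp
  finally have "AE x in lborel. ennreal (normal_density 0 (sqrt t) x) * indicator {..c} x = 0"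
    by (subst nn_integral_0_iff_AE[symmetric]) auto
  then have "AE x in lborel. x \<notin> {c - 1..c}"
  proof eventually_elim
    case (elim x)
    then show ?case using normal_density_pos[of "sqrt t" 0 x] assms by (auto simp: not_less split: split_indicator_asm)
  qed
  then have "emeasure lborel {c - 1..c} = 0" by (subst (asm) AE_iff_measurable[of "{c - 1..c}"]) auto
  then show False by simp
qed

text \<open>On the event \<open>A\<close>, where \<open>X u \<le> - y\<close> at
  \<open>u = T / 2\<close>, stopping at \<open>u\<close> costs at most the drawdown term
  \<open>q\<close> plus \<open>prob A * C\<close>, with \<open>C\<close> the mean exponential of the
  rise after \<open>u\<close>; waiting until \<open>T\<close> costs at least \<open>K * q\<close>
  with \<open>K > 1\<close>. Since \<open>q \<ge> prob A * exp (\<sigma> * y)\<close>, a deep enough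
  level \<open>y\<close> makes the surplus \<open>(K - 1) * q\<close> outweigh
  \<open>prob A * C\<close>.\<close>

proposition terminal_time_not_optimal:
  assumes l: "l < \<sigma> / 2"
  shows "\<exists>\<tau>\<in>stopping_times P B T. exp_cost P \<sigma> X T \<tau> < exp_cost P \<sigma> X T (\<lambda>_. T)"
proof -
  define u where "u = T / 2"
  have u: "0 < u" "u < T" "u \<in> {0..T}" "T - u = u" using T_pos by (auto simp: u_def)
  \<comment> \<open>Clamping the time at \<open>u\<close> keeps both processes indexed by
    \<open>[0,T]\<close>, so that the lemmas on the maximum over \<open>[0,T]\<close> serve the past
    and the future alike.\<close>
  define past where "past s = X (min s u)" for s
  define future where "future s \<omega> = X (max u s) \<omega> - X u \<omega>" for s \<omega>
  have clamp: "min s u \<in> {0..T}" "max u s \<in> {0..T}" if "s \<in> {0..T}" for s using that u by auto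
  have past_c: "continuous_on {0..T} (\<lambda>s. past s \<omega>)" if "\<omega> \<in> space P" for \<omega>
    unfolding past_def
    by (rule continuous_on_compose2[OF continuous_X[OF that]]) (use u in \<open>auto intro!: continuous_intros\<close>)
  have future_c: "continuous_on {0..T} (\<lambda>s. future s \<omega>)" if "\<omega> \<in> space P" for \<omega>
    unfolding future_def
    by (intro continuous_on_diff continuous_on_const continuous_on_compose2[OF continuous_X[OF that]])
      (use u in \<open>auto intro!: continuous_intros\<close>)
  define Y where "Y \<omega> = running_max past T \<omega> - X u \<omega>" for \<omega>
  define S' where "S' = running_max future T"
  have attain: "\<exists>s\<in>{0..T}. running_max V T \<omega> = V s \<omega>" if "continuous_on {0..T} (\<lambda>s. V s \<omega>)" for V and \<omega> :: 'a
    using running_max_attained[of T V \<omega>] that T_pos by (metis less_imp_le)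
  have Y_dom: "exp (\<sigma> * Y \<omega>) \<le> dominator \<omega>" if \<omega>: "\<omega> \<in> space P" for \<omega>
    using attain[of past, OF past_c[OF \<omega>]] exp_increment_le_dominator[OF \<omega> clamp(1) u(3)] by (auto simp: Y_def past_def)
  have S'_dom: "exp (\<sigma> * S' \<omega>) \<le> dominator \<omega>" if \<omega>: "\<omega> \<in> space P" for \<omega>
    using attain[of future, OF future_c[OF \<omega>]] exp_increment_le_dominator[OF \<omega> clamp(2) u(3)] by (auto simp: S'_def future_def)
  have Y_lower: "- X u \<omega> \<le> Y \<omega>" if \<omega>: "\<omega> \<in> space P" for \<omega>
    using running_max_upper[where X=past and s=0, OF past_c[OF \<omega>]] T_pos u X_0[OF \<omega>]
    by (simp add: Y_def past_def)
  have Y_le: "Y \<omega> \<le> S \<omega> - X u \<omega>" if \<omega>: "\<omega> \<in> space P" for \<omega>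
    using attain[of past, OF past_c[OF \<omega>]] X_le_S[OF \<omega> clamp(1)] by (auto simp: Y_def past_def)
  have S_le: "exp (\<sigma> * (S \<omega> - X u \<omega>)) \<le> exp (\<sigma> * Y \<omega>) + exp (\<sigma> * S' \<omega>)" if \<omega>: "\<omega> \<in> space P" for \<omega>
  proof -
    obtain s where s: "s \<in> {0..T}" "S \<omega> = X s \<omega>" using attain[of X, OF continuous_X[OF \<omega>]] by blast
    show ?thesis
    proof (cases "s \<le> u")
      case True
      then have "X s \<omega> = past s \<omega>" by (simp add: past_def)
      then have "S \<omega> - X u \<omega> \<le> Y \<omega>"
        using running_max_upper[where X=past, OF past_c[OF \<omega>] s(1)] s(2) by (simp add: Y_def)
      then have "exp (\<sigma> * (S \<omega> - X u \<omega>)) \<le> exp (\<sigma> * Y \<omega>)" using \<sigma>_pos by simp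
      then show ?thesis using exp_ge_zero[of "\<sigma> * S' \<omega>"] by linarith
    next
      case False
      then have "X s \<omega> - X u \<omega> = future s \<omega>" by (simp add: future_def max_def)
      then have "S \<omega> - X u \<omega> \<le> S' \<omega>"
        using running_max_upper[where X=future, OF future_c[OF \<omega>] s(1)] s(2) by (simp add: S'_def)
      then have "exp (\<sigma> * (S \<omega> - X u \<omega>)) \<le> exp (\<sigma> * S' \<omega>)" using \<sigma>_pos by simp
      then show ?thesis using exp_ge_zero[of "\<sigma> * Y \<omega>"] by linarith
    qed
  qed
  let ?Fu = "natural_filtration P B u"
  have X_Fu: "X s \<in> borel_measurable ?Fu" if "s \<in> {0..u}" for s
    by (intro measurable_X_sub measurable_natural_filtration that)
  have "running_max past T \<in> borel_measurable ?Fu"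
    unfolding past_def using u by (intro measurable_running_max X_Fu past_c[unfolded past_def]) auto
  then have Y_Fu [measurable]: "Y \<in> borel_measurable ?Fu"
    unfolding Y_def[abs_def] using u by (intro borel_measurable_diff X_Fu) auto
  have sub: "subalgebra P ?Fu"
    using u by (simp add: subalgebra_def) (intro sets_natural_filtration_subset measurable_B, auto)
  have [measurable]: "Y \<in> borel_measurable P" by (rule measurable_from_subalg[OF sub Y_Fu])
  have Bu: "(\<lambda>\<omega>. B u \<omega> - B 0 \<omega>) \<in> borel_measurable (vimage_algebra (space P) (\<lambda>\<omega>. B u \<omega> - B 0 \<omega>) borel)"
    by (rule measurable_vimage_algebra1) simp
  \<comment> \<open>The rise after \<open>u\<close> does not feel the increment over
    \<open>[0,u]\<close>, so it is independent of \<open>B u\<close>, and with it of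
    \<open>A\<close>.\<close>
  have S'_skip: "S' \<in> borel_measurable (skip_algebra 0 u)"
    unfolding S'_def
  proof (rule measurable_running_max[OF T_pos])
    fix s assume s: "s \<in> {0..T}"
    have "(\<lambda>\<omega>. skip 0 u (max u s) \<omega> + l * (max u s - u)) \<in> borel_measurable (skip_algebra 0 u)"
      using s u by (intro borel_measurable_add borel_measurable_const measurable_skip_skip_algebra) auto
    then show "future s \<in> borel_measurable (skip_algebra 0 u)"
      by (rule measurable_cong[THEN iffD1, rotated])
        (simp add: skip_def future_def with_drift_def B_start algebra_simps)
  qed (simp add: future_c)
  have [measurable]: "S' \<in> borel_measurable P"
    using u by (intro measurable_from_subalg[OF subalgebra_skip_algebra S'_skip]) auto
  \<comment> \<open>The factor by which postponing from \<open>u\<close> to \<open>T\<close>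
    inflates the drawdown term: \<open>exp (\<sigma>\<^sup>2 * u / 2)\<close> from the Gaussian
    increment and \<open>exp (- \<sigma> * l * u)\<close> from the drift, with
    \<open>T - u = u\<close>.\<close>
  define K where "K = exp ((\<sigma>\<^sup>2 / 2 - \<sigma> * l) * u)"
  have "\<sigma> * l < \<sigma> * (\<sigma> / 2)" using l \<sigma>_pos by (intro mult_strict_left_mono)
  then have K: "K > 1" using u by (simp add: K_def power2_eq_square)
  have int_dom: "integrable P g" if "g \<in> borel_measurable P" "\<And>\<omega>. \<omega> \<in> space P \<Longrightarrow> \<bar>g \<omega>\<bar> \<le> dominator \<omega>" for g :: "'a \<Rightarrow> real"
    using that by (intro Bochner_Integration.integrable_bound[OF integrable_dominator] AE_I2)
      (fastforce intro: order_trans[OF _ abs_ge_self])+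
  have int_S': "integrable P (\<lambda>\<omega>. exp (\<sigma> * S' \<omega>))" using S'_dom by (intro int_dom) auto
  define C where "C = (\<integral>\<omega>. exp (\<sigma> * S' \<omega>) \<partial>P)"
  have C: "C \<ge> 0" by (simp add: C_def)
  \<comment> \<open>Puts \<open>exp (\<sigma> * y)\<close> one above the break-even value
    \<open>C / (K - 1)\<close>.\<close>
  define y where "y = ln (C / (K - 1) + 1) / \<sigma>"
  have "exp (\<sigma> * y) = C / (K - 1) + 1" using C K \<sigma>_pos by (simp add: y_def add_nonneg_pos)
  then have y: "C < (K - 1) * exp (\<sigma> * y)" using K by (simp add: field_simps)
  define A where "A = {\<omega>\<in>space P. X u \<omega> \<le> - y}"
  have A_Fu: "A \<in> sets ?Fu"
  proof -
    have [measurable]: "X u \<in> borel_measurable ?Fu" using u by (intro X_Fu) auto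
    have "{\<omega>\<in>space ?Fu. X u \<omega> \<le> - y} \<in> sets ?Fu" by measurable
    then show ?thesis by (simp add: A_def)
  qed
  then have [measurable]: "A \<in> events" using sub by (auto simp: subalgebra_def)
  define \<tau> where "\<tau> \<omega> = (if X u \<omega> \<le> - y then u else T)" for \<omega>
  have \<tau>: "\<tau> \<in> stopping_times P B T"
  proof (rule stopping_timesI)
    show "\<tau> \<omega> \<in> {0..T}" for \<omega> using u by (simp add: \<tau>_def)
    fix t assume t: "t < T"
    show "{\<omega>\<in>space P. \<tau> \<omega> \<le> t} \<in> sets (natural_filtration P B t)"
    proof (cases "u \<le> t")
      case True
      then have "{\<omega>\<in>space P. \<tau> \<omega> \<le> t} = A" using t by (auto simp: \<tau>_def A_def)
      then show ?thesis using A_Fu sets_natural_filtration_mono[OF True] by blast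
    next
      case False
      then have "{\<omega>\<in>space P. \<tau> \<omega> \<le> t} = {}" using t u by (auto simp: \<tau>_def)
      then show ?thesis by (metis sets.empty_sets)
    qed
  qed
  have [measurable]: "X u \<in> borel_measurable P" "X T \<in> borel_measurable P"
    using u T_pos by (auto intro: measurable_X)
  define q where "q = (\<integral>\<omega>. indicator A \<omega> * exp (\<sigma> * Y \<omega>) \<partial>P)"
  have int_A: "integrable P (\<lambda>\<omega>. indicator A \<omega> * g \<omega>)" if "integrable P g" for g :: "'a \<Rightarrow> real"
    using that by (simp add: integrable_real_mult_indicator mult.commute)
  have int_Y: "integrable P (\<lambda>\<omega>. exp (\<sigma> * Y \<omega>))" using Y_dom by (intro int_dom) auto
  have int_u: "integrable P (\<lambda>\<omega>. exp (\<sigma> * (S \<omega> - X u \<omega>)))"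
    using exp_S_le_dominator[OF _ u(3)] by (intro int_dom) auto
  have T_mem: "T \<in> {0..T}" using T_pos by simp
  have int_T: "integrable P (\<lambda>\<omega>. exp (\<sigma> * (S \<omega> - X T \<omega>)))"
    using exp_S_le_dominator[OF _ T_mem] by (intro int_dom) auto
  have AC: "(\<integral>\<omega>. indicator A \<omega> * exp (\<sigma> * S' \<omega>) \<partial>P) = prob A * C"
  proof -
    let ?F = "\<lambda>p. ennreal (exp (\<sigma> * fst p)) * indicator {.. - y} (snd p + l * u)"
    have ind_A: "indicator {.. - y} (B u \<omega> - B 0 \<omega> + l * u) = (indicator A \<omega> :: ennreal)" if "\<omega> \<in> space P" for \<omega>
      using that by (simp add: A_def with_drift_def B_start split: split_indicator)
    have "ennreal (\<integral>\<omega>. indicator A \<omega> * exp (\<sigma> * S' \<omega>) \<partial>P) = (\<integral>\<^sup>+\<omega>. ennreal (indicator A \<omega> * exp (\<sigma> * S' \<omega>)) \<partial>P)"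
      by (intro nn_integral_eq_integral[symmetric] int_A int_S') auto
    also have "\<dots> = (\<integral>\<^sup>+\<omega>. ?F (S' \<omega>, B u \<omega> - B 0 \<omega>) \<partial>P)"
    proof (rule nn_integral_cong)
      fix \<omega> assume "\<omega> \<in> space P"
      from ind_A[OF this] show "ennreal (indicator A \<omega> * exp (\<sigma> * S' \<omega>)) = ?F (S' \<omega>, B u \<omega> - B 0 \<omega>)"
        by (simp split: split_indicator)
    qed
    also have "\<dots> = (\<integral>\<^sup>+\<omega>. (\<integral>\<^sup>+\<omega>'. ?F (S' \<omega>, B u \<omega>' - B 0 \<omega>') \<partial>P) \<partial>P)"
      by (rule nn_integral_indep_set[OF indep_skip_algebra[OF order_refl u(1) less_imp_le[OF u(2)]]
            space_skip_algebra space_vimage_algebra S'_skip Bu]) measurable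
    also have "\<dots> = (\<integral>\<^sup>+\<omega>. (\<integral>\<^sup>+\<omega>'. ennreal (exp (\<sigma> * S' \<omega>)) * indicator A \<omega>' \<partial>P) \<partial>P)"
      by (intro nn_integral_cong) (simp add: ind_A)
    also have "\<dots> = (\<integral>\<^sup>+\<omega>. ennreal (exp (\<sigma> * S' \<omega>)) \<partial>P) * emeasure P A"
      by (simp add: nn_integral_cmult nn_integral_multc)
    also have "(\<integral>\<^sup>+\<omega>. ennreal (exp (\<sigma> * S' \<omega>)) \<partial>P) = ennreal C"
      unfolding C_def by (intro nn_integral_eq_integral int_S') auto
    finally have "ennreal (\<integral>\<omega>. indicator A \<omega> * exp (\<sigma> * S' \<omega>) \<partial>P) = ennreal (prob A * C)"
      using C by (simp add: emeasure_eq_measure ennreal_mult mult.commute)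
    then show ?thesis using C by (subst (asm) ennreal_inj) auto
  qed
  \<comment> \<open>The maximum over \<open>[0,T]\<close> is bounded below by the one over
    \<open>[0,u]\<close>; the rest is the exponential mean of the increment over
    \<open>[u,T]\<close>, weighted by what is known at \<open>u\<close>.\<close>
  have KQ: "K * q \<le> (\<integral>\<omega>. indicator A \<omega> * exp (\<sigma> * (S \<omega> - X T \<omega>)) \<partial>P)"
  proof -
    let ?w = "\<lambda>\<omega>. indicator A \<omega> * ennreal (exp (\<sigma> * Y \<omega> - \<sigma> * l * u))"
    have subF: "sets ?Fu \<subseteq> sets (skip_algebra u T)" by (rule sets_natural_filtration_subset_skip_algebra[OF u(2)])
    have "?w \<in> borel_measurable ?Fu" using A_Fu by measurable
    then have w: "?w \<in> borel_measurable (skip_algebra u T)"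
      by (rule measurable_from_subalg[rotated]) (use subF in \<open>simp add: subalgebra_def\<close>)
    have "ennreal (K * q) = (\<integral>\<^sup>+\<omega>. ennreal (K * (indicator A \<omega> * exp (\<sigma> * Y \<omega>))) \<partial>P)"
      unfolding q_def integral_mult_right_zero[symmetric] using K
      by (intro nn_integral_eq_integral[symmetric] integrable_mult_right int_A int_Y AE_I2) auto
    also have "\<dots> = (\<integral>\<^sup>+\<omega>. ennreal (exp ((- \<sigma>)\<^sup>2 * (T - u) / 2)) * ?w \<omega> \<partial>P)"
    proof (rule nn_integral_cong)
      fix \<omega>
      have "K * exp (\<sigma> * Y \<omega>) = exp ((- \<sigma>)\<^sup>2 * (T - u) / 2) * exp (\<sigma> * Y \<omega> - \<sigma> * l * u)"
        by (simp add: K_def u(4) exp_add[symmetric] algebra_simps)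
      then show "ennreal (K * (indicator A \<omega> * exp (\<sigma> * Y \<omega>))) = ennreal (exp ((- \<sigma>)\<^sup>2 * (T - u) / 2)) * ?w \<omega>"
        by (simp add: ennreal_mult[symmetric] split: split_indicator)
    qed
    also have "\<dots> = (\<integral>\<^sup>+\<omega>. ?w \<omega> * ennreal (exp (- \<sigma> * (B T \<omega> - B u \<omega>))) \<partial>P)"
    proof -
      have "?w \<in> borel_measurable P" by measurable
      then show ?thesis
        using nn_integral_exp_increment[OF less_imp_le[OF u(1)] u(2) order_refl w, of "- \<sigma>"] by (simp add: nn_integral_cmult)
    qed
    also have "\<dots> \<le> (\<integral>\<^sup>+\<omega>. ennreal (indicator A \<omega> * exp (\<sigma> * (S \<omega> - X T \<omega>))) \<partial>P)"
    proof (rule nn_integral_mono)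
      fix \<omega> assume \<omega>: "\<omega> \<in> space P"
      have "\<sigma> * Y \<omega> \<le> \<sigma> * (S \<omega> - X u \<omega>)" using Y_le[OF \<omega>] \<sigma>_pos by simp
      then have "\<sigma> * Y \<omega> - \<sigma> * l * u + - \<sigma> * (B T \<omega> - B u \<omega>) \<le> \<sigma> * (S \<omega> - X T \<omega>)"
        using u(4) by (simp add: with_drift_def algebra_simps u_def)
      then have "exp (\<sigma> * Y \<omega> - \<sigma> * l * u) * exp (- \<sigma> * (B T \<omega> - B u \<omega>)) \<le> exp (\<sigma> * (S \<omega> - X T \<omega>))"
        by (simp only: exp_add[symmetric] exp_le_cancel_iff)
      then show "?w \<omega> * ennreal (exp (- \<sigma> * (B T \<omega> - B u \<omega>))) \<le> ennreal (indicator A \<omega> * exp (\<sigma> * (S \<omega> - X T \<omega>)))"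
        by (simp add: ennreal_mult[symmetric] ennreal_leI split: split_indicator)
    qed
    also have "\<dots> = ennreal (\<integral>\<omega>. indicator A \<omega> * exp (\<sigma> * (S \<omega> - X T \<omega>)) \<partial>P)"
      by (intro nn_integral_eq_integral int_A int_T) auto
    finally show ?thesis by (subst (asm) ennreal_le_iff) auto
  qed
  have pA: "prob A > 0"
  proof -
    have "A = {\<omega>\<in>space P. B u \<omega> \<le> - y - l * u}" by (auto simp: A_def with_drift_def)
    then show ?thesis using emeasure_B_atMost_pos[of u "- y - l * u"] u by (simp add: emeasure_eq_measure)
  qed
  have "prob A * exp (\<sigma> * y) \<le> q"
  proof -
    have "prob A * exp (\<sigma> * y) = (\<integral>\<omega>. indicator A \<omega> * exp (\<sigma> * y) \<partial>P)"
      by (simp add: Int_absorb2 sets.sets_into_space)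
    also have "\<dots> \<le> q" unfolding q_def
    proof (rule integral_mono)
      show "integrable P (\<lambda>\<omega>. indicator A \<omega> * exp (\<sigma> * y))" by (intro int_A) simp
      show "integrable P (\<lambda>\<omega>. indicator A \<omega> * exp (\<sigma> * Y \<omega>))" by (intro int_A int_Y)
      fix \<omega> assume \<omega>: "\<omega> \<in> space P"
      show "indicator A \<omega> * exp (\<sigma> * y) \<le> indicator A \<omega> * exp (\<sigma> * Y \<omega>)"
        using Y_lower[OF \<omega>] \<sigma>_pos by (auto simp: A_def split: split_indicator)
    qed
    finally show ?thesis .
  qed
  then have "(K - 1) * (prob A * exp (\<sigma> * y)) \<le> (K - 1) * q" using K by (intro mult_left_mono) auto
  moreover have "prob A * C < prob A * ((K - 1) * exp (\<sigma> * y))" using pA y by (intro mult_strict_left_mono)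
  ultimately have strict: "q + prob A * C < K * q" by (simp add: algebra_simps)
  have "(\<integral>\<omega>. indicator A \<omega> * exp (\<sigma> * (S \<omega> - X u \<omega>)) \<partial>P)
      \<le> (\<integral>\<omega>. indicator A \<omega> * exp (\<sigma> * Y \<omega>) + indicator A \<omega> * exp (\<sigma> * S' \<omega>) \<partial>P)"
  proof (rule integral_mono)
    show "indicator A \<omega> * exp (\<sigma> * (S \<omega> - X u \<omega>)) \<le> indicator A \<omega> * exp (\<sigma> * Y \<omega>) + indicator A \<omega> * exp (\<sigma> * S' \<omega>)"
      if "\<omega> \<in> space P" for \<omega> using S_le[OF that] by (simp split: split_indicator)
  qed (intro int_A int_u int_Y int_S' Bochner_Integration.integrable_add)+
  also have "\<dots> = q + prob A * C"
    unfolding q_def AC[symmetric] by (intro Bochner_Integration.integral_add int_A int_Y int_S')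
  finally have less: "(\<integral>\<omega>. indicator A \<omega> * exp (\<sigma> * (S \<omega> - X u \<omega>)) \<partial>P)
      < (\<integral>\<omega>. indicator A \<omega> * exp (\<sigma> * (S \<omega> - X T \<omega>)) \<partial>P)"
    using strict KQ by linarith
  have "exp_cost P \<sigma> X T \<tau> = (\<integral>\<omega>. exp (\<sigma> * (S \<omega> - X T \<omega>)) +
      (indicator A \<omega> * exp (\<sigma> * (S \<omega> - X u \<omega>)) - indicator A \<omega> * exp (\<sigma> * (S \<omega> - X T \<omega>))) \<partial>P)"
    unfolding exp_cost_def
    by (rule Bochner_Integration.integral_cong) (auto simp: \<tau>_def A_def split: split_indicator)
  also have "\<dots> = exp_cost P \<sigma> X T (\<lambda>_. T) + ((\<integral>\<omega>. indicator A \<omega> * exp (\<sigma> * (S \<omega> - X u \<omega>)) \<partial>P)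
      - (\<integral>\<omega>. indicator A \<omega> * exp (\<sigma> * (S \<omega> - X T \<omega>)) \<partial>P))"
    unfolding exp_cost_def
    using int_T int_A[OF int_T] int_A[OF int_u] by simp
  finally show ?thesis using less \<tau> by (intro bexI[of _ \<tau>]) auto
qed

end

section \<open>Improvement on the initial time, through almost sure positivity of the
  maximum\<close>

context brownian_motion
begin

text \<open>Chernoff bound: the event forces
  \<open>1 \<le> exp (- c * a) * exp (- c * B t \<omega>)\<close>. The parameter \<open>c\<close>
  stays free so that it can be scaled with time.\<close>

lemma prob_B_le:
  fixes c :: real
  assumes "t \<in> {0..T}" "c \<ge> 0"
  shows "prob {\<omega>\<in>space P. B t \<omega> \<le> - a} \<le> exp (c\<^sup>2 * t / 2 - c * a)"
proof -
  have [measurable]: "B t \<in> borel_measurable P" using assms by (intro measurable_B)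
  let ?A = "{\<omega>\<in>space P. B t \<omega> \<le> - a}"
  have "ennreal (prob ?A) = (\<integral>\<^sup>+\<omega>. indicator ?A \<omega> \<partial>P)"
    by (simp add: emeasure_eq_measure)
  also have "\<dots> \<le> (\<integral>\<^sup>+\<omega>. ennreal (exp (- c * a)) * ennreal (exp ((- c) * B t \<omega>)) \<partial>P)"
  proof (rule nn_integral_mono)
    fix \<omega>
    show "indicator ?A \<omega> \<le> ennreal (exp (- c * a)) * ennreal (exp ((- c) * B t \<omega>))"
    proof (cases "\<omega> \<in> ?A")
      case True
      then have "0 \<le> c * (- a - B t \<omega>)" using assms by (intro mult_nonneg_nonneg) auto
      then have "1 \<le> exp (- c * a) * exp ((- c) * B t \<omega>)"
        unfolding exp_add[symmetric] by (simp add: algebra_simps)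
      then show ?thesis using True by (simp add: ennreal_mult[symmetric] flip: ennreal_1) 
    qed simp
  qed
  also have "\<dots> = ennreal (exp (- c * a)) * ennreal (exp ((- c)\<^sup>2 * t / 2))"
    using nn_integral_exp_B[OF assms(1), of "- c"] by (simp add: nn_integral_cmult)
  also have "\<dots> = ennreal (exp (c\<^sup>2 * t / 2 - c * a))"
    by (simp add: ennreal_mult[symmetric] exp_add[symmetric] exp_diff exp_minus field_simps)
  finally show ?thesis by simp
qed

text \<open>By Brownian scaling the bound is the same for all intervals, which lets the product over
  many scales tend to zero.\<close>

lemma prob_increment_le_std_normal:
  assumes "0 \<le> a" "a < b" "b \<le> T" "y \<le> 2 * sqrt (b - a)"
  shows "prob {\<omega>\<in>space P. B b \<omega> - B a \<omega> \<le> y} \<le> measure (density lborel std_normal_density) {..2}"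
proof -
  have [measurable]: "B b \<in> borel_measurable P" "B a \<in> borel_measurable P" using assms by (auto intro: measurable_B)
  let ?\<xi> = "\<lambda>\<omega>. (B b \<omega> - B a \<omega> - 0) / sqrt (b - a)"
  have s: "sqrt (b - a) > 0" using assms by simp
  have "distributed P lborel ?\<xi> std_normal_density"
    using normal_standard_normal_convert[OF s, of "\<lambda>\<omega>. B b \<omega> - B a \<omega>" 0] normal_increments[OF assms(1-3)] by simp
  then have d: "distr P lborel ?\<xi> = density lborel std_normal_density" by (simp add: distributed_def)
  have "prob {\<omega>\<in>space P. B b \<omega> - B a \<omega> \<le> y} \<le> prob (?\<xi> -` {..2} \<inter> space P)"
  proof (rule finite_measure_mono)
    show "{\<omega>\<in>space P. B b \<omega> - B a \<omega> \<le> y} \<subseteq> ?\<xi> -` {..2} \<inter> space P"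
      using assms(4) s by (auto simp: divide_le_eq)
  qed measurable
  also have "\<dots> = measure (distr P lborel ?\<xi>) {..2}" by (subst measure_distr) auto
  finally show ?thesis unfolding d .
qed

end

lemma std_normal_atMost_less_1: "measure (density lborel std_normal_density) {..c} < 1"
proof -
  let ?N = "density lborel std_normal_density"
  interpret N: prob_space ?N by (rule prob_space_normal_density) simp
  have "\<not> (AE x in lborel. x \<le> c)"
  proof
    assume "AE x in lborel. x \<le> c"
    then have "emeasure lborel {c<..} = 0" by (subst (asm) AE_iff_measurable[of "{c<..}"]) auto
    then have "emeasure lborel {c<..c+1} = 0" using emeasure_mono[of "{c<..c + 1}" "{c<..}" lborel] by (simp add: greaterThanAtMost_def)
    then show False by simp
  qed
  then have "\<not> (AE x in ?N. x \<le> c)"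
    using normal_density_pos[of 1 0] by (subst AE_density) auto
  then have "N.prob {..c} \<noteq> 1"
    using N.prob_eq_1[of "{..c}"] by simp
  then show ?thesis using N.prob_le_1[of "{..c}"] by linarith
qed

context drifted_bm
begin

text \<open>Along the times \<open>s\<^sub>k = \<theta> r^k\<close>, the increments over \<open>[s\<^sub>k\<^sub>+\<^sub>1, s\<^sub>k]\<close> are independent and exceed \<open>sqrt s\<^sub>k\<close>
  with a probability bounded away from 0, while \<open>B\<close> at the left endpoint and the drift are at most half of that
  for small \<open>r\<close> and \<open>\<theta>\<close>.\<close>

lemma prob_S_nonpos_le:
  assumes K: "K \<ge> 2"
  shows "prob {\<omega>\<in>space P. S \<omega> \<le> 0} \<le>
    measure (density lborel std_normal_density) {..2} ^ n + n * exp ((1 - K) / 2)"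
proof (cases "n = 0")
  case True
  then show ?thesis by simp
next
  case n: False
  \<comment> \<open>Chosen so that the Chernoff parameter \<open>K / sqrt (t (Suc i))\<close> makes
    the variance term \<open>(K / sqrt (t (Suc i)))\<^sup>2 * t i\<close> equal to 1.\<close>
  define r where "r = 1 / K\<^sup>2"
  have r: "0 < r" "r \<le> 1 / 4"
  proof -
    have "2 * 2 \<le> K * K" using K by (intro mult_mono) auto
    then show "0 < r" "r \<le> 1 / 4" using K by (auto simp: r_def power2_eq_square field_simps)
  qed
  \<comment> \<open>Small enough for the drift accumulated by any time
    \<open>e \<le> \<theta>\<close> to be at most \<open>sqrt e / 2\<close> in absolute
    value.\<close>
  define \<theta> where "\<theta> = min T (1 / (4 * (l\<^sup>2 + 1)))"
  have \<theta>: "0 < \<theta>" "\<theta> \<le> T" "4 * l\<^sup>2 * \<theta> \<le> 1"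
  proof -
    have "0 < 4 * (l\<^sup>2 + 1)" by (simp add: add_nonneg_pos)
    then show "0 < \<theta>" using T_pos by (simp add: \<theta>_def)
    show "\<theta> \<le> T" by (simp add: \<theta>_def)
    have "4 * l\<^sup>2 * \<theta> \<le> 4 * l\<^sup>2 * (1 / (4 * (l\<^sup>2 + 1)))"
      by (intro mult_left_mono) (auto simp: \<theta>_def)
    also have "\<dots> \<le> 1" using \<open>0 < 4 * (l\<^sup>2 + 1)\<close> by (simp add: divide_le_eq)
    finally show "4 * l\<^sup>2 * \<theta> \<le> 1" .
  qed
  \<comment> \<open>Indexed backwards, because independence of increments is stated for increasing
    times.\<close>
  define t where "t i = \<theta> * r ^ (n - i)" for i
  have t_pos: "0 < t i" for i using \<theta> r by (simp add: t_def)
  have t_le: "t i \<le> \<theta>" for i using \<theta> r power_le_one[of r "n - i"] by (simp add: t_def mult_left_le)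
  have t_mem: "t i \<in> {0..T}" for i using t_pos[of i] t_le[of i] \<theta> by auto
  have t_step: "t i = r * t (Suc i)" if "i < n" for i
    using that by (simp add: t_def Suc_diff_Suc[symmetric] del: Suc_diff_Suc)
  have t_less: "t i < t (Suc i)" if "i < n" for i
    using t_step[OF that] t_pos[of "Suc i"] r by simp
  define \<xi> where "\<xi> i \<omega> = B (t (Suc i)) \<omega> - B (t i) \<omega>" for i \<omega>
  have ind: "indep_vars (\<lambda>_. borel) \<xi> {..<n}"
    unfolding \<xi>_def
  proof (rule indep_increments)
    show "0 \<le> t 0" "t n \<le> T" using t_mem[of 0] t_mem[of n] by auto
  qed (rule less_imp_le[OF t_less])
  let ?q = "measure (density lborel std_normal_density) {..2}"
  define D where "D i = {..sqrt (t (Suc i))}" for i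
  define G where "G i = {\<omega>\<in>space P. B (t i) \<omega> \<le> - (sqrt (t (Suc i)) / 2)}" for i
  have [measurable]: "B (t i) \<in> borel_measurable P" for i using t_mem by (rule measurable_B)
  have [measurable]: "\<xi> i \<in> borel_measurable P" for i unfolding \<xi>_def[abs_def] by measurable
  have [measurable]: "G i \<in> events" for i unfolding G_def by measurable
  \<comment> \<open>A nonpositive maximum keeps \<open>B\<close> at \<open>t (Suc i)\<close> at most
    \<open>sqrt (t (Suc i)) / 2\<close>; an increment above \<open>sqrt (t (Suc i))\<close> then
    forces \<open>B\<close> at \<open>t i\<close> below
    \<open>- (sqrt (t (Suc i)) / 2)\<close>.\<close>
  have incl: "{\<omega>\<in>space P. S \<omega> \<le> 0} \<subseteq> (\<Inter>i\<in>{..<n}. \<xi> i -` D i \<inter> space P) \<union> (\<Union>i<n. G i)"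
  proof
    fix \<omega> assume \<omega>: "\<omega> \<in> {\<omega>\<in>space P. S \<omega> \<le> 0}"
    have "\<omega> \<in> G i" if i: "i < n" and "\<xi> i \<omega> \<notin> D i" for i
    proof -
      let ?e = "t (Suc i)"
      have "X ?e \<omega> \<le> 0" using X_le_S[of \<omega> ?e] \<omega> t_mem[of "Suc i"] by auto
      then have "B ?e \<omega> \<le> \<bar>l\<bar> * ?e"
        using t_pos[of "Suc i"] abs_ge_minus_self[of "l * ?e"] by (simp add: with_drift_def abs_mult)
      also have "\<dots> = (\<bar>l\<bar> * sqrt ?e) * sqrt ?e" using t_pos[of "Suc i"] by simp
      also have "\<dots> \<le> 1 / 2 * sqrt ?e"
      proof (rule mult_right_mono)
        have "l\<^sup>2 * ?e \<le> l\<^sup>2 * \<theta>" using t_le by (intro mult_left_mono) auto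
        then have "(\<bar>l\<bar> * sqrt ?e)\<^sup>2 \<le> (1 / 2)\<^sup>2"
          using \<theta>(3) t_pos[of "Suc i"] by (simp add: power_mult_distrib power_divide)
        then show "\<bar>l\<bar> * sqrt ?e \<le> 1 / 2" by (rule power2_le_imp_le) simp
      qed (use t_pos[of "Suc i"] in simp)
      finally have "B ?e \<omega> \<le> sqrt ?e / 2" by simp
      moreover have "sqrt ?e < B ?e \<omega> - B (t i) \<omega>" using that by (simp add: D_def \<xi>_def)
      ultimately show ?thesis using \<omega> by (simp add: G_def)
    qed
    then show "\<omega> \<in> (\<Inter>i\<in>{..<n}. \<xi> i -` D i \<inter> space P) \<union> (\<Union>i<n. G i)" using \<omega> by blast
  qed
  have ev1: "(\<Inter>i\<in>{..<n}. \<xi> i -` D i \<inter> space P) \<in> events"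
    using n by (intro sets.finite_INT measurable_sets[of _ P borel]) (auto simp: D_def)
  have "prob {\<omega>\<in>space P. S \<omega> \<le> 0} \<le> prob ((\<Inter>i\<in>{..<n}. \<xi> i -` D i \<inter> space P) \<union> (\<Union>i<n. G i))"
    using ev1 by (intro finite_measure_mono incl) auto
  also have "\<dots> \<le> prob (\<Inter>i\<in>{..<n}. \<xi> i -` D i \<inter> space P) + prob (\<Union>i<n. G i)"
    using ev1 by (intro measure_Un_le) auto
  also have "prob (\<Inter>i\<in>{..<n}. \<xi> i -` D i \<inter> space P) = (\<Prod>i\<in>{..<n}. prob (\<xi> i -` D i \<inter> space P))"
    using n by (intro indep_varsD[OF ind]) (auto simp: D_def)
  also have "\<dots> \<le> (\<Prod>i\<in>{..<n}. ?q)"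
  proof (rule prod_mono, rule conjI)
    fix i assume i: "i \<in> {..<n}"
    have "t (Suc i) - t i = (1 - r) * t (Suc i)" using t_step[of i] i by (simp add: algebra_simps)
    then have "t (Suc i) \<le> 4 * (t (Suc i) - t i)" using r t_pos[of "Suc i"] by simp
    then have "sqrt (t (Suc i)) \<le> sqrt (4 * (t (Suc i) - t i))" by (rule real_sqrt_le_mono)
    then have "sqrt (t (Suc i)) \<le> 2 * sqrt (t (Suc i) - t i)" by (simp only: real_sqrt_mult real_sqrt_four)
    from prob_increment_le_std_normal[OF _ _ _ this] show "prob (\<xi> i -` D i \<inter> space P) \<le> ?q"
      using t_less[of i] i t_mem[of i] t_mem[of "Suc i"]
      by (simp add: \<xi>_def D_def vimage_def Int_def conj_commute)
  qed simp
  also have "\<dots> = ?q ^ n" by simp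
  also have "prob (\<Union>i<n. G i) \<le> (\<Sum>i<n. prob (G i))"
    by (intro measure_UNION_le) auto
  also have "\<dots> \<le> (\<Sum>i<n. exp ((1 - K) / 2))"
  proof (rule sum_mono)
    fix i assume "i \<in> {..<n}"
    then have i: "i < n" by simp
    let ?s = "sqrt (t (Suc i))"
    have s: "?s > 0" "?s\<^sup>2 = t (Suc i)" using t_pos[of "Suc i"] by auto
    have "prob (G i) \<le> exp ((K / ?s)\<^sup>2 * t i / 2 - K / ?s * (?s / 2))"
      unfolding G_def using K s by (intro prob_B_le t_mem) auto
    also have "(K / ?s)\<^sup>2 * t i = 1"
      using K t_pos[of "Suc i"] by (simp add: t_step[OF i] power_divide s r_def)
    also have "1 / 2 - K / ?s * (?s / 2) = (1 - K) / 2" using s by (simp add: field_simps)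
    finally show "prob (G i) \<le> exp ((1 - K) / 2)" .
  qed
  finally show ?thesis by simp
qed

text \<open>Two limits in this order: for fixed \<open>n\<close> the parameter \<open>K\<close> goes
  to infinity and removes the error term, then \<open>n\<close> goes to infinity and the power of a
  number below 1 vanishes.\<close>

lemma AE_S_pos: "AE \<omega> in P. S \<omega> > 0"
proof -
  let ?q = "measure (density lborel std_normal_density) {..2}"
  have "prob {\<omega>\<in>space P. S \<omega> \<le> 0} \<le> ?q ^ n" for n
  proof (rule LIMSEQ_le_const)
    have "(\<lambda>k. exp ((1 - real k) / 2)) \<longlonglongrightarrow> 0" by real_asymp
    then have "(\<lambda>k. ?q ^ n + n * exp ((1 - real k) / 2)) \<longlonglongrightarrow> ?q ^ n + real n * 0"
      by (intro tendsto_add tendsto_mult tendsto_const)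
    then show "(\<lambda>k. ?q ^ n + n * exp ((1 - real k) / 2)) \<longlonglongrightarrow> ?q ^ n" by simp
    show "\<exists>N. \<forall>k\<ge>N. prob {\<omega>\<in>space P. S \<omega> \<le> 0} \<le> ?q ^ n + n * exp ((1 - real k) / 2)"
      using prob_S_nonpos_le by (intro exI[of _ 2]) auto
  qed
  moreover have "(\<lambda>n. ?q ^ n) \<longlonglongrightarrow> 0"
    using std_normal_atMost_less_1[of 2] by (intro LIMSEQ_power_zero) simp
  ultimately have "prob {\<omega>\<in>space P. S \<omega> \<le> 0} \<le> 0" by (intro LIMSEQ_le_const) auto
  then have "prob {\<omega>\<in>space P. S \<omega> \<le> 0} = 0" by (simp add: measure_le_0_iff)
  then show ?thesis
    by (subst AE_iff_measurable[of "{\<omega>\<in>space P. S \<omega> \<le> 0}"]) (auto simp: emeasure_eq_measure not_less)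
qed

text \<open>The one-step identity is applied to the first \<open>k\<close> cells in turn. Each cell
  lowers the path after it by \<open>\<sigma>\<close> times its length, and on the mesh these
  amounts add up exactly to \<open>\<sigma> * min s h\<close>.\<close>

lemma mesh_cost_girsanov:
  assumes k: "k \<le> 2 ^ n"
  defines "h \<equiv> tick T n k"
  shows "mesh_cost n (\<lambda>_. h) = ennreal (exp ((\<sigma>\<^sup>2 / 2 - \<sigma> * l) * h)) *
    (\<integral>\<^sup>+\<omega>. ennreal (exp (\<sigma> * (SUP s\<in>mesh T n. X s \<omega> - \<sigma> * min s h))) \<partial>P)"
proof -
  \<comment> \<open>Interpolates between the cost and its fully transformed form: the first
    \<open>i\<close> cells have been traded for a lowered path, while the increment from tick
    \<open>i\<close> to \<open>h\<close> still awaits its turn.\<close>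
  define g where "g i = (\<integral>\<^sup>+\<omega>. ennreal (exp (- \<sigma> * (B h \<omega> - B (tick T n i) \<omega>))) *
      ennreal (exp (\<sigma> * (SUP s\<in>mesh T n. B s \<omega> + (l * s - \<sigma> * min s (tick T n i))))) \<partial>P)" for i
  have step: "g i = ennreal (exp (\<sigma>\<^sup>2 * (T / 2 ^ n) / 2)) * g (Suc i)" if i: "i < k" for i
  proof -
    let ?a = "tick T n i" and ?b = "tick T n (Suc i)"
    have ab: "?a < ?b" "?b \<le> h" "h \<le> T" "?b \<le> T"
      using i k T_pos tick_le[OF T_pos, of k n] tick_le[OF T_pos, of "Suc i" n]
      by (auto simp: tick_less_iff tick_le_iff h_def)
    let ?w = "\<lambda>\<omega>. ennreal (exp (- \<sigma> * (B h \<omega> - B ?b \<omega>)))"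
    have [measurable]: "skip ?a ?b h \<in> borel_measurable (skip_algebra ?a ?b)" "skip ?a ?b ?b \<in> borel_measurable (skip_algebra ?a ?b)"
      using ab by (auto intro!: measurable_skip_skip_algebra)
    \<comment> \<open>Between two times from \<open>?b\<close> on the removed increment cancels, so
      the weight is admissible although it looks past the cell.\<close>
    have "(\<lambda>\<omega>. ennreal (exp (- \<sigma> * (skip ?a ?b h \<omega> - skip ?a ?b ?b \<omega>)))) \<in> borel_measurable (skip_algebra ?a ?b)"
      by measurable
    then have w: "?w \<in> borel_measurable (skip_algebra ?a ?b)" using ab by (simp add: skip_def)
    have "g i = (\<integral>\<^sup>+\<omega>. ?w \<omega> * ennreal (exp (\<sigma> * (SUP s\<in>mesh T n. B s \<omega> + (l * s - \<sigma> * min s ?a)))) *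
        ennreal (exp (- \<sigma> * (B ?b \<omega> - B ?a \<omega>))) \<partial>P)"
      unfolding g_def
    proof (rule nn_integral_cong)
      fix \<omega>
      have "exp (- \<sigma> * (B h \<omega> - B ?a \<omega>)) = exp (- \<sigma> * (B h \<omega> - B ?b \<omega>)) * exp (- \<sigma> * (B ?b \<omega> - B ?a \<omega>))"
        by (simp add: exp_add[symmetric] algebra_simps)
      then show "ennreal (exp (- \<sigma> * (B h \<omega> - B ?a \<omega>))) * ennreal (exp (\<sigma> * (SUP s\<in>mesh T n. B s \<omega> + (l * s - \<sigma> * min s ?a)))) =
        ?w \<omega> * ennreal (exp (\<sigma> * (SUP s\<in>mesh T n. B s \<omega> + (l * s - \<sigma> * min s ?a)))) * ennreal (exp (- \<sigma> * (B ?b \<omega> - B ?a \<omega>)))"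
        by (simp add: ennreal_mult mult_ac)
    qed
    also have "\<dots> = ennreal (exp (\<sigma>\<^sup>2 * (T / 2 ^ n) / 2)) * (\<integral>\<^sup>+\<omega>. ?w \<omega> * ennreal (exp (\<sigma> * (SUP s\<in>mesh T n.
        B s \<omega> - (if ?b \<le> s then \<sigma> * (T / 2 ^ n) else 0) + (l * s - \<sigma> * min s ?a)))) \<partial>P)"
      using i k by (intro mesh_girsanov_step w) simp
    also have "(\<lambda>\<omega>. SUP s\<in>mesh T n. B s \<omega> - (if ?b \<le> s then \<sigma> * (T / 2 ^ n) else 0) + (l * s - \<sigma> * min s ?a)) =
        (\<lambda>\<omega>. SUP s\<in>mesh T n. B s \<omega> + (l * s - \<sigma> * min s ?b))"
    proof (intro ext SUP_cong refl)
      fix \<omega> s assume "s \<in> mesh T n"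
      then have "s \<le> ?a \<or> ?b \<le> s" using mesh_avoids[OF T_pos, of n i] by auto
      then show "B s \<omega> - (if ?b \<le> s then \<sigma> * (T / 2 ^ n) else 0) + (l * s - \<sigma> * min s ?a) = B s \<omega> + (l * s - \<sigma> * min s ?b)"
        using ab(1) by (auto simp: min_def tick_Suc algebra_simps)
    qed
    finally show ?thesis by (simp add: g_def)
  qed
  have g: "g 0 = ennreal (exp (\<sigma>\<^sup>2 * tick T n i / 2)) * g i" if "i \<le> k" for i
    using that
  proof (induction i)
    case (Suc i)
    then have "g 0 = ennreal (exp (\<sigma>\<^sup>2 * tick T n i / 2)) * (ennreal (exp (\<sigma>\<^sup>2 * (T / 2 ^ n) / 2)) * g (Suc i))"
      using step[of i] by simp
    also have "\<dots> = ennreal (exp (\<sigma>\<^sup>2 * tick T n (Suc i) / 2)) * g (Suc i)"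
      by (simp add: mult.assoc[symmetric] ennreal_mult[symmetric] exp_add[symmetric] tick_Suc)
        (simp add: algebra_simps add_divide_distrib)
    finally show ?case .
  qed simp
  have "mesh_cost n (\<lambda>_. h) = (\<integral>\<^sup>+\<omega>. ennreal (exp (- \<sigma> * l * h)) * (ennreal (exp (- \<sigma> * (B h \<omega> - B 0 \<omega>))) *
      ennreal (exp (\<sigma> * (SUP s\<in>mesh T n. B s \<omega> + (l * s - \<sigma> * min s 0))))) \<partial>P)"
    unfolding mesh_cost_def
  proof (rule nn_integral_cong)
    fix \<omega> assume \<omega>: "\<omega> \<in> space P"
    have "(SUP s\<in>mesh T n. B s \<omega> + (l * s - \<sigma> * min s 0)) = mesh_max n \<omega>"
      unfolding mesh_max_eq using mesh_subset[OF T_pos, of n] by (intro SUP_cong refl) (auto simp: min_def)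
    moreover have "exp (\<sigma> * (mesh_max n \<omega> - X h \<omega>)) = exp (- \<sigma> * l * h) * (exp (- \<sigma> * (B h \<omega> - B 0 \<omega>)) * exp (\<sigma> * mesh_max n \<omega>))"
      using B_start[OF \<omega>] by (simp add: with_drift_def exp_add[symmetric] algebra_simps)
    ultimately show "ennreal (exp (\<sigma> * (mesh_max n \<omega> - X h \<omega>))) = ennreal (exp (- \<sigma> * l * h)) * (ennreal (exp (- \<sigma> * (B h \<omega> - B 0 \<omega>))) *
      ennreal (exp (\<sigma> * (SUP s\<in>mesh T n. B s \<omega> + (l * s - \<sigma> * min s 0)))))"
      by (simp add: ennreal_mult)
  qed
  also have "\<dots> = ennreal (exp (- \<sigma> * l * h)) * g 0"
  proof -
    have h: "h \<in> {0..T}" unfolding h_def by (rule tick_mem[OF T_pos k])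
    have [measurable]: "B h \<in> borel_measurable P" "B 0 \<in> borel_measurable P" using h T_pos by (auto intro: measurable_B)
    have "B s \<in> borel_measurable P" if "s \<in> mesh T n" for s
      using that mesh_subset[OF T_pos] by (intro measurable_B) blast
    then have [measurable]: "(\<lambda>\<omega>. SUP s\<in>mesh T n. B s \<omega> + (l * s - \<sigma> * min s 0)) \<in> borel_measurable P"
      by (intro borel_measurable_cSUP countable_finite finite_mesh bdd_above_finite finite_imageI borel_measurable_add
          borel_measurable_const)
    show ?thesis unfolding g_def by (simp add: nn_integral_cmult)
  qed
  also have "\<dots> = ennreal (exp (- \<sigma> * l * h)) * (ennreal (exp (\<sigma>\<^sup>2 * h / 2)) * g k)"
    using g[OF order_refl] by (simp add: h_def)
  also have "g k = (\<integral>\<^sup>+\<omega>. ennreal (exp (\<sigma> * (SUP s\<in>mesh T n. X s \<omega> - \<sigma> * min s h))) \<partial>P)"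
    by (simp add: g_def h_def with_drift_def algebra_simps)
  also have "ennreal (exp (- \<sigma> * l * h)) * (ennreal (exp (\<sigma>\<^sup>2 * h / 2)) * R) = ennreal (exp ((\<sigma>\<^sup>2 / 2 - \<sigma> * l) * h)) * R" for R
  proof -
    have "exp (- \<sigma> * l * h) * exp (\<sigma>\<^sup>2 * h / 2) = exp ((\<sigma>\<^sup>2 / 2 - \<sigma> * l) * h)"
      unfolding exp_add[symmetric] by (simp add: algebra_simps)
    then show ?thesis unfolding mult.assoc[symmetric] by (simp add: ennreal_mult[symmetric])
  qed
  finally show ?thesis .
qed

text \<open>The maximum of the path as seen under the change of measure with density
  \<open>exp (- \<sigma> B\<^sub>h - \<sigma>\<^sup>2 h / 2)\<close>, which lowers the drift by \<open>\<sigma>\<close> on \<open>[0,h]\<close>.\<close>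

definition slowed_max :: "real \<Rightarrow> 'a \<Rightarrow> real" where
  "slowed_max h = running_max (\<lambda>s \<omega>. X s \<omega> - \<sigma> * min s h) T"

lemma continuous_slowed: "\<omega> \<in> space P \<Longrightarrow> continuous_on {0..T} (\<lambda>s. X s \<omega> - \<sigma> * min s h)"
  by (intro continuous_intros continuous_X)

lemma measurable_slowed_max [measurable]: "slowed_max h \<in> borel_measurable P"
  unfolding slowed_max_def
  by (intro measurable_running_max T_pos continuous_slowed borel_measurable_diff measurable_X borel_measurable_const)

lemma slowed_max_attained:
  assumes "\<omega> \<in> space P"
  obtains s where "s \<in> {0..T}" "slowed_max h \<omega> = X s \<omega> - \<sigma> * min s h"
  using running_max_attained[of T "\<lambda>s \<omega>. X s \<omega> - \<sigma> * min s h" \<omega>, OF less_imp_le[OF T_pos] continuous_slowed[OF assms]]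
  unfolding slowed_max_def by blast

lemma slowed_max_le_S:
  assumes \<omega>: "\<omega> \<in> space P" and h: "h \<ge> 0"
  shows "slowed_max h \<omega> \<le> S \<omega>"
proof -
  obtain s where s: "s \<in> {0..T}" "slowed_max h \<omega> = X s \<omega> - \<sigma> * min s h" by (rule slowed_max_attained[OF \<omega>])
  moreover have "0 \<le> \<sigma> * min s h" using s h \<sigma>_pos by auto
  ultimately show ?thesis using X_le_S[OF \<omega> s(1)] by linarith
qed

text \<open>The time is dyadic, hence fixed by the rounding at all levels from \<open>m\<close> on,
  and there the mesh maximum of the slowed path is at most its true maximum.\<close>

lemma exp_cost_le_slowed_max:
  fixes m :: nat
  defines "h \<equiv> T / 2 ^ m"
  shows "ennreal (exp_cost P \<sigma> X T (\<lambda>_. h)) \<le>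
    ennreal (exp ((\<sigma>\<^sup>2 / 2 - \<sigma> * l) * h)) * (\<integral>\<^sup>+\<omega>. ennreal (exp (\<sigma> * slowed_max h \<omega>)) \<partial>P)"
proof (rule LIMSEQ_le_const2)
  have h: "h \<in> {0..T}" using T_pos by (auto simp: h_def divide_le_eq mult_left_le)
  show "(\<lambda>n. mesh_cost n (mesh_time n (\<lambda>_. h))) \<longlonglongrightarrow> ennreal (exp_cost P \<sigma> X T (\<lambda>_. h))"
    by (rule mesh_cost_tendsto) (use h in auto)
  have "mesh_cost n (mesh_time n (\<lambda>_. h)) \<le>
      ennreal (exp ((\<sigma>\<^sup>2 / 2 - \<sigma> * l) * h)) * (\<integral>\<^sup>+\<omega>. ennreal (exp (\<sigma> * slowed_max h \<omega>)) \<partial>P)" if n: "m \<le> n" for n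
  proof -
    define k :: nat where "k = 2 ^ (n - m)"
    have k: "k \<le> 2 ^ n" by (simp add: k_def)
    have h_eq: "h = tick T n k"
    proof -
      have "(2 :: real) ^ n = 2 ^ m * 2 ^ (n - m)" using n by (simp flip: power_add)
      then show ?thesis by (simp add: h_def tick_def k_def)
    qed
    have "next_tick T n h = k"
      unfolding next_tick_def h_eq tick_le_iff[OF T_pos] by (rule Least_equality) auto
    then have "mesh_time n (\<lambda>_. h) = (\<lambda>_. tick T n k)" by (simp add: mesh_time_def fun_eq_iff)
    then have "mesh_cost n (mesh_time n (\<lambda>_. h)) = ennreal (exp ((\<sigma>\<^sup>2 / 2 - \<sigma> * l) * h)) *
        (\<integral>\<^sup>+\<omega>. ennreal (exp (\<sigma> * (SUP s\<in>mesh T n. X s \<omega> - \<sigma> * min s h))) \<partial>P)"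
      using mesh_cost_girsanov[OF k] by (simp add: h_eq)
    also have "\<dots> \<le> ennreal (exp ((\<sigma>\<^sup>2 / 2 - \<sigma> * l) * h)) * (\<integral>\<^sup>+\<omega>. ennreal (exp (\<sigma> * slowed_max h \<omega>)) \<partial>P)"
    proof (intro mult_left_mono nn_integral_mono ennreal_leI)
      fix \<omega> assume \<omega>: "\<omega> \<in> space P"
      have "(SUP s\<in>mesh T n. X s \<omega> - \<sigma> * min s h) \<le> slowed_max h \<omega>"
        unfolding slowed_max_def
        by (intro cSUP_least mesh_nonempty running_max_upper[where X="\<lambda>s \<omega>. X s \<omega> - \<sigma> * min s h"] continuous_slowed \<omega>)
          (use mesh_subset[OF T_pos, of n] in blast)
      then show "exp (\<sigma> * (SUP s\<in>mesh T n. X s \<omega> - \<sigma> * min s h)) \<le> exp (\<sigma> * slowed_max h \<omega>)"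
        using \<sigma>_pos by simp
    qed simp
    finally show ?thesis .
  qed
  then show "\<exists>N. \<forall>n\<ge>N. mesh_cost n (mesh_time n (\<lambda>_. h)) \<le>
      ennreal (exp ((\<sigma>\<^sup>2 / 2 - \<sigma> * l) * h)) * (\<integral>\<^sup>+\<omega>. ennreal (exp (\<sigma> * slowed_max h \<omega>)) \<partial>P)" by blast
qed

text \<open>The factor \<open>c\<close> and a full drop of the maximum multiply to
  \<open>exp (- \<kappa> * h)\<close> with
  \<open>\<kappa> = \<sigma> * (l + \<sigma> / 2) > 0\<close>, a gain of first order in
  \<open>h\<close>. Where the drop is incomplete, the loss carries the factor
  \<open>1 - exp (- \<sigma>\<^sup>2 * h)\<close>, also of first order, but against a mass
  \<open>p\<close> that tends to zero.\<close>

proposition initial_time_not_optimal: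
  assumes l: "l > - \<sigma> / 2"
  shows "\<exists>\<tau>\<in>stopping_times P B T. exp_cost P \<sigma> X T \<tau> < exp_cost P \<sigma> X T (\<lambda>_. 0)"
proof -
  define h where "h m = T / 2 ^ m" for m :: nat
  have h_pos: "0 < h m" for m using T_pos by (simp add: h_def)
  have h_mem: "h m \<in> {0..T}" for m using T_pos by (auto simp: h_def divide_le_eq mult_left_le)
  have h_0: "h \<longlonglongrightarrow> 0"
    unfolding h_def by (intro real_tendsto_divide_at_top[OF tendsto_const]) real_asymp
  define C where "C = exp_cost P \<sigma> X T (\<lambda>_. 0)"
  have C_eq: "C = (\<integral>\<omega>. exp (\<sigma> * S \<omega>) \<partial>P)"
    unfolding C_def exp_cost_def by (intro Bochner_Integration.integral_cong) (auto simp: X_0)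
  have expS_dom: "exp (\<sigma> * S \<omega>) \<le> dominator \<omega>" if "\<omega> \<in> space P" for \<omega>
    using exp_S_le_dominator[OF that, of 0] T_pos X_0[OF that] by simp
  have int_S: "integrable P (\<lambda>\<omega>. exp (\<sigma> * S \<omega>))"
    using expS_dom by (intro Bochner_Integration.integrable_bound[OF integrable_dominator] AE_I2)
      (auto intro: order_trans[OF _ abs_ge_self])
  define E where "E m = {\<omega>\<in>space P. slowed_max (h m) \<omega> > S \<omega> - \<sigma> * h m}" for m
  have [measurable]: "E m \<in> events" for m unfolding E_def by measurable
  have int_E: "integrable P (\<lambda>\<omega>. indicator (E m) \<omega> * exp (\<sigma> * S \<omega>))" for m
    using integrable_real_mult_indicator[OF _ int_S, of "E m"] by (simp add: mult.commute)
  define p where "p m = (\<integral>\<omega>. indicator (E m) \<omega> * exp (\<sigma> * S \<omega>) \<partial>P)" for m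
  have p_0: "p \<longlonglongrightarrow> 0"
  proof -
    have "(\<lambda>m. \<integral>\<omega>. indicator (E m) \<omega> * exp (\<sigma> * S \<omega>) \<partial>P) \<longlonglongrightarrow> (\<integral>\<omega>. 0 \<partial>P)"
    proof (rule integral_dominated_convergence[OF _ _ int_S])
      show "AE \<omega> in P. norm (indicator (E m) \<omega> * exp (\<sigma> * S \<omega>)) \<le> exp (\<sigma> * S \<omega>)" for m
        by (intro AE_I2) (simp split: split_indicator)
      \<comment> \<open>Continuity at \<open>0\<close> keeps the path below half the maximum on an
        initial stretch. Once \<open>h\<close> fits into it and \<open>\<sigma> * h\<close> is below
        half the maximum, a maximiser of the slowed path either lies at or past \<open>h\<close>,
        where the drop is complete, or has value at most \<open>S / 2\<close>, which is below
        \<open>S - \<sigma> * h\<close>.\<close>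
      show "AE \<omega> in P. (\<lambda>m. indicator (E m) \<omega> * exp (\<sigma> * S \<omega>)) \<longlonglongrightarrow> 0"
        using AE_S_pos AE_space
      proof eventually_elim
        case (elim \<omega>)
        have "((\<lambda>s. X s \<omega>) \<longlongrightarrow> X 0 \<omega>) (at 0 within {0..T})"
          using continuous_X[OF elim(2)] T_pos by (simp add: continuous_on)
        moreover have "X 0 \<omega> < S \<omega> / 2" using elim X_0 by simp
        ultimately have "\<forall>\<^sub>F s in at 0 within {0..T}. X s \<omega> < S \<omega> / 2" by (rule order_tendstoD(2))
        then obtain d where d: "d > 0" "\<And>s. s \<in> {0..T} \<Longrightarrow> s \<noteq> 0 \<Longrightarrow> dist s 0 < d \<Longrightarrow> X s \<omega> < S \<omega> / 2"
          unfolding eventually_at by blast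
        have "\<forall>\<^sub>F m in sequentially. h m < d" using h_0 d(1) by (rule order_tendstoD(2))
        moreover have "\<forall>\<^sub>F m in sequentially. h m < S \<omega> / (2 * \<sigma>)"
          using elim \<sigma>_pos by (intro order_tendstoD(2)[OF h_0]) simp
        ultimately have "\<forall>\<^sub>F m in sequentially. \<omega> \<notin> E m"
        proof eventually_elim
          case (elim m)
          have \<sigma>h: "\<sigma> * h m < S \<omega> / 2" using elim \<sigma>_pos by (simp add: field_simps)
          obtain s where s: "s \<in> {0..T}" "slowed_max (h m) \<omega> = X s \<omega> - \<sigma> * min s (h m)"
            by (rule slowed_max_attained[OF \<open>\<omega> \<in> space P\<close>])
          have "slowed_max (h m) \<omega> \<le> S \<omega> - \<sigma> * h m"
          proof (cases "s < h m")
            case True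
            have "X s \<omega> \<le> S \<omega> / 2"
              using d(2)[OF s(1)] True elim(1) s(1) \<open>X 0 \<omega> < S \<omega> / 2\<close> by (cases "s = 0") auto
            moreover have "0 \<le> \<sigma> * min s (h m)" using s(1) h_pos[of m] \<sigma>_pos by auto
            ultimately show ?thesis using \<sigma>h s(2) by linarith
          next
            case False
            then show ?thesis using X_le_S[OF \<open>\<omega> \<in> space P\<close> s(1)] s(2) by (simp add: min.absorb2)
          qed
          then show "\<omega> \<notin> E m" by (simp add: E_def)
        qed
        then show ?case by (rule tendsto_eventually[OF eventually_mono]) simp
      qed
    qed measurable
    then show ?thesis by (simp add: p_def[abs_def])
  qed
  have p_nonneg: "0 \<le> p m" for m by (simp add: p_def)
  define \<kappa> where "\<kappa> = \<sigma>\<^sup>2 / 2 + \<sigma> * l"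
  have "\<sigma> * (- \<sigma> / 2) < \<sigma> * l" using l \<sigma>_pos by (intro mult_strict_left_mono)
  then have \<kappa>: "\<kappa> > 0" by (simp add: \<kappa>_def power2_eq_square)
  define c where "c m = exp ((\<sigma>\<^sup>2 / 2 - \<sigma> * l) * h m)" for m
  have bound: "exp_cost P \<sigma> X T (\<lambda>_. h m) \<le> exp (- \<kappa> * h m) * C + c m * ((1 - exp (- \<sigma>\<^sup>2 * h m)) * p m)" for m
  proof -
    define d where "d = exp (- \<sigma>\<^sup>2 * h m)"
    have d: "0 < d" "d \<le> 1" using h_pos[of m] by (auto simp: d_def)
    have cd: "c m * d = exp (- \<kappa> * h m)"
      by (simp add: c_def d_def \<kappa>_def exp_add[symmetric] algebra_simps)
    have int: "integrable P (\<lambda>\<omega>. d * exp (\<sigma> * S \<omega>) + (1 - d) * (indicator (E m) \<omega> * exp (\<sigma> * S \<omega>)))"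
      by (intro Bochner_Integration.integrable_add integrable_mult_right int_S int_E)
    have "(\<integral>\<^sup>+\<omega>. ennreal (exp (\<sigma> * slowed_max (h m) \<omega>)) \<partial>P)
        \<le> (\<integral>\<^sup>+\<omega>. ennreal (d * exp (\<sigma> * S \<omega>) + (1 - d) * (indicator (E m) \<omega> * exp (\<sigma> * S \<omega>))) \<partial>P)"
    proof (intro nn_integral_mono ennreal_leI)
      fix \<omega> assume \<omega>: "\<omega> \<in> space P"
      show "exp (\<sigma> * slowed_max (h m) \<omega>) \<le> d * exp (\<sigma> * S \<omega>) + (1 - d) * (indicator (E m) \<omega> * exp (\<sigma> * S \<omega>))"
      proof (cases "\<omega> \<in> E m")
        case True
        have "exp (\<sigma> * slowed_max (h m) \<omega>) \<le> exp (\<sigma> * S \<omega>)"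
          using slowed_max_le_S[OF \<omega> less_imp_le[OF h_pos]] \<sigma>_pos by simp
        then show ?thesis using True by (simp add: algebra_simps)
      next
        case False
        then have "slowed_max (h m) \<omega> \<le> S \<omega> - \<sigma> * h m" using \<omega> by (simp add: E_def)
        then have "\<sigma> * slowed_max (h m) \<omega> \<le> \<sigma> * (S \<omega> - \<sigma> * h m)" using \<sigma>_pos by (intro mult_left_mono) auto
        then have "exp (\<sigma> * slowed_max (h m) \<omega>) \<le> exp (- \<sigma>\<^sup>2 * h m + \<sigma> * S \<omega>)"
          by (simp add: algebra_simps power2_eq_square)
        then show ?thesis using False unfolding exp_add by (simp add: d_def)
      qed
    qed
    also have "\<dots> = ennreal (\<integral>\<omega>. d * exp (\<sigma> * S \<omega>) + (1 - d) * (indicator (E m) \<omega> * exp (\<sigma> * S \<omega>)) \<partial>P)"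
      using d by (intro nn_integral_eq_integral int AE_I2) simp
    also have "(\<integral>\<omega>. d * exp (\<sigma> * S \<omega>) + (1 - d) * (indicator (E m) \<omega> * exp (\<sigma> * S \<omega>)) \<partial>P) = d * C + (1 - d) * p m"
      unfolding C_eq p_def
      by (subst Bochner_Integration.integral_add) (auto intro: int_S int_E)
    finally have "ennreal (c m) * (\<integral>\<^sup>+\<omega>. ennreal (exp (\<sigma> * slowed_max (h m) \<omega>)) \<partial>P) \<le> ennreal (c m) * ennreal (d * C + (1 - d) * p m)"
      by (intro mult_left_mono) auto
    then have "ennreal (exp_cost P \<sigma> X T (\<lambda>_. h m)) \<le> ennreal (c m * (d * C + (1 - d) * p m))"
      using exp_cost_le_slowed_max[of m] by (simp add: h_def[symmetric] c_def[symmetric] ennreal_mult') (simp add: c_def ennreal_mult')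
    moreover have "0 \<le> c m * (d * C + (1 - d) * p m)"
      using d p_nonneg exp_cost_nonneg by (auto simp: c_def C_def intro!: mult_nonneg_nonneg add_nonneg_nonneg)
    ultimately have "exp_cost P \<sigma> X T (\<lambda>_. h m) \<le> c m * (d * C + (1 - d) * p m)"
      by (simp add: ennreal_le_iff)
    also have "\<dots> = exp (- \<kappa> * h m) * C + c m * ((1 - d) * p m)"
      unfolding cd[symmetric] by (simp add: algebra_simps)
    finally show ?thesis by (simp add: d_def)
  qed
  have C_pos: "C > 0"
  proof -
    have "1 = (\<integral>\<omega>. (1 :: real) \<partial>P)" by (simp add: prob_space)
    also have "\<dots> \<le> C" unfolding C_eq
    proof (rule integral_mono)
      fix \<omega> assume \<omega>: "\<omega> \<in> space P"
      have "0 \<le> S \<omega>" using X_le_S[OF \<omega>, of 0] X_0[OF \<omega>] T_pos by simp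
      then show "1 \<le> exp (\<sigma> * S \<omega>)" using \<sigma>_pos by simp
    qed (use int_S in auto)
    finally show ?thesis by simp
  qed
  have "c \<longlonglongrightarrow> exp ((\<sigma>\<^sup>2 / 2 - \<sigma> * l) * 0)"
    unfolding c_def by (intro tendsto_intros h_0)
  then have "\<forall>\<^sub>F m in sequentially. c m < 2" by (rule order_tendstoD(2)) simp
  \<comment> \<open>Calibrated so that, with \<open>c m < 2\<close>, the loss is at most
    \<open>2 * \<sigma>\<^sup>2 * h m * p m\<close> and stays below
    \<open>\<kappa> * h m * C / 2\<close>, the guaranteed part of the gain.\<close>
  moreover have "\<forall>\<^sub>F m in sequentially. p m < C * \<kappa> / (4 * \<sigma>\<^sup>2)"
    using C_pos \<kappa> \<sigma>_pos by (intro order_tendstoD(2)[OF p_0]) simp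
  moreover have "\<forall>\<^sub>F m in sequentially. h m < 1 / \<kappa>"
    using \<kappa> by (intro order_tendstoD(2)[OF h_0]) simp
  ultimately have "\<forall>\<^sub>F m in sequentially. exp_cost P \<sigma> X T (\<lambda>_. h m) < C"
  proof eventually_elim
    case (elim m)
    let ?x = "\<kappa> * h m"
    have x: "0 < ?x" "?x < 1" using \<kappa> h_pos[of m] elim(3) by (auto simp: field_simps)
    \<comment> \<open>A linear upper bound for the exponential on \<open>(0,1)\<close>, at the price
      of half its slope.\<close>
    have "exp (- ?x) = 1 / exp ?x" by (simp add: exp_minus divide_inverse)
    also have "\<dots> \<le> 1 / (1 + ?x)"
      using exp_ge_add_one_self[of ?x] x by (intro divide_left_mono) (auto intro!: mult_pos_pos add_pos_pos)
    also have "\<dots> \<le> 1 - ?x / 2"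
    proof -
      have "1 \<le> (1 - ?x / 2) * (1 + ?x)" using mult_strict_left_mono[OF x(2) x(1)] by (simp add: algebra_simps)
      then show ?thesis using x by (simp add: divide_le_eq)
    qed
    finally have "exp (- \<kappa> * h m) * C \<le> (1 - ?x / 2) * C" using C_pos by (intro mult_right_mono) auto
    moreover have "c m * ((1 - exp (- \<sigma>\<^sup>2 * h m)) * p m) \<le> 2 * ((\<sigma>\<^sup>2 * h m) * p m)"
      using elim(1) p_nonneg[of m] h_pos[of m] exp_ge_add_one_self[of "- \<sigma>\<^sup>2 * h m"]
      by (intro mult_mono mult_right_mono mult_nonneg_nonneg) (auto simp: c_def)
    moreover have "2 * ((\<sigma>\<^sup>2 * h m) * p m) < ?x / 2 * C"
    proof -
      have "2 * (\<sigma>\<^sup>2 * h m) * p m < 2 * (\<sigma>\<^sup>2 * h m) * (C * \<kappa> / (4 * \<sigma>\<^sup>2))"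
        using elim(2) h_pos[of m] \<sigma>_pos by (intro mult_strict_left_mono) auto
      also have "\<dots> = ?x / 2 * C" using \<sigma>_pos by (simp add: field_simps)
      finally show ?thesis by (simp add: mult.assoc)
    qed
    ultimately show ?case using bound[of m] by (simp add: algebra_simps)
  qed
  then obtain m where "exp_cost P \<sigma> X T (\<lambda>_. h m) < C"
    using eventually_happens'[OF sequentially_bot] by blast
  then show ?thesis
    unfolding C_def by (intro bexI[of _ "\<lambda>_. h m"] const_stopping_times h_mem)
qed

end

section \<open>Optimality in the original prediction problem\<close>

lemma is_optimalI:
  assumes "\<tau> \<in> \<T>" "\<And>\<tau>'. \<tau>' \<in> \<T> \<Longrightarrow> J \<tau> \<le> J \<tau>'"
  shows "is_optimal \<T> J \<tau>"
  unfolding is_optimal_def using assms by (intro conjI cInf_eq_minimum[symmetric]) auto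


theorem theorem3:
  fixes P :: "'a measure" and B Z B\<^sub>l :: "real \<Rightarrow> 'a \<Rightarrow> real" and Z0 :: "'a \<Rightarrow> real"
    and T \<sigma> \<mu> l V\<^sub>1 :: real
  assumes "T > 0" and "\<sigma> > 0"
    and "brownian_motion P B T"
    and "Z0 \<in> borel_measurable P" and "\<forall>\<omega>\<in>space P. Z0 \<omega> > 0"
    and "prob_space.indep_set P (sets (vimage_algebra (space P) Z0 borel))
           (sets (natural_filtration P B T))"
    and "Z = geometric_bm Z0 B \<mu> \<sigma>"
    and "l = (\<mu> - \<sigma>\<^sup>2 / 2) / \<sigma>"
    and "B\<^sub>l = with_drift B l"
    and "V\<^sub>1 = (INF \<tau>\<in>stopping_times P Z T. ratio_cost P Z T \<tau>)"
  shows "V\<^sub>1 = (INF \<tau>\<in>stopping_times P B T. ratio_cost P Z T \<tau>)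
    \<and> V\<^sub>1 = (INF \<tau>\<in>stopping_times P Z T. exp_cost P \<sigma> B\<^sub>l T \<tau>)
    \<and> V\<^sub>1 = (INF \<tau>\<in>stopping_times P B T. exp_cost P \<sigma> B\<^sub>l T \<tau>)
    \<and> (l \<ge> \<sigma> / 2 \<longrightarrow> (\<forall>\<tau>\<in>stopping_times P B T.
          exp_cost P \<sigma> B\<^sub>l T \<tau> \<ge> (\<integral>\<omega>. exp (\<sigma> * (running_max B\<^sub>l T \<omega> - B\<^sub>l T \<omega>)) \<partial>P)))
    \<and> (l \<le> - \<sigma> / 2 \<longrightarrow> (\<forall>\<tau>\<in>stopping_times P B T.
          exp_cost P \<sigma> B\<^sub>l T \<tau> \<ge> (\<integral>\<omega>. exp (\<sigma> * running_max B\<^sub>l T \<omega>) \<partial>P)))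
    \<and> (\<mu> \<ge> \<sigma>\<^sup>2 \<longrightarrow>
          is_optimal (stopping_times P Z T) (ratio_cost P Z T) (\<lambda>_. T) \<and>
          is_optimal (stopping_times P B T) (exp_cost P \<sigma> B\<^sub>l T) (\<lambda>_. T))
    \<and> (\<mu> \<le> 0 \<longrightarrow>
          is_optimal (stopping_times P Z T) (ratio_cost P Z T) (\<lambda>_. 0) \<and>
          is_optimal (stopping_times P B T) (exp_cost P \<sigma> B\<^sub>l T) (\<lambda>_. 0))
    \<and> (l < \<sigma> / 2 \<longrightarrow> \<not> (\<forall>\<tau>\<in>stopping_times P B T.
          exp_cost P \<sigma> B\<^sub>l T \<tau> \<ge> (\<integral>\<omega>. exp (\<sigma> * (running_max B\<^sub>l T \<omega> - B\<^sub>l T \<omega>)) \<partial>P)))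
    \<and> (l > - \<sigma> / 2 \<longrightarrow> \<not> (\<forall>\<tau>\<in>stopping_times P B T.
          exp_cost P \<sigma> B\<^sub>l T \<tau> \<ge> (\<integral>\<omega>. exp (\<sigma> * running_max B\<^sub>l T \<omega>) \<partial>P)))"
proof -
  interpret brownian_motion P B T by fact
  have drift: "\<sigma> * l = \<mu> - \<sigma>\<^sup>2 / 2" using assms(2,8) by simp
  interpret predicted_gbm P B T \<sigma> l Z0 Z
  proof unfold_locales
    fix t \<omega>
    have "\<sigma> * with_drift B l t \<omega> = \<sigma> * B t \<omega> + (\<sigma> * l) * t" by (simp add: with_drift_def algebra_simps)
    then show "Z t \<omega> = Z0 \<omega> * exp (\<sigma> * with_drift B l t \<omega>)" by (simp only: assms(7) geometric_bm_def drift)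
  qed (use assms in auto)
  note B\<^sub>l = assms(9)
  have ratio_B: "ratio_cost P Z T \<tau> = exp_cost P \<sigma> X T \<tau>" if "\<tau> \<in> stopping_times P B T" for \<tau>
    by (rule ratio_cost_eq_exp_cost[OF stopping_times_range[OF that]])
  have ratio_Z: "ratio_cost P Z T \<tau> = exp_cost P \<sigma> X T \<tau>" if "\<tau> \<in> stopping_times P Z T" for \<tau>
    by (rule ratio_cost_eq_exp_cost[OF stopping_times_range[OF that]])
  have V1_Z: "V\<^sub>1 = (INF \<tau>\<in>stopping_times P Z T. exp_cost P \<sigma> X T \<tau>)"
    unfolding assms(10) by (intro INF_cong refl ratio_Z)
  then have V1_B: "V\<^sub>1 = (INF \<tau>\<in>stopping_times P B T. exp_cost P \<sigma> X T \<tau>)"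
    by (simp only: INF_stopping_times_Z_eq_B)
  have V1_ratio: "V\<^sub>1 = (INF \<tau>\<in>stopping_times P B T. ratio_cost P Z T \<tau>)"
    unfolding V1_B by (intro INF_cong refl ratio_B[symmetric])
  have cost_T: "(\<integral>\<omega>. exp (\<sigma> * (S \<omega> - X T \<omega>)) \<partial>P) = exp_cost P \<sigma> X T (\<lambda>_. T)"
    by (simp only: exp_cost_def)
  have cost_0: "(\<integral>\<omega>. exp (\<sigma> * S \<omega>) \<partial>P) = exp_cost P \<sigma> X T (\<lambda>_. 0)"
    unfolding exp_cost_def by (intro Bochner_Integration.integral_cong) (auto simp: X_0)
  \<comment> \<open>Both classes have the same infimum, so a constant time that attains it among
    stopping times of \<open>B\<close> attains it among those of \<open>Z\<close>; no direct
    comparison with each stopping time of \<open>Z\<close> is made.\<close>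
  have optimal: "is_optimal (stopping_times P Z T) (ratio_cost P Z T) (\<lambda>_. c) \<and>
      is_optimal (stopping_times P B T) (exp_cost P \<sigma> X T) (\<lambda>_. c)"
    if c: "c \<in> {0..T}" and min: "\<And>\<tau>. \<tau> \<in> stopping_times P B T \<Longrightarrow> exp_cost P \<sigma> X T (\<lambda>_. c) \<le> exp_cost P \<sigma> X T \<tau>"
    for c
  proof
    show opt: "is_optimal (stopping_times P B T) (exp_cost P \<sigma> X T) (\<lambda>_. c)"
      by (intro is_optimalI const_stopping_times c min)
    show "is_optimal (stopping_times P Z T) (ratio_cost P Z T) (\<lambda>_. c)"
      using opt ratio_Z[OF const_stopping_times[OF c]] const_stopping_times[OF c]
      by (simp only: is_optimal_def V1_B[symmetric] assms(10)[symmetric] simp_thms)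
  qed
  have terminal: "exp_cost P \<sigma> X T (\<lambda>_. T) \<le> exp_cost P \<sigma> X T \<tau>"
    if "l \<ge> \<sigma> / 2" "\<tau> \<in> stopping_times P B T" for \<tau>
    using that by (rule exp_cost_ge_terminal)
  have initial: "exp_cost P \<sigma> X T (\<lambda>_. 0) \<le> exp_cost P \<sigma> X T \<tau>"
    if "l \<le> - \<sigma> / 2" "\<tau> \<in> stopping_times P B T" for \<tau>
    using that by (rule exp_cost_ge_initial)
  have \<mu>_large: "l \<ge> \<sigma> / 2" if "\<mu> \<ge> \<sigma>\<^sup>2"
    using that assms(2) unfolding assms(8) by (simp add: field_simps power2_eq_square)
  have \<mu>_small: "l \<le> - \<sigma> / 2" if "\<mu> \<le> 0"
    using that assms(2) unfolding assms(8) by (simp add: field_simps power2_eq_square)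
  have T_opt: "is_optimal (stopping_times P Z T) (ratio_cost P Z T) (\<lambda>_. T) \<and>
      is_optimal (stopping_times P B T) (exp_cost P \<sigma> X T) (\<lambda>_. T)" if "\<mu> \<ge> \<sigma>\<^sup>2"
    using assms(1) by (intro optimal terminal \<mu>_large that) auto
  have zero_opt: "is_optimal (stopping_times P Z T) (ratio_cost P Z T) (\<lambda>_. 0) \<and>
      is_optimal (stopping_times P B T) (exp_cost P \<sigma> X T) (\<lambda>_. 0)" if "\<mu> \<le> 0"
    using assms(1) by (intro optimal initial \<mu>_small that) auto
  show ?thesis
    unfolding B\<^sub>l cost_T cost_0
  proof (intro conjI[OF V1_ratio] conjI[OF V1_Z] conjI[OF V1_B] conjI impI ballI)
    show "\<not> (\<forall>\<tau>\<in>stopping_times P B T. exp_cost P \<sigma> X T (\<lambda>_. T) \<le> exp_cost P \<sigma> X T \<tau>)" if "l < \<sigma> / 2"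
      using terminal_time_not_optimal[OF that] by (auto simp: not_le)
    show "\<not> (\<forall>\<tau>\<in>stopping_times P B T. exp_cost P \<sigma> X T (\<lambda>_. 0) \<le> exp_cost P \<sigma> X T \<tau>)" if "l > - \<sigma> / 2"
      using initial_time_not_optimal[OF that] by (auto simp: not_le)
  qed (use terminal initial T_opt zero_opt in blast)+
qed

end
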